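(* Let $P$ be a finite poset. Then there exists an $\mathbb{N}$-graded Gorenstein tiled order $A$ over $R=k[x]$ such that the algebra $\Gamma_A$ is isomorphic to the incidence algebra $kP$ if and only if $P$ is either the empty poset or has a maximum.
   Context: Let $k$ be a field, $R=k[x]$, $K=k[x,x^{-1}]$, graded by $\deg x=1$. Modules are right modules. For a $\mathbb{Z}$-graded vector space $M$, $M(1)_n=M_{n+1}$ and $M_{\ge 0}=\bigoplus_{n\ge 0}M_n$. A tiled order (over $R$) of size $n\geq 1$ is an $R$-subalgebra $A=[Rx^{d(i,j)}]_{1\le i,j\le n}\subseteq \mathrm{M}_n(K)$ with integers $d(i,j)$ satisfying $d(i,i)=0$ and $d(i,l)+d(l,j)\ge d(i,j)$ for all $i,j,l$. It is $\mathbb{Z}$-graded by $\mathrm{M}_n(K)_j=\mathrm{M}_n(k)x^j$; it is $\mathbb{N}$-graded iff all $d(i,j)\ge 0$. Let $e_i$ be the diagonal matrix units. Fix $\mathbb{I}\subseteq\{1,\dots,n\}$, a complete set of representatives for $i\sim j \iff e_iA\simeq e_jA$ as ungraded modules (equivalently $d(i,j)+d(j,i)=0$). $A$ is Gorenstein if the graded right $A$-module $\mathrm{Hom}_R(A,R(-1))$ is projective; equivalently there is a (unique) bijection $\nu:\mathbb{I}\to\mathbb{I}$ (the Nakayama permutation) with $d(\nu i,j)+d(j,i)=d(\nu i,i)$ for all $i\in\mathbb{I}$ and $1\le j\le n$. Put $p_i=1-d(\nu i,i)$, $i\in\mathbb{I}$. $\mathrm{CM}^{\mathbb{Z}}A$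 is the Frobenius category of finitely generated graded $A$-modules that are projective over $R$, with degree-$0$ homomorphisms, and $\underline{\mathrm{CM}}^{\mathbb{Z}}A$ is its stable category (modulo maps factoring through graded projectives). For $\mathbb{N}$-graded Gorenstein $A$ put $V=[R\ \cdots\ R]\oplus\bigoplus_{i\in\mathbb{I}}\bigoplus_{j=1}^{-p_i}e_{\nu i}A(j)_{\ge 0}$ ($n$ entries in the row module $[R\ \cdots\ R]$; empty sums are zero) and $\Gamma_A=\mathrm{End}_{\underline{\mathrm{CM}}^{\mathbb{Z}}A}(V)$. For a finite poset $P$, the incidence algebra $kP$ has basis $\{(y,x): x\le y\}$ with $(z,y)(y,x)=(z,x)$ and all other products zero; so $e_y(kP)e_x\neq0$ iff $x\le y$ (paths in the Hasse quiver, with arrows going upward, are composed like maps). $kP=0$ if $P$ is empty. *)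

theory Defs
  imports
    "HOL-Algebra.QuotRing"
    "HOL-Algebra.Generated_Groups"
    "HOL-Library.Poly_Mapping"
    "Jordan_Normal_Form.Matrix"
begin

section \<open>Graded algebras and graded right modules\<close>

text \<open>
  A k-algebra is a record of type \<open>('k, 'a) module\<close> from HOL-Algebra: the ring operations
  together with the scalar multiplication. The field is the type \<open>'k\<close>.
\<close>

record ('k, 'a) graded_algebra = "('k, 'a) module" +
  deg_part :: "int \<Rightarrow> 'a set"

text \<open>
  As for modules in HOL-Algebra, a module extends the record \<open>ring\<close> in order to be an
  \<^locale>\<open>abelian_group\<close>; the fields \<open>mult\<close> and \<open>one\<close> carry no information. The type \<open>'a\<close>
  is that of the elements of the algebra, which acts on the right through \<open>ract\<close>.
\<close>

record ('a, 'm) gmod = "'m ring" +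
  ract :: "'m \<Rightarrow> 'a \<Rightarrow> 'm"
  gr :: "int \<Rightarrow> 'm set"

definition nonneg_graded :: "('k, 'a) graded_algebra \<Rightarrow> bool" where
  "nonneg_graded A \<longleftrightarrow> (\<forall>m<0. deg_part A m = {\<zero>\<^bsub>A\<^esub>})"

definition right_module :: "('k, 'a) graded_algebra \<Rightarrow> ('a, 'm) gmod \<Rightarrow> bool" where
  "right_module A M \<longleftrightarrow>
     abelian_group M \<and>
     (\<forall>v\<in>carrier M. ract M v \<one>\<^bsub>A\<^esub> = v) \<and>
     (\<forall>v\<in>carrier M. \<forall>a\<in>carrier A. ract M v a \<in> carrier M) \<and>
     (\<forall>v\<in>carrier M. \<forall>a\<in>carrier A. \<forall>b\<in>carrier A.
        ract M v (a \<otimes>\<^bsub>A\<^esub> b) = ract M (ract M v a) b \<and>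
        ract M v (a \<oplus>\<^bsub>A\<^esub> b) = ract M v a \<oplus>\<^bsub>M\<^esub> ract M v b) \<and>
     (\<forall>v\<in>carrier M. \<forall>w\<in>carrier M. \<forall>a\<in>carrier A.
        ract M (v \<oplus>\<^bsub>M\<^esub> w) a = ract M v a \<oplus>\<^bsub>M\<^esub> ract M w a)"

definition graded_module :: "('k, 'a) graded_algebra \<Rightarrow> ('a, 'm) gmod \<Rightarrow> bool" where
  "graded_module A M \<longleftrightarrow>
     right_module A M \<and>
     (\<forall>m. additive_subgroup (gr M m) M) \<and>
     (\<forall>v\<in>carrier M. \<exists>!c. (\<forall>m. c m \<in> gr M m) \<and> finite {m. c m \<noteq> \<zero>\<^bsub>M\<^esub>} \<and>
        v = (\<Oplus>\<^bsub>M\<^esub>m\<in>{m. c m \<noteq> \<zero>\<^bsub>M\<^esub>}. c m)) \<and>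
     (\<forall>m l. \<forall>v\<in>gr M m. \<forall>a\<in>deg_part A l. ract M v a \<in> gr M (m + l))"

text \<open>Homomorphisms are extensional on the carrier, so that equality of maps is HOL equality.\<close>

definition module_hom ::
  "('k, 'a) graded_algebra \<Rightarrow> ('a, 'm) gmod \<Rightarrow> ('a, 'n) gmod \<Rightarrow> ('m \<Rightarrow> 'n) set" where
  "module_hom A M N =
     {f \<in> carrier M \<rightarrow>\<^sub>E carrier N.
        (\<forall>v\<in>carrier M. \<forall>w\<in>carrier M. f (v \<oplus>\<^bsub>M\<^esub> w) = f v \<oplus>\<^bsub>N\<^esub> f w) \<and>
        (\<forall>v\<in>carrier M. \<forall>a\<in>carrier A. f (ract M v a) = ract N (f v) a)}"

definition graded_hom ::
  "('k, 'a) graded_algebra \<Rightarrow> ('a, 'm) gmod \<Rightarrow> ('a, 'n) gmod \<Rightarrow> ('m \<Rightarrow> 'n) set" where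
  "graded_hom A M N = {f \<in> module_hom A M N. \<forall>m. f ` gr M m \<subseteq> gr N m}"

definition module_isomorphic ::
  "('k, 'a) graded_algebra \<Rightarrow> ('a, 'm) gmod \<Rightarrow> ('a, 'n) gmod \<Rightarrow> bool" where
  "module_isomorphic A M N \<longleftrightarrow> (\<exists>f\<in>module_hom A M N. bij_betw f (carrier M) (carrier N))"

definition shift :: "('a, 'm) gmod \<Rightarrow> int \<Rightarrow> ('a, 'm) gmod" where
  "shift M j = M\<lparr>gr := \<lambda>m. gr M (m + j)\<rparr>"

text \<open>The submodule generated additively by the homogeneous elements of degree at least 0.\<close>

definition trunc :: "('a, 'm) gmod \<Rightarrow> ('a, 'm) gmod" where
  "trunc M = M\<lparr>carrier := generate (add_monoid M) (\<Union>m\<in>{0..}. gr M m),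
               gr := \<lambda>m. if 0 \<le> m then gr M m else {\<zero>\<^bsub>M\<^esub>}\<rparr>"

text \<open>A direct sum only for finite \<open>J\<close>, the only case needed.\<close>

definition direct_sum :: "'j set \<Rightarrow> ('j \<Rightarrow> ('a, 'm) gmod) \<Rightarrow> ('a, 'j \<Rightarrow> 'm) gmod" where
  "direct_sum J M =
     \<lparr>carrier = (\<Pi>\<^sub>E j\<in>J. carrier (M j)), monoid.mult = undefined, one = undefined,
      zero = (\<lambda>j\<in>J. \<zero>\<^bsub>M j\<^esub>),
      add = (\<lambda>v w. \<lambda>j\<in>J. v j \<oplus>\<^bsub>M j\<^esub> w j),
      ract = (\<lambda>v a. \<lambda>j\<in>J. ract (M j) (v j) a),
      gr = (\<lambda>m. \<Pi>\<^sub>E j\<in>J. gr (M j) m)\<rparr>"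

definition right_ideal :: "('k, 'a) graded_algebra \<Rightarrow> 'a set \<Rightarrow> ('a, 'a) gmod" where
  "right_ideal A S =
     \<lparr>carrier = S, monoid.mult = undefined, one = undefined, zero = \<zero>\<^bsub>A\<^esub>, add = add A,
      ract = monoid.mult A, gr = (\<lambda>m. S \<inter> deg_part A m)\<rparr>"

definition regular :: "('k, 'a) graded_algebra \<Rightarrow> ('a, 'a) gmod" where
  "regular A = right_ideal A (carrier A)"

definition restrict_scalars :: "('b \<Rightarrow> 'a) \<Rightarrow> ('a, 'm) gmod \<Rightarrow> ('b, 'm) gmod" where
  "restrict_scalars \<phi> M =
     \<lparr>carrier = carrier M, monoid.mult = undefined, one = undefined, zero = \<zero>\<^bsub>M\<^esub>, add = add M,
      ract = (\<lambda>v b. ract M v (\<phi> b)), gr = gr M\<rparr>"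

definition fin_gen :: "('k, 'a) graded_algebra \<Rightarrow> ('a, 'm) gmod \<Rightarrow> bool" where
  "fin_gen A M \<longleftrightarrow>
     (\<exists>S\<subseteq>carrier M. finite S \<and>
        (\<forall>v\<in>carrier M. \<exists>c\<in>S \<rightarrow> carrier A. v = (\<Oplus>\<^bsub>M\<^esub>s\<in>S. ract M s (c s))))"

text \<open>
  Finitely generated graded projective modules: graded direct summands (retracts by maps of
  degree 0) of finite direct sums of shifts of the regular module. For a finitely generated
  graded module this is equivalent to projectivity, both in the graded category and after
  forgetting the grading.
\<close>

definition graded_projective :: "('k, 'a) graded_algebra \<Rightarrow> ('a, 'm) gmod \<Rightarrow> bool" where
  "graded_projective A M \<longleftrightarrow>
     graded_module A M \<and>
     (\<exists>(r::nat) (t::nat \<Rightarrow> int).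
        let F = direct_sum {..<r} (\<lambda>s. shift (regular A) (t s))
        in \<exists>i\<in>graded_hom A M F. \<exists>p\<in>graded_hom A F M. \<forall>v\<in>carrier M. p (i v) = v)"

text \<open>
  The graded right A-module of S-linear maps from A to N, where A is an S-module via \<open>\<phi>\<close>.
  The element \<open>a\<close> sends \<open>f\<close> to \<open>b \<mapsto> f (a b)\<close>. Since A is finitely generated over S, every
  S-linear map is a finite sum of homogeneous ones.
\<close>

definition Hom_module ::
  "('k, 'b) graded_algebra \<Rightarrow> ('b \<Rightarrow> 'a) \<Rightarrow> ('k, 'a) graded_algebra \<Rightarrow> ('b, 'n) gmod
     \<Rightarrow> ('a, 'a \<Rightarrow> 'n) gmod" where
  "Hom_module S \<phi> A N =
     (let H = module_hom S (restrict_scalars \<phi> (regular A)) N in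
     \<lparr>carrier = H, monoid.mult = undefined, one = undefined,
      zero = (\<lambda>b\<in>carrier A. \<zero>\<^bsub>N\<^esub>),
      add = (\<lambda>f g. \<lambda>b\<in>carrier A. f b \<oplus>\<^bsub>N\<^esub> g b),
      ract = (\<lambda>f a. \<lambda>b\<in>carrier A. f (a \<otimes>\<^bsub>A\<^esub> b)),
      gr = (\<lambda>j. {f \<in> H. \<forall>m. f ` deg_part A m \<subseteq> gr N (m + j)})\<rparr>)"


section \<open>Tiled orders\<close>

text \<open>The Laurent polynomial ring K, with \<open>x ^ m\<close> represented by \<open>single m 1\<close>.\<close>

type_synonym 'k laurent = "int \<Rightarrow>\<^sub>0 'k"

definition homog :: "int \<Rightarrow> 'k::field laurent set" where
  "homog m = range (\<lambda>c. Poly_Mapping.single m c)"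

definition poly_carrier :: "'k::field laurent set" where
  "poly_carrier = {f. \<forall>m\<in>Poly_Mapping.keys f. 0 \<le> m}"

definition poly_times_x :: "int \<Rightarrow> 'k::field laurent set" where
  "poly_times_x d = (\<lambda>r. r * Poly_Mapping.single d 1) ` poly_carrier"

definition poly_algebra :: "('k::field, 'k laurent) graded_algebra" where
  "poly_algebra =
     \<lparr>carrier = poly_carrier, monoid.mult = (*), one = 1, zero = 0, add = (+),
      module.smult = (\<lambda>c f. Poly_Mapping.single 0 c * f),
      deg_part = (\<lambda>m. poly_carrier \<inter> homog m)\<rparr>"

definition tiled_exponents :: "nat \<Rightarrow> (nat \<Rightarrow> nat \<Rightarrow> int) \<Rightarrow> bool" where
  "tiled_exponents n d \<longleftrightarrow>
     1 \<le> n \<and> (\<forall>i<n. d i i = 0) \<and> (\<forall>i<n. \<forall>j<n. \<forall>l<n. d i l + d l j \<ge> d i j)"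

text \<open>The indices 1, ..., n become 0, ..., n - 1.\<close>

definition tiled_order ::
  "nat \<Rightarrow> (nat \<Rightarrow> nat \<Rightarrow> int) \<Rightarrow> ('k::field, 'k laurent mat) graded_algebra" where
  "tiled_order n d =
     (let C = {a \<in> carrier_mat n n. \<forall>i<n. \<forall>j<n. a $$ (i, j) \<in> poly_times_x (d i j)} in
     \<lparr>carrier = C, monoid.mult = (*), one = 1\<^sub>m n, zero = 0\<^sub>m n n, add = (+),
      module.smult = (\<lambda>c a. Poly_Mapping.single 0 c \<cdot>\<^sub>m a),
      deg_part = (\<lambda>m. {a \<in> C. \<forall>i<n. \<forall>j<n. a $$ (i, j) \<in> homog m})\<rparr>)"

definition diag_unit :: "nat \<Rightarrow> nat \<Rightarrow> 'k::field laurent mat" where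
  "diag_unit n i = mat n n (\<lambda>(r, c). if r = i \<and> c = i then 1 else 0)"

definition row_proj ::
  "nat \<Rightarrow> (nat \<Rightarrow> nat \<Rightarrow> int) \<Rightarrow> nat \<Rightarrow> ('k::field laurent mat, 'k laurent mat) gmod" where
  "row_proj n d i =
     (let A = tiled_order n d in right_ideal A ((\<lambda>a. diag_unit n i * a) ` carrier A))"

definition scalar_emb :: "nat \<Rightarrow> 'k::field laurent \<Rightarrow> 'k laurent mat" where
  "scalar_emb n f = f \<cdot>\<^sub>m 1\<^sub>m n"

definition complete_reps ::
  "('k::field) itself \<Rightarrow> nat \<Rightarrow> (nat \<Rightarrow> nat \<Rightarrow> int) \<Rightarrow> nat set \<Rightarrow> bool" where
  "complete_reps _ n d I \<longleftrightarrow>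
     I \<subseteq> {..<n} \<and>
     (\<forall>i<n. \<exists>!j. j \<in> I \<and>
        module_isomorphic (tiled_order n d :: ('k, 'k laurent mat) graded_algebra)
          (row_proj n d i) (row_proj n d j))"

definition gorenstein ::
  "('k::field) itself \<Rightarrow> nat \<Rightarrow> (nat \<Rightarrow> nat \<Rightarrow> int) \<Rightarrow> bool" where
  "gorenstein _ n d \<longleftrightarrow>
     (let A = tiled_order n d :: ('k, 'k laurent mat) graded_algebra in
      graded_projective A
        (Hom_module poly_algebra (scalar_emb n) A (shift (regular poly_algebra) (-1))))"

definition nakayama ::
  "nat \<Rightarrow> (nat \<Rightarrow> nat \<Rightarrow> int) \<Rightarrow> nat set \<Rightarrow> (nat \<Rightarrow> nat) \<Rightarrow> bool" where
  "nakayama n d I \<nu> \<longleftrightarrow>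
     bij_betw \<nu> I I \<and> (\<forall>i\<in>I. \<forall>j<n. d (\<nu> i) j + d j i = d (\<nu> i) i)"

definition p_param :: "(nat \<Rightarrow> nat \<Rightarrow> int) \<Rightarrow> (nat \<Rightarrow> nat) \<Rightarrow> nat \<Rightarrow> int" where
  "p_param d \<nu> i = 1 - d (\<nu> i) i"


section \<open>The stable category of graded Cohen-Macaulay modules\<close>

text \<open>
  Objects of the category of graded CM modules. A module that is finitely generated over A is
  so over R, hence projectivity over R may be expressed by \<^const>\<open>graded_projective\<close>.
\<close>

definition graded_CM ::
  "nat \<Rightarrow> (nat \<Rightarrow> nat \<Rightarrow> int) \<Rightarrow> ('k::field laurent mat, 'm) gmod \<Rightarrow> bool" where
  "graded_CM n d M \<longleftrightarrow>
     (let A = tiled_order n d :: ('k, 'k laurent mat) graded_algebra in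
      graded_module A M \<and> fin_gen A M \<and>
      graded_projective poly_algebra (restrict_scalars (scalar_emb n) M))"

definition graded_End ::
  "('k, 'a) graded_algebra \<Rightarrow> ('a, 'm) gmod \<Rightarrow> ('k, 'm \<Rightarrow> 'm) module" where
  "graded_End A M =
     \<lparr>carrier = graded_hom A M M,
      monoid.mult = (\<lambda>f g. compose (carrier M) f g),
      one = (\<lambda>v\<in>carrier M. v),
      zero = (\<lambda>v\<in>carrier M. \<zero>\<^bsub>M\<^esub>),
      add = (\<lambda>f g. \<lambda>v\<in>carrier M. f v \<oplus>\<^bsub>M\<^esub> g v),
      module.smult = (\<lambda>c f. \<lambda>v\<in>carrier M. ract M (f v) (c \<odot>\<^bsub>A\<^esub> \<one>\<^bsub>A\<^esub>))\<rparr>"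

text \<open>
  Endomorphisms factoring through a graded projective. The type of the elements of \<open>Q\<close> is no
  restriction: every finitely generated graded projective module is isomorphic to a submodule of
  a finite direct sum of shifts of A, which has elements of this type.
\<close>

definition proj_ideal ::
  "nat \<Rightarrow> (nat \<Rightarrow> nat \<Rightarrow> int) \<Rightarrow> ('k::field laurent mat, 'm) gmod \<Rightarrow> ('m \<Rightarrow> 'm) set" where
  "proj_ideal n d M =
     (let A = tiled_order n d :: ('k, 'k laurent mat) graded_algebra in
     {f \<in> graded_hom A M M.
        \<exists>Q :: ('k laurent mat, nat \<Rightarrow> 'k laurent mat) gmod.
          graded_CM n d Q \<and> graded_projective A Q \<and>
          (\<exists>g\<in>graded_hom A M Q. \<exists>h\<in>graded_hom A Q M. f = compose (carrier M) h g)})"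

definition quotient_algebra ::
  "('k, 'b) module \<Rightarrow> 'b set \<Rightarrow> ('k, 'b set) module" where
  "quotient_algebra B J =
     (let Q = B Quot J in
     \<lparr>carrier = carrier Q, monoid.mult = monoid.mult Q, one = one Q, zero = zero Q, add = add Q,
      module.smult = (\<lambda>c X. \<Union>b\<in>X. J +>\<^bsub>B\<^esub> (c \<odot>\<^bsub>B\<^esub> b))\<rparr>)"

definition stable_End ::
  "nat \<Rightarrow> (nat \<Rightarrow> nat \<Rightarrow> int) \<Rightarrow> ('k::field laurent mat, 'm) gmod
     \<Rightarrow> ('k, ('m \<Rightarrow> 'm) set) module" where
  "stable_End n d M = quotient_algebra (graded_End (tiled_order n d) M) (proj_ideal n d M)"

definition row_module ::
  "nat \<Rightarrow> ('k::field laurent mat, 'k laurent mat) gmod" where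
  "row_module n =
     (let C = {v \<in> carrier_mat 1 n. \<forall>j<n. v $$ (0, j) \<in> poly_carrier} in
     \<lparr>carrier = C, monoid.mult = undefined, one = undefined, zero = 0\<^sub>m 1 n, add = (+), ract = (*),
      gr = (\<lambda>m. {v \<in> C. \<forall>j<n. v $$ (0, j) \<in> homog m})\<rparr>)"

text \<open>\<open>None\<close> indexes the row module, \<open>Some (i, j)\<close> the truncation of the j-th shift.\<close>

definition V_module ::
  "nat \<Rightarrow> (nat \<Rightarrow> nat \<Rightarrow> int) \<Rightarrow> nat set \<Rightarrow> (nat \<Rightarrow> nat)
     \<Rightarrow> ('k::field laurent mat, (nat \<times> int) option \<Rightarrow> 'k laurent mat) gmod" where
  "V_module n d I \<nu> =
     direct_sum (insert None (Some ` (SIGMA i:I. {1..- p_param d \<nu> i})))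
       (\<lambda>s. case s of
              None \<Rightarrow> row_module n
            | Some (i, j) \<Rightarrow> trunc (shift (row_proj n d (\<nu> i)) j))"

definition Gamma_algebra ::
  "nat \<Rightarrow> (nat \<Rightarrow> nat \<Rightarrow> int) \<Rightarrow> nat set \<Rightarrow> (nat \<Rightarrow> nat)
     \<Rightarrow> ('k::field, (((nat \<times> int) option \<Rightarrow> 'k laurent mat)
                  \<Rightarrow> ((nat \<times> int) option \<Rightarrow> 'k laurent mat)) set) module" where
  "Gamma_algebra n d I \<nu> = stable_End n d (V_module n d I \<nu>)"


section \<open>Incidence algebras\<close>

text \<open>
  A poset is a set \<open>P\<close> with a relation \<open>r\<close>, where \<open>(x, y) \<in> r\<close> means that x is at most y.
  A function \<open>\<phi>\<close> stands for the linear combination of the basis elements (y, x) with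
  coefficients \<open>\<phi> (y, x)\<close>; the product is the bilinear extension of (z, y) (y, x) = (z, x).
\<close>

definition incidence_algebra ::
  "'p set \<Rightarrow> 'p rel \<Rightarrow> ('k::field, 'p \<times> 'p \<Rightarrow> 'k) module" where
  "incidence_algebra P r =
     \<lparr>carrier = {\<phi>. \<forall>y x. (x, y) \<notin> r \<longrightarrow> \<phi> (y, x) = 0},
      monoid.mult = (\<lambda>\<phi> \<psi>. \<lambda>(z, x). \<Sum>y\<in>P. \<phi> (z, y) * \<psi> (y, x)),
      one = (\<lambda>(y, x). if y = x \<and> x \<in> P then 1 else 0),
      zero = (\<lambda>_. 0),
      add = (\<lambda>\<phi> \<psi> q. \<phi> q + \<psi> q),
      module.smult = (\<lambda>c \<phi> q. c * \<phi> q)\<rparr>"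

definition algebra_isomorphic :: "('k, 'b) module \<Rightarrow> ('k, 'c) module \<Rightarrow> bool" where
  "algebra_isomorphic B C \<longleftrightarrow>
     (\<exists>h\<in>ring_iso B C. \<forall>c. \<forall>b\<in>carrier B. h (c \<odot>\<^bsub>B\<^esub> b) = c \<odot>\<^bsub>C\<^esub> h b)"

definition has_maximum :: "'p set \<Rightarrow> 'p rel \<Rightarrow> bool" where
  "has_maximum P r \<longleftrightarrow> (\<exists>m\<in>P. \<forall>x\<in>P. (x, m) \<in> r)"

end

theory Submission
  imports Defs
begin

text \<open>
  All modules in question are finite direct sums of rows \<open>[R x^a(1) ... R x^a(n)]\<close> with a shifted
  grading; such a sum is called a row lattice here. Absorbing the shift into the exponents, a
  homomorphism of degree 0 between two row lattices is a matrix over the field: multiplication by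
  a Laurent polynomial is the only way to map a row to a row, and degree 0 leaves only scalars. The
  entry at \<open>(t, s)\<close> may be nonzero only if row \<open>s\<close> is contained in row \<open>t\<close>, that is, if the exponents
  of \<open>t\<close> are pointwise at most those of \<open>s\<close> (\<open>coord_hom\<close>, \<open>coeff_nonzero_le\<close>, \<open>hom_of_hom\<close>). Such a
  matrix factors through a graded projective module if and only if, for every nonzero entry
  \<open>(t, s)\<close>, some shift of a row of the order lies between row \<open>s\<close> and row \<open>t\<close> (\<open>proj_ideal_coeff\<close>,
  \<open>proj_idealI\<close>).
  
  The rows of V are \<open>O = [R ... R]\<close> and the truncations of \<open>e_\<nu>i A(j)\<close>. The identity
  \<open>d(\<nu>i, l) + d(l, i) = d(\<nu>i, i)\<close> shows that a shifted projective row between such a truncation and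
  \<open>O\<close> is equal to \<open>O\<close> (\<open>projective_below_row_module\<close>). Consequently no projective row lies between
  two nonprojective rows of V, and \<open>\<Gamma>\<close> is the incidence algebra of the nonprojective rows, ordered
  by inclusion (\<open>stable_End_incidence\<close>, \<open>Gamma_incidence\<close>). If \<open>O\<close> is not projective, then it is the
  maximum of this order. If \<open>O = e_a A\<close>, then every other row lies in the unique maximal graded
  submodule of \<open>e_a A\<close>, which is the last truncation of \<open>e_\<nu>a A\<close>; if there are truncations at all,
  this one is among them and is the maximum (\<open>nonprojective_summands_maximum\<close>). An isomorphism of
  incidence algebras transports the existence of a maximum
  (\<open>maximum_of_incidence_isomorphic\<close>), which proves one direction of the theorem.
  
  For the other direction, remove the maximum from the poset and double the rest: on two copies of
  it, which the Nakayama permutation exchanges, take the order with exponents \<open>\<delta>(p, q)\<close> inside each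
  copy and \<open>k - \<delta>(q, p)\<close> and \<open>h - \<delta>(q, p)\<close> between the copies, where \<open>\<delta>\<close> is 0 or 1 according to
  the order relation. For \<open>h = 2\<close> and \<open>k = 1\<close> there is exactly one truncation for each remaining
  point; its exponents are the indicator function of the points related to it, so that inclusion
  of these rows is the given order (\<open>summand_order_iff\<close>). The one-point poset and the empty poset
  arise from the doubling of a point with \<open>(h, k) = (1, 1)\<close> and \<open>(1, 0)\<close>.
\<close>
section \<open>Laurent polynomials\<close>

lemma lookup_monomial_mult:
  fixes f :: "'k::field laurent"
  shows "Poly_Mapping.lookup (Poly_Mapping.single a c * f) m = c * Poly_Mapping.lookup f (m - a)"
proof -
  have *: "(m = a + q) = (q = m - a)" for q by auto
  show ?thesis
    by (simp add: lookup_mult lookup_single * when_def mult_when if_distrib[of "\<lambda>x. x * _"]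
        Sum_any.delta cong: if_cong)
qed

lemma laurent_eqI:
  fixes f g :: "'k::field laurent"
  assumes "\<And>m. Poly_Mapping.lookup f m = Poly_Mapping.lookup g m"
  shows "f = g"
  using assms by (simp add: poly_mapping_eqI)

lemma monomial_mult_cancel:
  fixes f :: "'k::field laurent"
  shows "Poly_Mapping.single m 1 * (Poly_Mapping.single (- m) 1 * f) = f"
    "Poly_Mapping.single (- m) 1 * (Poly_Mapping.single m 1 * f) = f"
  by (rule laurent_eqI, simp add: lookup_monomial_mult)+

lemma poly_carrier_iff:
  fixes f :: "'k::field laurent"
  shows "f \<in> poly_carrier \<longleftrightarrow> (\<forall>m<0. Poly_Mapping.lookup f m = 0)"
  by (auto simp: poly_carrier_def in_keys_iff not_less[symmetric])

lemma poly_times_x_iff: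
  fixes f :: "'k::field laurent"
  shows "f \<in> poly_times_x d \<longleftrightarrow> (\<forall>m<d. Poly_Mapping.lookup f m = 0)"
proof
  assume "f \<in> poly_times_x d"
  then obtain r where r: "r \<in> poly_carrier" "f = Poly_Mapping.single d 1 * r"
    by (auto simp: poly_times_x_def mult.commute)
  then show "\<forall>m<d. Poly_Mapping.lookup f m = 0"
    by (auto simp: lookup_monomial_mult poly_carrier_iff)
next
  assume *: "\<forall>m<d. Poly_Mapping.lookup f m = 0"
  let ?r = "Poly_Mapping.single (- d) 1 * f"
  have "?r \<in> poly_carrier" using * by (auto simp: lookup_monomial_mult poly_carrier_iff)
  moreover have "f = ?r * Poly_Mapping.single d 1"
    by (subst mult.commute) (rule monomial_mult_cancel(1)[symmetric])
  ultimately show "f \<in> poly_times_x d" unfolding poly_times_x_def by (rule image_eqI[rotated])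
qed

lemma poly_times_x_0: "poly_times_x 0 = poly_carrier"
  by (auto simp: poly_times_x_iff poly_carrier_iff)

lemma homog_iff:
  fixes f :: "'k::field laurent"
  shows "f \<in> homog m \<longleftrightarrow> (\<forall>l. l \<noteq> m \<longrightarrow> Poly_Mapping.lookup f l = 0)"
proof
  assume "f \<in> homog m" then show "\<forall>l. l \<noteq> m \<longrightarrow> Poly_Mapping.lookup f l = 0"
    by (auto simp: homog_def lookup_single)
next
  assume "\<forall>l. l \<noteq> m \<longrightarrow> Poly_Mapping.lookup f l = 0"
  then have "f = Poly_Mapping.single m (Poly_Mapping.lookup f m)"
    by (intro laurent_eqI) (auto simp: lookup_single when_def)
  then show "f \<in> homog m" unfolding homog_def by (rule range_eqI)
qed

lemma homog_eq_monomial: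
  fixes f :: "'k::field laurent"
  assumes "f \<in> homog m"
  shows "f = Poly_Mapping.single m (Poly_Mapping.lookup f m)"
  using assms by (intro laurent_eqI) (auto simp: homog_iff lookup_single when_def)

lemma poly_times_x_simps [simp]:
  "(0::'k::field laurent) \<in> poly_times_x d"
  "(0::'k::field laurent) \<in> homog d"
  by (auto simp: poly_times_x_iff homog_iff)

lemma poly_times_x_add:
  "f \<in> poly_times_x d \<Longrightarrow> g \<in> poly_times_x d \<Longrightarrow> f + g \<in> poly_times_x d"
  for f :: "'k::field laurent"
  by (auto simp: poly_times_x_iff lookup_add)

lemma poly_times_x_uminus: "f \<in> poly_times_x d \<Longrightarrow> - f \<in> poly_times_x d"
  for f :: "'k::field laurent"
  by (auto simp: poly_times_x_iff)

lemma poly_times_x_mult: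
  fixes f g :: "'k::field laurent"
  assumes "f \<in> poly_times_x a" "g \<in> poly_times_x b"
  shows "f * g \<in> poly_times_x (a + b)"
proof -
  obtain r s where rs: "r \<in> poly_carrier" "s \<in> poly_carrier"
    "f = r * Poly_Mapping.single a 1" "g = s * Poly_Mapping.single b 1"
    using assms by (auto simp: poly_times_x_def)
  have "r * s \<in> poly_carrier"
    using rs(1,2) keys_mult[of r s] by (fastforce simp: poly_carrier_def)
  moreover have "f * g = (r * s) * Poly_Mapping.single (a + b) 1"
  proof -
    have "f * g = (r * s) * (Poly_Mapping.single a 1 * Poly_Mapping.single b 1)"
      by (simp add: rs ac_simps)
    then show ?thesis by (simp add: mult_single)
  qed
  ultimately show ?thesis by (auto simp: poly_times_x_def)
qed

lemma poly_times_x_mono: "f \<in> poly_times_x a \<Longrightarrow> b \<le> a \<Longrightarrow> f \<in> poly_times_x b"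
  for f :: "'k::field laurent"
  by (auto simp: poly_times_x_iff)

lemma monomial_mult_poly_times_x:
  fixes f :: "'k::field laurent"
  assumes "f \<in> poly_times_x a" "b = m + a"
  shows "Poly_Mapping.single m c * f \<in> poly_times_x b"
  using assms by (auto simp: poly_times_x_iff lookup_monomial_mult)

lemma poly_times_x_sum:
  "(\<And>i. i \<in> A \<Longrightarrow> f i \<in> poly_times_x d) \<Longrightarrow> sum f A \<in> poly_times_x d"
  for f :: "'i \<Rightarrow> 'k::field laurent"
  by (auto simp: poly_times_x_iff lookup_sum intro!: sum.neutral)

lemma monomial_in_poly_times_x [simp]:
  "Poly_Mapping.single m (c::'k::field) \<in> poly_times_x d \<longleftrightarrow> c = 0 \<or> d \<le> m"
  by (auto simp: poly_times_x_iff lookup_single when_def)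

lemma monomial_in_homog [simp]:
  "Poly_Mapping.single m (c::'k::field) \<in> homog l \<longleftrightarrow> c = 0 \<or> m = l"
  by (auto simp: homog_iff lookup_single when_def)

lemma homog_add: "f \<in> homog d \<Longrightarrow> g \<in> homog d \<Longrightarrow> f + g \<in> homog d"
  for f :: "'k::field laurent"
  by (auto simp: homog_iff lookup_add)

lemma homog_uminus: "f \<in> homog d \<Longrightarrow> - f \<in> homog d"
  for f :: "'k::field laurent"
  by (auto simp: homog_iff)

lemma monomial_mult_homog:
  fixes f :: "'k::field laurent"
  assumes "f \<in> homog a" "b = m + a"
  shows "Poly_Mapping.single m c * f \<in> homog b"
  using assms by (auto simp: homog_iff lookup_monomial_mult)

lemma homog_mult:
  fixes f g :: "'k::field laurent"
  assumes "f \<in> homog a" "g \<in> homog b"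
  shows "f * g \<in> homog (a + b)"
  using assms by (subst homog_eq_monomial[OF assms(1)]) (auto intro: monomial_mult_homog)

lemma homog_sum: "(\<And>i. i \<in> A \<Longrightarrow> f i \<in> homog d) \<Longrightarrow> sum f A \<in> homog d"
  for f :: "'i \<Rightarrow> 'k::field laurent"
  by (auto simp: homog_iff lookup_sum intro!: sum.neutral)

lemma homog_Int_poly_times_x:
  fixes f :: "'k::field laurent"
  assumes "f \<in> homog m" "f \<in> poly_times_x d" "m < d"
  shows "f = 0"
  using assms by (intro laurent_eqI) (metis homog_iff poly_times_x_iff lookup_zero)

section \<open>Modules with Laurent coordinates\<close>

text \<open>
  A graded abelian group identified with the product of the fractional ideals \<open>R x^f(y)\<close>, where the
  coordinates of a homogeneous element of degree \<open>m\<close> are monomials of the same degree \<open>m\<close>. This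
  uniformity is the reason for allowing arbitrary exponents: a shift of the grading becomes a
  change of the coordinates by a power of \<open>x\<close>. Subtraction and the decomposition into degrees are
  consequences of the coordinates.
\<close>
locale coordinates =
  fixes M :: "('a, 'm) gmod" and X :: "'x set"
    and \<kappa> :: "'m \<Rightarrow> 'x \<Rightarrow> 'k::field laurent" and f :: "'x \<Rightarrow> int"
  assumes finite_index: "finite X"
    and coord_in: "\<And>v x. v \<in> carrier M \<Longrightarrow> x \<in> X \<Longrightarrow> \<kappa> v x \<in> poly_times_x (f x)"
    and coord_inj: "\<And>v w. v \<in> carrier M \<Longrightarrow> w \<in> carrier M \<Longrightarrow>
          (\<And>x. x \<in> X \<Longrightarrow> \<kappa> v x = \<kappa> w x) \<Longrightarrow> v = w"
    and coord_surj: "\<And>F. (\<And>x. x \<in> X \<Longrightarrow> F x \<in> poly_times_x (f x)) \<Longrightarrow>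
          \<exists>v\<in>carrier M. \<forall>x\<in>X. \<kappa> v x = F x"
    and zero_closed: "\<zero>\<^bsub>M\<^esub> \<in> carrier M"
    and coord_zero: "\<And>x. x \<in> X \<Longrightarrow> \<kappa> \<zero>\<^bsub>M\<^esub> x = 0"
    and add_closed: "\<And>v w. v \<in> carrier M \<Longrightarrow> w \<in> carrier M \<Longrightarrow> v \<oplus>\<^bsub>M\<^esub> w \<in> carrier M"
    and coord_add: "\<And>v w x. v \<in> carrier M \<Longrightarrow> w \<in> carrier M \<Longrightarrow> x \<in> X \<Longrightarrow>
          \<kappa> (v \<oplus>\<^bsub>M\<^esub> w) x = \<kappa> v x + \<kappa> w x"
    and gr_eq: "\<And>m. gr M m = {v \<in> carrier M. \<forall>x\<in>X. \<kappa> v x \<in> homog m}"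
begin

definition vec :: "('x \<Rightarrow> 'k laurent) \<Rightarrow> 'm" where
  "vec F = (SOME v. v \<in> carrier M \<and> (\<forall>x\<in>X. \<kappa> v x = F x))"

lemma
  assumes "\<And>x. x \<in> X \<Longrightarrow> F x \<in> poly_times_x (f x)"
  shows vec_closed: "vec F \<in> carrier M"
    and coord_vec: "\<And>x. x \<in> X \<Longrightarrow> \<kappa> (vec F) x = F x"
proof -
  have "\<exists>v. v \<in> carrier M \<and> (\<forall>x\<in>X. \<kappa> v x = F x)" using coord_surj[of F] assms by blast
  from someI_ex[OF this]
  show "vec F \<in> carrier M" "\<And>x. x \<in> X \<Longrightarrow> \<kappa> (vec F) x = F x" by (auto simp: vec_def)
qed

lemma abelian_group: "abelian_group M"
proof (rule abelian_groupI)
  fix v assume v: "v \<in> carrier M"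
  let ?w = "vec (\<lambda>x. - \<kappa> v x)"
  have *: "- \<kappa> v x \<in> poly_times_x (f x)" if "x \<in> X" for x
    using coord_in[OF v that] by (rule poly_times_x_uminus)
  have "?w \<in> carrier M" using * by (rule vec_closed)
  moreover have "?w \<oplus>\<^bsub>M\<^esub> v = \<zero>\<^bsub>M\<^esub>"
    using * v by (intro coord_inj)
      (auto simp: add_closed zero_closed vec_closed coord_add coord_zero coord_vec)
  ultimately show "\<exists>y\<in>carrier M. y \<oplus>\<^bsub>M\<^esub> v = \<zero>\<^bsub>M\<^esub>" by blast
qed (auto simp: add_closed zero_closed coord_add coord_zero ac_simps intro!: coord_inj)

sublocale abelian_group M by (rule abelian_group)

lemma coord_minus:
  assumes "v \<in> carrier M" "x \<in> X" shows "\<kappa> (\<ominus>\<^bsub>M\<^esub> v) x = - \<kappa> v x"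
proof -
  have "\<kappa> (\<ominus>\<^bsub>M\<^esub> v \<oplus>\<^bsub>M\<^esub> v) x = 0" using assms by (simp add: l_neg coord_zero)
  then show ?thesis using assms by (simp add: coord_add eq_neg_iff_add_eq_0)
qed

lemma coord_finsum:
  assumes "finite A" "c \<in> A \<rightarrow> carrier M" "x \<in> X"
  shows "\<kappa> (finsum M c A) x = (\<Sum>a\<in>A. \<kappa> (c a) x)"
  using assms(1,2)
  by (induction A rule: finite_induct) (auto simp: coord_zero coord_add assms(3) finsum_closed)

lemma additive_subgroup_gr: "additive_subgroup (gr M m) M"
  unfolding additive_subgroup_def
proof (rule subgroup.intro)
  fix v assume "v \<in> gr M m"
  then show "inv\<^bsub>add_monoid M\<^esub> v \<in> gr M m"
    using coord_minus by (auto simp: gr_eq a_inv_def[symmetric] intro: homog_uminus)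
qed (auto simp: gr_eq coord_add coord_zero intro: homog_add)

lemma homogeneous_decomposition:
  assumes v: "v \<in> carrier M"
  shows "\<exists>!c. (\<forall>m. c m \<in> gr M m) \<and> finite {m. c m \<noteq> \<zero>\<^bsub>M\<^esub>} \<and>
           v = (\<Oplus>\<^bsub>M\<^esub>m\<in>{m. c m \<noteq> \<zero>\<^bsub>M\<^esub>}. c m)"
proof (rule ex1I)
  \<comment> \<open>The homogeneous component of degree m is obtained by cutting each coordinate down to degree m.\<close>
  define part where "part m x = Poly_Mapping.single m (Poly_Mapping.lookup (\<kappa> v x) m)" for m x
  have part: "part m x \<in> poly_times_x (f x)" if "x \<in> X" for m x
    using coord_in[OF v that] by (auto simp: part_def poly_times_x_iff lookup_single when_def)
  let ?c = "\<lambda>m. vec (part m)"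
  have c: "?c m \<in> carrier M" for m using part by (intro vec_closed)
  have cx: "\<kappa> (?c m) x = part m x" if "x \<in> X" for m x using part that by (intro coord_vec)
  have null: "Poly_Mapping.lookup (\<kappa> v x) m = 0" if "?c m = \<zero>\<^bsub>M\<^esub>" "x \<in> X" for m x
    using cx[OF that(2), of m] that coord_zero[OF that(2)] by (simp add: part_def)
      (metis lookup_single_eq lookup_zero)
  have "{m. ?c m \<noteq> \<zero>\<^bsub>M\<^esub>} \<subseteq> (\<Union>x\<in>X. Poly_Mapping.keys (\<kappa> v x))"
  proof
    fix m assume m: "m \<in> {m. ?c m \<noteq> \<zero>\<^bsub>M\<^esub>}"
    then obtain x where "x \<in> X" "part m x \<noteq> 0"
      using coord_inj[OF c[of m] zero_closed] coord_zero cx by auto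
    then show "m \<in> (\<Union>x\<in>X. Poly_Mapping.keys (\<kappa> v x))"
      by (auto simp: part_def in_keys_iff intro!: bexI[of _ x])
  qed
  then have fin: "finite {m. ?c m \<noteq> \<zero>\<^bsub>M\<^esub>}"
    by (rule finite_subset) (simp add: finite_index)
  have "v = (\<Oplus>\<^bsub>M\<^esub>m\<in>{m. ?c m \<noteq> \<zero>\<^bsub>M\<^esub>}. ?c m)"
  proof (rule coord_inj[OF v])
    show "(\<Oplus>\<^bsub>M\<^esub>m\<in>{m. ?c m \<noteq> \<zero>\<^bsub>M\<^esub>}. ?c m) \<in> carrier M" using c by (intro finsum_closed) auto
    fix x assume x: "x \<in> X"
    show "\<kappa> v x = \<kappa> (\<Oplus>\<^bsub>M\<^esub>m\<in>{m. ?c m \<noteq> \<zero>\<^bsub>M\<^esub>}. ?c m) x"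
    proof (rule laurent_eqI)
      fix l
      show "Poly_Mapping.lookup (\<kappa> v x) l =
            Poly_Mapping.lookup (\<kappa> (\<Oplus>\<^bsub>M\<^esub>m\<in>{m. ?c m \<noteq> \<zero>\<^bsub>M\<^esub>}. ?c m) x) l"
        using null[OF _ x, of l] fin c x
        by (subst coord_finsum) (auto simp: cx part_def lookup_sum lookup_single when_def)
    qed
  qed
  with fin c cx show "(\<forall>m. ?c m \<in> gr M m) \<and> finite {m. ?c m \<noteq> \<zero>\<^bsub>M\<^esub>} \<and>
           v = (\<Oplus>\<^bsub>M\<^esub>m\<in>{m. ?c m \<noteq> \<zero>\<^bsub>M\<^esub>}. ?c m)"
    by (auto simp: gr_eq part_def)
  fix c' assume c': "(\<forall>m. c' m \<in> gr M m) \<and> finite {m. c' m \<noteq> \<zero>\<^bsub>M\<^esub>} \<and>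
           v = (\<Oplus>\<^bsub>M\<^esub>m\<in>{m. c' m \<noteq> \<zero>\<^bsub>M\<^esub>}. c' m)"
  show "c' = ?c"
  proof (rule ext, rule coord_inj)
    fix m
    show "c' m \<in> carrier M" "?c m \<in> carrier M" using c' c by (auto simp: gr_eq)
    fix x assume x: "x \<in> X"
    have h: "\<kappa> (c' l) x \<in> homog l" for l using c' x by (auto simp: gr_eq)
    then have h': "Poly_Mapping.lookup (\<kappa> (c' l) x) m = 0" if "m \<noteq> l" for l
      using that by (auto simp: homog_iff)
    \<comment> \<open>The coefficient of degree m of v sees only the summand of degree m, which is thus determined.\<close>
    have "Poly_Mapping.lookup (\<kappa> v x) m
        = (\<Sum>l\<in>{l. c' l \<noteq> \<zero>\<^bsub>M\<^esub>}. Poly_Mapping.lookup (\<kappa> (c' l) x) m)"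
      using c' x by (auto simp: coord_finsum lookup_sum gr_eq Pi_def)
    also have "\<dots> = (\<Sum>l\<in>{l. c' l \<noteq> \<zero>\<^bsub>M\<^esub>}. if l = m then Poly_Mapping.lookup (\<kappa> (c' m) x) m else 0)"
      using h' by (intro sum.cong) auto
    also have "\<dots> = Poly_Mapping.lookup (\<kappa> (c' m) x) m"
      using c' x coord_zero by simp
    finally have "part m x = \<kappa> (c' m) x"
      using homog_eq_monomial[OF h[of m]] by (simp add: part_def)
    then show "\<kappa> (c' m) x = \<kappa> (?c m) x" using x by (simp add: cx)
  qed
qed

text \<open>
  If the algebra acts on the coordinates by matrices with entries of the right degree, then the
  module axioms are the axioms of a matrix representation. The two algebras of interest, the
  tiled order and the polynomial ring, both act in this way.
\<close>
lemma graded_moduleI: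
  fixes B :: "('k, 'a) graded_algebra" and \<rho> :: "'a \<Rightarrow> 'x \<Rightarrow> 'x \<Rightarrow> 'k laurent"
  assumes closed: "\<one>\<^bsub>B\<^esub> \<in> carrier B"
      "\<And>a b. a \<in> carrier B \<Longrightarrow> b \<in> carrier B \<Longrightarrow> a \<otimes>\<^bsub>B\<^esub> b \<in> carrier B"
      "\<And>a b. a \<in> carrier B \<Longrightarrow> b \<in> carrier B \<Longrightarrow> a \<oplus>\<^bsub>B\<^esub> b \<in> carrier B"
      "\<And>l. deg_part B l \<subseteq> carrier B"
    and act_closed: "\<And>v a. v \<in> carrier M \<Longrightarrow> a \<in> carrier B \<Longrightarrow> ract M v a \<in> carrier M"
    and act: "\<And>v a x. v \<in> carrier M \<Longrightarrow> a \<in> carrier B \<Longrightarrow> x \<in> X \<Longrightarrow>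
          \<kappa> (ract M v a) x = (\<Sum>y\<in>X. \<kappa> v y * \<rho> a y x)"
    and one: "\<And>x y. x \<in> X \<Longrightarrow> y \<in> X \<Longrightarrow> \<rho> \<one>\<^bsub>B\<^esub> y x = (if y = x then 1 else 0)"
    and mult: "\<And>a b x y. a \<in> carrier B \<Longrightarrow> b \<in> carrier B \<Longrightarrow> x \<in> X \<Longrightarrow> y \<in> X \<Longrightarrow>
          \<rho> (a \<otimes>\<^bsub>B\<^esub> b) y x = (\<Sum>z\<in>X. \<rho> a y z * \<rho> b z x)"
    and add: "\<And>a b x y. a \<in> carrier B \<Longrightarrow> b \<in> carrier B \<Longrightarrow> x \<in> X \<Longrightarrow> y \<in> X \<Longrightarrow>
          \<rho> (a \<oplus>\<^bsub>B\<^esub> b) y x = \<rho> a y x + \<rho> b y x"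
    and deg: "\<And>a l x y. a \<in> deg_part B l \<Longrightarrow> x \<in> X \<Longrightarrow> y \<in> X \<Longrightarrow> \<rho> a y x \<in> homog l"
  shows "graded_module B M"
proof -
  have "ract M v \<one>\<^bsub>B\<^esub> = v" if v: "v \<in> carrier M" for v
    using v closed act_closed
    by (intro coord_inj) (auto simp: act one if_distrib[of "(*) _"] finite_index cong: if_cong)
  moreover have "ract M v (a \<otimes>\<^bsub>B\<^esub> b) = ract M (ract M v a) b"
    if "v \<in> carrier M" "a \<in> carrier B" "b \<in> carrier B" for v a b
  proof (rule coord_inj)
    fix x assume x: "x \<in> X"
    have "\<kappa> (ract M v (a \<otimes>\<^bsub>B\<^esub> b)) x = (\<Sum>y\<in>X. \<Sum>z\<in>X. \<kappa> v y * (\<rho> a y z * \<rho> b z x))"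
      using that x by (simp add: act closed mult sum_distrib_left)
    also have "\<dots> = (\<Sum>z\<in>X. \<Sum>y\<in>X. \<kappa> v y * (\<rho> a y z * \<rho> b z x))" by (rule sum.swap)
    also have "\<dots> = \<kappa> (ract M (ract M v a) b) x"
      using that x by (simp add: act act_closed sum_distrib_right mult.assoc)
    finally show "\<kappa> (ract M v (a \<otimes>\<^bsub>B\<^esub> b)) x = \<kappa> (ract M (ract M v a) b) x" .
  qed (use that closed act_closed in auto)
  moreover have "ract M v (a \<oplus>\<^bsub>B\<^esub> b) = ract M v a \<oplus>\<^bsub>M\<^esub> ract M v b"
    if "v \<in> carrier M" "a \<in> carrier B" "b \<in> carrier B" for v a b
    using that closed act_closed
    by (intro coord_inj) (auto simp: act coord_add add distrib_left sum.distrib)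
  moreover have "ract M (v \<oplus>\<^bsub>M\<^esub> w) a = ract M v a \<oplus>\<^bsub>M\<^esub> ract M w a"
    if "v \<in> carrier M" "w \<in> carrier M" "a \<in> carrier B" for v w a
    using that closed act_closed
    by (intro coord_inj) (auto simp: act coord_add distrib_right sum.distrib)
  ultimately have "right_module B M"
    unfolding right_module_def using abelian_group act_closed by auto
  moreover have "ract M v a \<in> gr M (m + l)" if "v \<in> gr M m" "a \<in> deg_part B l" for m l v a
  proof -
    have "a \<in> carrier B" using that closed(4)[of l] by blast
    then show ?thesis using that act_closed deg
      by (auto simp: gr_eq act intro!: homog_sum homog_mult)
  qed
  ultimately show ?thesis
    unfolding graded_module_def using additive_subgroup_gr homogeneous_decomposition by blast
qed

end

section \<open>Tiled orders\<close>

lemma tiled_order_sel [simp]: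
  "monoid.mult (tiled_order n d) = (*)" "one (tiled_order n d) = 1\<^sub>m n"
  "zero (tiled_order n d) = 0\<^sub>m n n" "add (tiled_order n d) = (+)"
  "module.smult (tiled_order n d) = (\<lambda>c a. Poly_Mapping.single 0 c \<cdot>\<^sub>m a)"
  by (simp_all add: tiled_order_def)

lemma tiled_order_carrier:
  "a \<in> carrier (tiled_order n d) \<longleftrightarrow>
     a \<in> carrier_mat n n \<and> (\<forall>i<n. \<forall>j<n. a $$ (i, j) \<in> poly_times_x (d i j))"
  by (auto simp: tiled_order_def)

lemma tiled_order_deg:
  "a \<in> deg_part (tiled_order n d) m \<longleftrightarrow>
     a \<in> carrier (tiled_order n d) \<and> (\<forall>i<n. \<forall>j<n. a $$ (i, j) \<in> homog m)"
  by (auto simp: tiled_order_def)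

lemma tiled_orderD:
  assumes "a \<in> carrier (tiled_order n d)"
  shows "dim_row a = n" "dim_col a = n" "i < n \<Longrightarrow> j < n \<Longrightarrow> a $$ (i, j) \<in> poly_times_x (d i j)"
  using assms by (auto simp: tiled_order_carrier)

lemma index_mult_mat_sum:
  assumes "a \<in> carrier_mat m n" "b \<in> carrier_mat n q" "i < m" "j < q"
  shows "(a * b) $$ (i, j) = (\<Sum>l<n. a $$ (i, l) * b $$ (l, j))"
  using assms by (simp add: scalar_prod_def atLeast0LessThan)

lemma tiled_order_mult_index:
  assumes "a \<in> carrier (tiled_order n d)" "b \<in> carrier (tiled_order n d)" "i < n" "j < n"
  shows "(a * b) $$ (i, j) = (\<Sum>l<n. a $$ (i, l) * b $$ (l, j))"
  using assms by (intro index_mult_mat_sum) (auto simp: tiled_order_carrier)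

context
  fixes n :: nat and d :: "nat \<Rightarrow> nat \<Rightarrow> int"
  assumes tiled: "tiled_exponents n d"
begin

lemma tiled_order_one_closed: "1\<^sub>m n \<in> carrier (tiled_order n d)"
  using tiled by (auto simp: tiled_order_carrier tiled_exponents_def single_one[symmetric]
      simp del: single_one)

lemma tiled_order_mult_closed:
  assumes "a \<in> carrier (tiled_order n d)" "b \<in> carrier (tiled_order n d)"
  shows "a * b \<in> carrier (tiled_order n d)"
proof -
  have "(a * b) $$ (i, j) \<in> poly_times_x (d i j)" if "i < n" "j < n" for i j
  proof -
    have "a $$ (i, l) * b $$ (l, j) \<in> poly_times_x (d i j)" if "l < n" for l
    proof (rule poly_times_x_mono)
      show "a $$ (i, l) * b $$ (l, j) \<in> poly_times_x (d i l + d l j)"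
        using assms \<open>i < n\<close> \<open>j < n\<close> that by (intro poly_times_x_mult tiled_orderD(3))
      show "d i j \<le> d i l + d l j"
        using tiled \<open>i < n\<close> \<open>j < n\<close> that by (auto simp: tiled_exponents_def)
    qed
    then show ?thesis
      using assms that by (auto simp: tiled_order_mult_index intro: poly_times_x_sum)
  qed
  then show ?thesis using assms by (auto simp: tiled_order_carrier)
qed

lemma tiled_order_add_closed:
  assumes "a \<in> carrier (tiled_order n d)" "b \<in> carrier (tiled_order n d)"
  shows "a + b \<in> carrier (tiled_order n d)"
  using assms by (auto simp: tiled_order_carrier intro!: poly_times_x_add)

end

definition entry_mat :: "nat \<Rightarrow> 'k::field laurent \<Rightarrow> nat \<Rightarrow> nat \<Rightarrow> 'k laurent mat" where
  "entry_mat n p i j = mat n n (\<lambda>(r, c). if r = i \<and> c = j then p else 0)"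

lemma entry_mat_index [simp]:
  "r < n \<Longrightarrow> c < n \<Longrightarrow> entry_mat n p i j $$ (r, c) = (if r = i \<and> c = j then p else 0)"
  "dim_row (entry_mat n p i j) = n" "dim_col (entry_mat n p i j) = n"
  by (auto simp: entry_mat_def)

lemma entry_mat_closed:
  "p \<in> poly_times_x (d i j) \<Longrightarrow> entry_mat n p i j \<in> carrier (tiled_order n d)"
  by (auto simp: tiled_order_carrier entry_mat_def)

lemma scalar_emb_index [simp]:
  "r < n \<Longrightarrow> c < n \<Longrightarrow> scalar_emb n p $$ (r, c) = (if r = c then p else 0)"
  "dim_row (scalar_emb n p) = n" "dim_col (scalar_emb n p) = n"
  by (auto simp: scalar_emb_def)

lemma scalar_emb_closed:
  "tiled_exponents n d \<Longrightarrow> p \<in> poly_carrier \<Longrightarrow> scalar_emb n p \<in> carrier (tiled_order n d)"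
  by (auto simp: tiled_order_carrier tiled_exponents_def poly_times_x_0[symmetric])

section \<open>Homomorphisms\<close>

lemma module_homD:
  assumes "\<phi> \<in> module_hom A M N"
  shows "\<phi> \<in> carrier M \<rightarrow>\<^sub>E carrier N"
    and "v \<in> carrier M \<Longrightarrow> \<phi> v \<in> carrier N"
    and "v \<in> carrier M \<Longrightarrow> w \<in> carrier M \<Longrightarrow> \<phi> (v \<oplus>\<^bsub>M\<^esub> w) = \<phi> v \<oplus>\<^bsub>N\<^esub> \<phi> w"
    and "v \<in> carrier M \<Longrightarrow> a \<in> carrier A \<Longrightarrow> \<phi> (ract M v a) = ract N (\<phi> v) a"
  using assms by (auto simp: module_hom_def)

lemma graded_homD:
  assumes "\<phi> \<in> graded_hom A M N"
  shows "\<phi> \<in> module_hom A M N" and "v \<in> gr M m \<Longrightarrow> \<phi> v \<in> gr N m"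
  using assms by (auto simp: graded_hom_def)

lemma module_hom_zero:
  assumes "abelian_group M" "abelian_group N" "\<phi> \<in> module_hom A M N"
  shows "\<phi> \<zero>\<^bsub>M\<^esub> = \<zero>\<^bsub>N\<^esub>"
proof -
  interpret M: abelian_group M by fact
  interpret N: abelian_group N by fact
  have "\<phi> \<zero>\<^bsub>M\<^esub> \<oplus>\<^bsub>N\<^esub> \<phi> \<zero>\<^bsub>M\<^esub> = \<phi> \<zero>\<^bsub>M\<^esub>"
    using module_homD(3)[OF assms(3), of "\<zero>\<^bsub>M\<^esub>" "\<zero>\<^bsub>M\<^esub>"] by simp
  then show ?thesis using module_homD(2)[OF assms(3), of "\<zero>\<^bsub>M\<^esub>"]
    by (metis M.zero_closed N.add.l_cancel_one)
qed

lemma module_hom_finsum: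
  assumes "abelian_group M" "abelian_group N" "\<phi> \<in> module_hom A M N"
    and "finite X" "c \<in> X \<rightarrow> carrier M"
  shows "\<phi> (finsum M c X) = finsum N (\<lambda>x. \<phi> (c x)) X"
proof -
  interpret M: abelian_group M by fact
  interpret N: abelian_group N by fact
  show ?thesis using assms(4,5)
  proof (induction X rule: finite_induct)
    case empty
    then show ?case using module_hom_zero[OF assms(1-3)] by simp
  next
    case (insert x X)
    then have "c \<in> X \<rightarrow> carrier M" "c x \<in> carrier M" by auto
    moreover from this have "(\<lambda>x. \<phi> (c x)) \<in> X \<rightarrow> carrier N" "\<phi> (c x) \<in> carrier N"
      using module_homD(2)[OF assms(3)] by auto
    ultimately show ?case using insert module_homD(3)[OF assms(3)] by simp
  qed
qed

lemma compose_graded_hom: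
  assumes "\<phi> \<in> graded_hom A M N" "\<psi> \<in> graded_hom A N Q"
    and "\<And>v w. v \<in> carrier M \<Longrightarrow> w \<in> carrier M \<Longrightarrow> v \<oplus>\<^bsub>M\<^esub> w \<in> carrier M"
    and "\<And>v a. v \<in> carrier M \<Longrightarrow> a \<in> carrier A \<Longrightarrow> ract M v a \<in> carrier M"
    and "\<And>m. gr M m \<subseteq> carrier M"
  shows "compose (carrier M) \<psi> \<phi> \<in> graded_hom A M Q"
  unfolding graded_hom_def module_hom_def
  using graded_homD[OF assms(1)] graded_homD[OF assms(2)]
    module_homD[OF graded_homD(1)[OF assms(1)]] module_homD[OF graded_homD(1)[OF assms(2)]]
    assms(3-5)
  by (auto simp: compose_def PiE_iff subset_iff)

text \<open>
  A finite direct sum of rows, indexed by \<open>J\<close>, on which the tiled order acts by multiplication of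
  row vectors with matrices. The action preserves the rows, so \<open>(j, l)\<close> stands for the entry in
  column \<open>l\<close> of row \<open>j\<close>.
\<close>
locale row_lattice = coordinates M "J \<times> {..<n}" \<kappa> f
  for n :: nat and d :: "nat \<Rightarrow> nat \<Rightarrow> int"
    and M :: "('k::field laurent mat, 'm) gmod" and J :: "'j set"
    and \<kappa> :: "'m \<Rightarrow> 'j \<times> nat \<Rightarrow> 'k laurent" and f :: "'j \<times> nat \<Rightarrow> int" +
  assumes tiled: "tiled_exponents n d"
    and finite_rows: "finite J"
    and act_closed: "\<And>v a. v \<in> carrier M \<Longrightarrow> a \<in> carrier (tiled_order n d) \<Longrightarrow>
          ract M v a \<in> carrier M"
    and act: "\<And>v a j l. v \<in> carrier M \<Longrightarrow> a \<in> carrier (tiled_order n d) \<Longrightarrow> j \<in> J \<Longrightarrow> l < n \<Longrightarrow>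
          \<kappa> (ract M v a) (j, l) = (\<Sum>l'<n. \<kappa> v (j, l') * a $$ (l', l))"
begin

lemma n_pos: "0 < n" using tiled by (auto simp: tiled_exponents_def)

lemma row_eqI:
  assumes "v \<in> carrier M" "w \<in> carrier M"
    and "\<And>j l. j \<in> J \<Longrightarrow> l < n \<Longrightarrow> \<kappa> v (j, l) = \<kappa> w (j, l)"
  shows "v = w"
  using assms by (intro coord_inj) auto

lemma gr_subset: "gr M m \<subseteq> carrier M" by (auto simp: gr_eq)

lemma graded_module: "graded_module (tiled_order n d) M"
proof (rule graded_moduleI)
  let ?\<rho> = "\<lambda>a (j, l) (j', l'). if j = j' then a $$ (l, l') else 0"
  have sum_rows: "(\<Sum>y\<in>J \<times> {..<n}. F y * (case y of (j', l') \<Rightarrow> if j' = j then G l' else 0))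
      = (\<Sum>l<n. F (j, l) * G l)" if "j \<in> J" for j and F :: "'j \<times> nat \<Rightarrow> 'k laurent" and G
  proof -
    have "(\<Sum>y\<in>J \<times> {..<n}. F y * (case y of (j', l') \<Rightarrow> if j' = j then G l' else 0))
      = (\<Sum>y\<in>{j} \<times> {..<n}. F y * (case y of (j', l') \<Rightarrow> if j' = j then G l' else 0))"
      using that finite_rows by (intro sum.mono_neutral_right) (auto split: if_splits)
    also have "\<dots> = (\<Sum>j'\<in>{j}. \<Sum>l<n. F (j', l) * G l)"
      unfolding sum.cartesian_product by (intro sum.cong) auto
    also have "\<dots> = (\<Sum>l<n. F (j, l) * G l)" by simp
    finally show ?thesis .
  qed
  fix a :: "'k laurent mat" and x assume a: "a \<in> carrier (tiled_order n d)" and x: "x \<in> J \<times> {..<n}"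
  {
    fix v assume v: "v \<in> carrier M"
    show "\<kappa> (ract M v a) x = (\<Sum>y\<in>J \<times> {..<n}. \<kappa> v y * ?\<rho> a y x)"
    proof (cases x)
      case (Pair j l)
      then show ?thesis using act[OF v a, of j l] x sum_rows[of j "\<kappa> v" "\<lambda>l'. a $$ (l', l)"]
        by (simp add: case_prod_beta)
    qed
  }
  fix b :: "'k laurent mat" and y assume b: "b \<in> carrier (tiled_order n d)" and y: "y \<in> J \<times> {..<n}"
  show "?\<rho> (a \<otimes>\<^bsub>tiled_order n d\<^esub> b) y x = (\<Sum>z\<in>J \<times> {..<n}. ?\<rho> a y z * ?\<rho> b z x)"
  proof (cases x; cases y)
    fix j l j' l' assume [simp]: "x = (j, l)" "y = (j', l')"
    show ?thesis
      using x y tiled_order_mult_index[OF a b]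
        sum_rows[of j "\<lambda>z. ?\<rho> a y z" "\<lambda>l'. b $$ (l', l)"]
      by (simp add: case_prod_beta)
  qed
  show "?\<rho> (a \<oplus>\<^bsub>tiled_order n d\<^esub> b) y x = ?\<rho> a y x + ?\<rho> b y x"
    using a b x y by (auto simp: tiled_order_carrier)
qed (auto simp: tiled_order_one_closed[OF tiled] tiled_order_mult_closed[OF tiled]
    tiled_order_add_closed[OF tiled] act_closed tiled_order_deg split: if_splits)

definition basis :: "'j \<times> nat \<Rightarrow> 'm" where
  "basis x = vec (\<lambda>y. if y = x then Poly_Mapping.single (f x) 1 else 0)"

lemma basis_closed: "basis x \<in> carrier M"
  unfolding basis_def by (rule vec_closed) auto

lemma coord_basis:
  "y \<in> J \<times> {..<n} \<Longrightarrow> \<kappa> (basis x) y = (if y = x then Poly_Mapping.single (f x) 1 else 0)"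
  unfolding basis_def by (rule coord_vec) auto

lemma basis_homogeneous: "basis x \<in> gr M (f x)"
  by (auto simp: gr_eq basis_closed coord_basis)

lemma act_entry_mat:
  assumes "v \<in> carrier M" "p \<in> poly_times_x (d i k)" "i < n" "k < n" "j \<in> J" "l < n"
  shows "\<kappa> (ract M v (entry_mat n p i k)) (j, l) = (if l = k then \<kappa> v (j, i) * p else 0)"
proof -
  have "\<kappa> (ract M v (entry_mat n p i k)) (j, l) =
      (\<Sum>l'<n. if l' = i then if l = k then \<kappa> v (j, i) * p else 0 else 0)"
    unfolding act[OF assms(1) entry_mat_closed[where d = d, OF assms(2)] assms(5,6)]
    using assms(3-) by (intro sum.cong) auto
  then show ?thesis using assms(3) by simp
qed

lemma act_scalar_emb:
  assumes "v \<in> carrier M" "p \<in> poly_carrier" "j \<in> J" "l < n"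
  shows "\<kappa> (ract M v (scalar_emb n p)) (j, l) = \<kappa> v (j, l) * p"
proof -
  have "\<kappa> (ract M v (scalar_emb n p)) (j, l) = (\<Sum>l'<n. if l' = l then \<kappa> v (j, l) * p else 0)"
    unfolding act[OF assms(1) scalar_emb_closed[OF tiled assms(2)] assms(3,4)]
    using assms(4) by (intro sum.cong) auto
  then show ?thesis using assms by simp
qed

text \<open>
  The coefficient with which a basis element occurs in the expansion of a vector over \<open>R\<close>.
\<close>
definition coeff_at :: "'m \<Rightarrow> 'j \<times> nat \<Rightarrow> 'k laurent" where
  "coeff_at v x = Poly_Mapping.single (- f x) 1 * \<kappa> v x"

lemma coeff_at_closed:
  assumes "v \<in> carrier M" "x \<in> J \<times> {..<n}"
  shows "coeff_at v x \<in> poly_carrier"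
  using monomial_mult_poly_times_x[OF coord_in[OF assms], of 0 "- f x"]
  by (simp add: coeff_at_def poly_times_x_0)

lemma basis_expansion:
  assumes v: "v \<in> carrier M"
  shows "v = (\<Oplus>\<^bsub>M\<^esub>x\<in>J \<times> {..<n}. ract M (basis x) (scalar_emb n (coeff_at v x)))"
proof -
  let ?c = "\<lambda>x. ract M (basis x) (scalar_emb n (coeff_at v x))"
  have c: "?c \<in> J \<times> {..<n} \<rightarrow> carrier M"
    using v by (auto intro!: act_closed basis_closed scalar_emb_closed[OF tiled] coeff_at_closed)
  show ?thesis
  proof (rule row_eqI[OF v finsum_closed[OF c]])
    fix j l assume jl: "j \<in> J" "l < n"
    have "\<kappa> (finsum M ?c (J \<times> {..<n})) (j, l) =
        (\<Sum>x\<in>J \<times> {..<n}. \<kappa> (basis x) (j, l) * coeff_at v x)"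
      using c jl v finite_index
      by (auto simp: coord_finsum act_scalar_emb basis_closed coeff_at_closed intro!: sum.cong)
    also have "\<dots> = (\<Sum>x\<in>J \<times> {..<n}. if x = (j, l) then \<kappa> v (j, l) else 0)"
      using jl by (intro sum.cong) (auto simp: coord_basis coeff_at_def monomial_mult_cancel)
    also have "\<dots> = \<kappa> v (j, l)" using jl finite_index by simp
    finally show "\<kappa> v (j, l) = \<kappa> (finsum M ?c (J \<times> {..<n})) (j, l)" by simp
  qed
qed

end

locale row_lattice_pair =
  S: row_lattice n d M J \<kappa> f + T: row_lattice n d M' J' \<kappa>' f'
  for n :: nat and d :: "nat \<Rightarrow> nat \<Rightarrow> int"
    and M :: "('k::field laurent mat, 'm) gmod" and J :: "'j set"
    and \<kappa> :: "'m \<Rightarrow> 'j \<times> nat \<Rightarrow> 'k laurent" and f :: "'j \<times> nat \<Rightarrow> int"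
    and M' :: "('k laurent mat, 'n) gmod" and J' :: "'i set"
    and \<kappa>' :: "'n \<Rightarrow> 'i \<times> nat \<Rightarrow> 'k laurent" and f' :: "'i \<times> nat \<Rightarrow> int"
begin

abbreviation "Hom \<equiv> graded_hom (tiled_order n d) M M'"

text \<open>
  The scalar by which \<open>\<phi>\<close> maps row \<open>s\<close> to row \<open>t\<close>. By \<open>hom_basis\<close> it can be read off in every
  column; column 0 always exists.
\<close>
definition coeff :: "('m \<Rightarrow> 'n) \<Rightarrow> 'i \<Rightarrow> 'j \<Rightarrow> 'k" where
  "coeff \<phi> t s = Poly_Mapping.lookup (\<kappa>' (\<phi> (S.basis (s, 0))) (t, 0)) (f (s, 0))"

text \<open>
  A basis element in column \<open>l\<close> is fixed by the idempotent at \<open>l\<close>, hence so is its image, which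
  therefore lives in column \<open>l\<close>; having degree 0, the map leaves only a scalar \<open>e l\<close>. Moving two
  columns to a common position by elements of the order shows that this scalar does not depend
  on the column.
\<close>
lemma hom_basis:
  assumes \<phi>: "\<phi> \<in> Hom" and s: "s \<in> J" and t: "t \<in> J'" and l: "l < n" and l': "l' < n"
  shows "\<kappa>' (\<phi> (S.basis (s, l))) (t, l') =
           (if l' = l then Poly_Mapping.single (f (s, l)) (coeff \<phi> t s) else 0)"
proof -
  note hom = module_homD[OF graded_homD(1)[OF \<phi>]]
  have \<phi>b: "\<phi> (S.basis x) \<in> carrier M'" for x by (rule hom(2)[OF S.basis_closed])
  have one: "1 \<in> poly_times_x (d i i)" if "i < n" for i
    using S.tiled that by (simp add: tiled_exponents_def single_one[symmetric] del: single_one)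
  have col: "\<kappa>' (\<phi> (S.basis (s, i))) (t, l') = 0" if "i < n" "l' \<noteq> i" "l' < n" for i l'
  proof -
    have "ract M (S.basis (s, i)) (entry_mat n 1 i i) = S.basis (s, i)"
      using that one
      by (intro S.row_eqI)
         (auto simp: S.act_entry_mat S.basis_closed S.coord_basis s
           intro!: S.act_closed entry_mat_closed)
    then have "\<phi> (S.basis (s, i)) = ract M' (\<phi> (S.basis (s, i))) (entry_mat n 1 i i)"
      using hom(4)[OF S.basis_closed[of "(s, i)"] entry_mat_closed[where d = d, OF one[OF that(1)]]]
      by simp
    then have "\<kappa>' (\<phi> (S.basis (s, i))) (t, l') =
        \<kappa>' (ract M' (\<phi> (S.basis (s, i))) (entry_mat n 1 i i)) (t, l')" by simp
    also have "\<dots> = 0" using T.act_entry_mat[OF \<phi>b one[OF that(1)] that(1,1) t that(3)] that by simp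
    finally show ?thesis .
  qed
  define e where "e i = Poly_Mapping.lookup (\<kappa>' (\<phi> (S.basis (s, i))) (t, i)) (f (s, i))" for i
  have diag: "\<kappa>' (\<phi> (S.basis (s, i))) (t, i) = Poly_Mapping.single (f (s, i)) (e i)"
    if "i < n" for i
    unfolding e_def
    using graded_homD(2)[OF \<phi> S.basis_homogeneous, of "(s, i)"] that t
    by (intro homog_eq_monomial) (auto simp: T.gr_eq)
  have "e l = e 0"
  proof -
    \<comment> \<open>The exponent N is large enough for x^N at (l, 0) to belong to the order and for the exponent
      N' to be nonnegative; N' is chosen such that both products are equal.\<close>
    define N where "N = max (d l 0) (f (s, 0) - f (s, l))"
    define N' where "N' = f (s, l) + N - f (s, 0)"
    have N: "Poly_Mapping.single N (1::'k) \<in> poly_times_x (d l 0)"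
      "Poly_Mapping.single N' (1::'k) \<in> poly_times_x (d 0 0)"
      using S.tiled S.n_pos by (auto simp: N_def N'_def tiled_exponents_def)
    let ?p = "Poly_Mapping.single N (1::'k)" and ?q = "Poly_Mapping.single N' (1::'k)"
    have "ract M (S.basis (s, l)) (entry_mat n ?p l 0) = ract M (S.basis (s, 0)) (entry_mat n ?q 0 0)"
      using N l S.n_pos
      by (intro S.row_eqI)
         (auto simp: S.act_entry_mat S.basis_closed S.coord_basis s mult_single N'_def
           simp del: monomial_in_poly_times_x intro!: S.act_closed entry_mat_closed)
    then have "ract M' (\<phi> (S.basis (s, l))) (entry_mat n ?p l 0)
        = ract M' (\<phi> (S.basis (s, 0))) (entry_mat n ?q 0 0)"
      using hom(4)[OF S.basis_closed[of "(s, l)"] entry_mat_closed[where d = d, OF N(1)]]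
        hom(4)[OF S.basis_closed[of "(s, 0)"] entry_mat_closed[where d = d, OF N(2)]] by simp
    then have "\<kappa>' (ract M' (\<phi> (S.basis (s, l))) (entry_mat n ?p l 0)) (t, 0)
        = \<kappa>' (ract M' (\<phi> (S.basis (s, 0))) (entry_mat n ?q 0 0)) (t, 0)" by simp
    then have "Poly_Mapping.single (f (s, l) + N) (e l) = Poly_Mapping.single (f (s, l) + N) (e 0)"
      unfolding T.act_entry_mat[OF \<phi>b N(1) l S.n_pos t S.n_pos]
        T.act_entry_mat[OF \<phi>b N(2) S.n_pos S.n_pos t S.n_pos] diag[OF l] diag[OF S.n_pos]
      by (simp add: mult_single N'_def)
    then show ?thesis by (metis lookup_single_eq)
  qed
  moreover have "e 0 = coeff \<phi> t s" by (simp add: coeff_def e_def)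
  ultimately show ?thesis using col[OF l _ l'] diag[OF l] by auto
qed

text \<open>
  A homomorphism is linear over \<open>R\<close> and hence determined by its values on the basis, where it acts
  by scalars.
\<close>
lemma coord_hom:
  assumes \<phi>: "\<phi> \<in> Hom" and v: "v \<in> carrier M" and t: "t \<in> J'" and l: "l < n"
  shows "\<kappa>' (\<phi> v) (t, l) = (\<Sum>s\<in>J. Poly_Mapping.single 0 (coeff \<phi> t s) * \<kappa> v (s, l))"
proof -
  note mhom = graded_homD(1)[OF \<phi>]
  note hom = module_homD[OF mhom]
  let ?X = "J \<times> {..<n}"
  let ?r = "\<lambda>x. scalar_emb n (S.coeff_at v x)"
  have r: "?r x \<in> carrier (tiled_order n d)" if "x \<in> ?X" for x
    using v that by (intro scalar_emb_closed[OF S.tiled] S.coeff_at_closed)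
  have "\<phi> v = \<phi> (\<Oplus>\<^bsub>M\<^esub>x\<in>?X. ract M (S.basis x) (?r x))" using S.basis_expansion[OF v] by simp
  also have "\<dots> = (\<Oplus>\<^bsub>M'\<^esub>x\<in>?X. \<phi> (ract M (S.basis x) (?r x)))"
    using r by (intro module_hom_finsum[OF S.abelian_group T.abelian_group mhom S.finite_index])
      (auto intro!: S.act_closed S.basis_closed)
  also have "\<dots> = (\<Oplus>\<^bsub>M'\<^esub>x\<in>?X. ract M' (\<phi> (S.basis x)) (?r x))"
    using r by (intro T.finsum_cong') (auto simp: hom(4) S.basis_closed intro!: T.act_closed hom(2))
  finally have "\<kappa>' (\<phi> v) (t, l) = (\<Sum>x\<in>?X. \<kappa>' (ract M' (\<phi> (S.basis x)) (?r x)) (t, l))"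
    using r t l S.finite_index
    by (simp add: T.coord_finsum Pi_def T.act_closed hom(2) S.basis_closed)
  also have "\<dots> = (\<Sum>s\<in>J. \<Sum>l'<n. \<kappa>' (\<phi> (S.basis (s, l'))) (t, l) * S.coeff_at v (s, l'))"
    using t l v unfolding sum.cartesian_product
    by (intro sum.cong) (auto simp: T.act_scalar_emb hom(2) S.basis_closed S.coeff_at_closed)
  also have "\<dots> = (\<Sum>s\<in>J. \<Sum>l'<n. if l' = l
      then Poly_Mapping.single (f (s, l)) (coeff \<phi> t s) * S.coeff_at v (s, l) else 0)"
    using t l by (intro sum.cong refl) (simp add: hom_basis[OF \<phi>])
  also have "\<dots> = (\<Sum>s\<in>J. Poly_Mapping.single (f (s, l)) (coeff \<phi> t s) * S.coeff_at v (s, l))"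
    using l by simp
  also have "\<dots> = (\<Sum>s\<in>J. Poly_Mapping.single 0 (coeff \<phi> t s) * \<kappa> v (s, l))"
    by (intro sum.cong) (auto simp: S.coeff_at_def mult.assoc[symmetric] mult_single)
  finally show ?thesis .
qed

lemma coeff_nonzero_le:
  assumes \<phi>: "\<phi> \<in> Hom" and s: "s \<in> J" and t: "t \<in> J'" and l: "l < n"
    and "coeff \<phi> t s \<noteq> 0"
  shows "f' (t, l) \<le> f (s, l)"
  using T.coord_in[OF module_homD(2)[OF graded_homD(1)[OF \<phi>] S.basis_closed], of "(t, l)" "(s, l)"]
    hom_basis[OF \<phi> s t l l] assms by auto

lemma coeff_eqI:
  assumes "\<And>v. v \<in> carrier M \<Longrightarrow>
      \<kappa>' (\<phi> v) (t, 0) = (\<Sum>s\<in>J. Poly_Mapping.single 0 (c s) * \<kappa> v (s, 0))"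
    and s: "s \<in> J"
  shows "coeff \<phi> t s = c s"
proof -
  have "\<kappa>' (\<phi> (S.basis (s, 0))) (t, 0)
      = (\<Sum>s'\<in>J. if s' = s then Poly_Mapping.single (f (s, 0)) (c s) else 0)"
    using assms(1)[OF S.basis_closed, of "(s, 0)"] S.n_pos
    by (auto simp: S.coord_basis mult_single intro!: sum.cong)
  then show ?thesis using s S.finite_rows by (simp add: coeff_def)
qed

definition hom_of :: "('i \<Rightarrow> 'j \<Rightarrow> 'k) \<Rightarrow> 'm \<Rightarrow> 'n" where
  "hom_of c = (\<lambda>v\<in>carrier M. T.vec (\<lambda>(t, l). \<Sum>s\<in>J. Poly_Mapping.single 0 (c t s) * \<kappa> v (s, l)))"

context
  fixes c :: "'i \<Rightarrow> 'j \<Rightarrow> 'k"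
  assumes c: "\<And>s t l. s \<in> J \<Longrightarrow> t \<in> J' \<Longrightarrow> l < n \<Longrightarrow> c t s \<noteq> 0 \<Longrightarrow> f' (t, l) \<le> f (s, l)"
begin

lemma hom_of_in_range:
  assumes "v \<in> carrier M" "x \<in> J' \<times> {..<n}"
  shows "(case x of (t, l) \<Rightarrow> \<Sum>s\<in>J. Poly_Mapping.single 0 (c t s) * \<kappa> v (s, l)) \<in> poly_times_x (f' x)"
proof (cases x)
  case (Pair t l)
  have "Poly_Mapping.single 0 (c t s) * \<kappa> v (s, l) \<in> poly_times_x (f' (t, l))" if s: "s \<in> J" for s
  proof (cases "c t s = 0")
    case False
    have "f' (t, l) \<le> f (s, l)" using c[OF s _ _ False] assms(2) Pair by simp
    then show ?thesis
      using S.coord_in[OF assms(1), of "(s, l)"] s assms(2) Pair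
      by (intro poly_times_x_mono[OF monomial_mult_poly_times_x[OF _ refl]]) auto
  qed simp
  then show ?thesis using Pair by (auto intro: poly_times_x_sum)
qed

lemma hom_of_closed: "v \<in> carrier M \<Longrightarrow> hom_of c v \<in> carrier M'"
  using hom_of_in_range by (auto simp: hom_of_def intro!: T.vec_closed)

lemma coord_hom_of:
  assumes "v \<in> carrier M" "t \<in> J'" "l < n"
  shows "\<kappa>' (hom_of c v) (t, l) = (\<Sum>s\<in>J. Poly_Mapping.single 0 (c t s) * \<kappa> v (s, l))"
  using T.coord_vec[OF hom_of_in_range[OF assms(1)], of "(t, l)"] assms by (simp add: hom_of_def)

lemma hom_of_hom: "hom_of c \<in> Hom"
  unfolding graded_hom_def module_hom_def
proof (intro CollectI conjI ballI allI subsetI)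
  show "hom_of c \<in> carrier M \<rightarrow>\<^sub>E carrier M'"
    using hom_of_closed by (auto simp: hom_of_def)
next
  fix v w assume v: "v \<in> carrier M" and w: "w \<in> carrier M"
  show "hom_of c (v \<oplus>\<^bsub>M\<^esub> w) = hom_of c v \<oplus>\<^bsub>M'\<^esub> hom_of c w"
    using v w
    by (intro T.row_eqI)
       (auto simp: coord_hom_of T.coord_add hom_of_closed S.add_closed T.add_closed S.coord_add
         sum.distrib distrib_left)
next
  fix v and a :: "'k laurent mat"
  assume v: "v \<in> carrier M" and a: "a \<in> carrier (tiled_order n d)"
  show "hom_of c (ract M v a) = ract M' (hom_of c v) a"
  proof (rule T.row_eqI)
    fix t l assume t: "t \<in> J'" and l: "l < n"
    have "\<kappa>' (hom_of c (ract M v a)) (t, l)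
        = (\<Sum>s\<in>J. \<Sum>l'<n. Poly_Mapping.single 0 (c t s) * \<kappa> v (s, l') * a $$ (l', l))"
      using v a t l by (simp add: coord_hom_of S.act_closed S.act sum_distrib_left mult.assoc)
    also have "\<dots> = (\<Sum>l'<n. \<Sum>s\<in>J. Poly_Mapping.single 0 (c t s) * \<kappa> v (s, l') * a $$ (l', l))"
      by (rule sum.swap)
    also have "\<dots> = \<kappa>' (ract M' (hom_of c v) a) (t, l)"
      using v a t l by (simp add: coord_hom_of hom_of_closed T.act sum_distrib_right)
    finally show "\<kappa>' (hom_of c (ract M v a)) (t, l) = \<kappa>' (ract M' (hom_of c v) a) (t, l)" .
  qed (use v a in \<open>auto intro: hom_of_closed S.act_closed T.act_closed\<close>)
next
  fix m w assume "w \<in> hom_of c ` gr M m"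
  then obtain v where v: "v \<in> gr M m" "w = hom_of c v" by auto
  then show "w \<in> gr M' m"
    by (auto simp: T.gr_eq S.gr_eq hom_of_closed coord_hom_of
        intro!: homog_sum monomial_mult_homog)
qed

lemma coeff_hom_of: "s \<in> J \<Longrightarrow> t \<in> J' \<Longrightarrow> coeff (hom_of c) t s = c t s"
  using coord_hom_of S.n_pos by (intro coeff_eqI) auto

end

end

section \<open>Constructions of row lattices\<close>

text \<open>
  Row lattices are closed under finite direct sums, shifts and truncations. Together with the
  rows of the order, the row module and the regular module they yield V and the free modules.
\<close>
lemma row_lattice_direct_sum:
  fixes M :: "'s \<Rightarrow> ('k::field laurent mat, 'm) gmod"
  assumes S: "finite S" and tiled: "tiled_exponents n d"
    and M: "\<And>s. s \<in> S \<Longrightarrow> row_lattice n d (M s) (J s) (\<kappa> s) (f s)"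
  shows "row_lattice n d (direct_sum S M) (Sigma S J)
           (\<lambda>v ((s, j), l). \<kappa> s (v s) (j, l)) (\<lambda>((s, j), l). f s (j, l))"
proof -
  have [simp]: "carrier (direct_sum S M) = (\<Pi>\<^sub>E s\<in>S. carrier (M s))"
    "zero (direct_sum S M) = (\<lambda>s\<in>S. \<zero>\<^bsub>M s\<^esub>)"
    "add (direct_sum S M) = (\<lambda>v w. \<lambda>s\<in>S. v s \<oplus>\<^bsub>M s\<^esub> w s)"
    "ract (direct_sum S M) = (\<lambda>v a. \<lambda>s\<in>S. ract (M s) (v s) a)"
    "gr (direct_sum S M) = (\<lambda>m. \<Pi>\<^sub>E s\<in>S. gr (M s) m)"
    by (simp_all add: direct_sum_def)
  note C = M[THEN row_lattice.axioms(1)]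
  note R = M
  have fin: "finite (Sigma S J)" using S row_lattice.finite_rows[OF R] by auto
  show ?thesis
  proof (unfold_locales, goal_cases)
    case 1
    then show ?case using fin by simp
  next
    case (2 v x)
    then show ?case
      by (auto simp: PiE_iff intro!: coordinates.coord_in[OF C])
  next
    case (3 v w)
    show ?case
    proof (rule PiE_ext)
      fix s assume s: "s \<in> S"
      show "v s = w s"
      proof (rule row_lattice.row_eqI[OF R[OF s]])
        show "v s \<in> carrier (M s)" "w s \<in> carrier (M s)" using 3(1,2) s by (auto simp: PiE_iff)
        fix j l assume "j \<in> J s" "l < n"
        then show "\<kappa> s (v s) (j, l) = \<kappa> s (w s) (j, l)" using 3(3)[of "((s, j), l)"] s by simp
      qed
    qed (use 3 in auto)
  next
    case (4 F)
    have "\<exists>w\<in>carrier (M s). \<forall>x\<in>J s \<times> {..<n}. \<kappa> s w x = F ((s, fst x), snd x)" if "s \<in> S" for s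
    proof (rule coordinates.coord_surj[OF C[OF that]])
      fix x assume "x \<in> J s \<times> {..<n}"
      then show "F ((s, fst x), snd x) \<in> poly_times_x (f s x)"
        using 4[of "((s, fst x), snd x)"] that by (auto simp: case_prod_beta)
    qed
    then obtain w where w: "\<And>s. s \<in> S \<Longrightarrow> w s \<in> carrier (M s)"
      "\<And>s x. s \<in> S \<Longrightarrow> x \<in> J s \<times> {..<n} \<Longrightarrow> \<kappa> s (w s) x = F ((s, fst x), snd x)"
      by metis
    show ?case
      by (rule bexI[of _ "restrict w S"]) (auto simp: w)
  next
    case 5
    show ?case by (auto intro!: coordinates.zero_closed[OF C])
  next
    case (6 x)
    then show ?case by (auto intro!: coordinates.coord_zero[OF C])
  next
    case (7 v w)
    then show ?case by (auto simp: PiE_iff intro!: coordinates.add_closed[OF C])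
  next
    case (8 v w x)
    then show ?case by (auto simp: PiE_iff intro!: coordinates.coord_add[OF C])
  next
    case (9 m)
    have *: "(\<forall>s\<in>S. v s \<in> gr (M s) m) \<longleftrightarrow>
        (\<forall>s\<in>S. v s \<in> carrier (M s)) \<and> (\<forall>s\<in>S. \<forall>j\<in>J s. \<forall>l<n. \<kappa> s (v s) (j, l) \<in> homog m)" for v
      using coordinates.gr_eq[OF C] by fastforce
    have "v \<in> (\<Pi>\<^sub>E s\<in>S. gr (M s) m) \<longleftrightarrow> v \<in> (\<Pi>\<^sub>E s\<in>S. carrier (M s)) \<and>
        (\<forall>s\<in>S. \<forall>j\<in>J s. \<forall>l<n. \<kappa> s (v s) (j, l) \<in> homog m)" for v
      unfolding PiE_iff * by blast
    then show ?case by (simp add: set_eq_iff) blast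
  next
    case 10
    show ?case by (rule tiled)
  next
    case 11
    show ?case by (rule fin)
  next
    case (12 v a)
    then show ?case by (auto simp: PiE_iff intro!: row_lattice.act_closed[OF R])
  next
    case (13 v a j l)
    then show ?case by (auto simp: PiE_iff intro!: row_lattice.act[OF R])
  qed
qed

lemma row_lattice_shift:
  fixes M :: "('k::field laurent mat, 'm) gmod"
  assumes "row_lattice n d M J \<kappa> f"
  shows "row_lattice n d (shift M t) J (\<lambda>v x. Poly_Mapping.single (- t) 1 * \<kappa> v x) (\<lambda>x. f x - t)"
proof -
  interpret row_lattice n d M J \<kappa> f by fact
  have [simp]: "carrier (shift M t) = carrier M" "zero (shift M t) = zero M"
    "add (shift M t) = add M" "ract (shift M t) = ract M" "gr (shift M t) = (\<lambda>m. gr M (m + t))"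
    by (simp_all add: shift_def)
  have cancel: "Poly_Mapping.single (- t) 1 * g = Poly_Mapping.single (- t) 1 * h \<longleftrightarrow> g = h"
    for g h :: "'k laurent"
    using monomial_mult_cancel(1)[of t] by metis
  show ?thesis
  proof (unfold_locales, goal_cases)
    case (2 v x)
    then show ?case by (intro monomial_mult_poly_times_x[OF coord_in]) auto
  next
    case (3 v w)
    show ?case
    proof (rule coord_inj[OF 3(1,2)[simplified]])
      fix x assume "x \<in> J \<times> {..<n}"
      from 3(3)[OF this] show "\<kappa> v x = \<kappa> w x" by (simp only: cancel)
    qed
  next
    case (4 F)
    have "\<exists>v\<in>carrier M. \<forall>x\<in>J \<times> {..<n}. \<kappa> v x = Poly_Mapping.single t 1 * F x"
    proof (rule coord_surj)
      fix x assume "x \<in> J \<times> {..<n}"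
      then show "Poly_Mapping.single t 1 * F x \<in> poly_times_x (f x)"
        using 4[of x] by (intro monomial_mult_poly_times_x[of _ "f x - t"]) auto
    qed
    then obtain v where "v \<in> carrier M" "\<forall>x\<in>J \<times> {..<n}. \<kappa> v x = Poly_Mapping.single t 1 * F x"
      by blast
    then show ?case by (intro bexI[of _ v]) (auto simp: monomial_mult_cancel)
  next
    case (9 m)
    have "Poly_Mapping.single (- t) 1 * g \<in> homog m \<longleftrightarrow> g \<in> homog (m + t)" for g :: "'k laurent"
      using monomial_mult_homog[of g "m + t" m "- t" 1]
        monomial_mult_homog[of "Poly_Mapping.single (- t) 1 * g" m "m + t" t 1]
      by (auto simp: monomial_mult_cancel)
    then show ?case by (auto simp: gr_eq)
  qed (auto simp: finite_index tiled finite_rows zero_closed coord_zero add_closed coord_add act_closed act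
      distrib_left sum_distrib_left mult.assoc)
qed

text \<open>
  The homogeneous elements of nonnegative degree have polynomial coordinates. Conversely, if all
  coordinates are polynomials, then so are those of the homogeneous components, and the components
  of negative degree vanish.
\<close>
lemma (in coordinates) trunc_carrier:
  "generate (add_monoid M) (\<Union>m\<in>{0..}. gr M m)
     = {v \<in> carrier M. \<forall>x\<in>X. \<kappa> v x \<in> poly_times_x (max (f x) 0)}" (is "?G = ?C")
proof
  show "?G \<subseteq> ?C"
  proof
    fix v assume "v \<in> ?G"
    then show "v \<in> ?C"
    proof (induction rule: generate.induct)
      case one
      then show ?case by (simp add: coord_zero)
    next
      case (incl v)
      then show ?case
        by (auto simp: gr_eq homog_iff poly_times_x_iff max_def dest!: coord_in)
    next
      case (inv v)
      then have "v \<in> ?C"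
        by (auto simp: gr_eq homog_iff poly_times_x_iff max_def dest!: coord_in)
      then show ?case
        by (auto simp: a_inv_def[symmetric] coord_minus intro: poly_times_x_uminus)
    next
      case (eng v w)
      then show ?case by (auto simp: coord_add intro: poly_times_x_add)
    qed
  qed
  show "?C \<subseteq> ?G"
  proof
    fix v assume v: "v \<in> ?C"
    obtain c where c: "\<And>m. c m \<in> gr M m" "finite {m. c m \<noteq> \<zero>\<^bsub>M\<^esub>}"
      "v = (\<Oplus>\<^bsub>M\<^esub>m\<in>{m. c m \<noteq> \<zero>\<^bsub>M\<^esub>}. c m)"
      using homogeneous_decomposition[of v] v by auto
    have "0 \<le> m" if "c m \<noteq> \<zero>\<^bsub>M\<^esub>" for m
    proof (rule ccontr)
      assume m: "\<not> 0 \<le> m"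
      have "c m = \<zero>\<^bsub>M\<^esub>"
      proof (rule coord_inj)
        fix x assume x: "x \<in> X"
        have "Poly_Mapping.lookup (\<kappa> v x) m
            = (\<Sum>l\<in>{l. c l \<noteq> \<zero>\<^bsub>M\<^esub>}. Poly_Mapping.lookup (\<kappa> (c l) x) m)"
          using c(1,2) x by (subst c(3)) (auto simp: coord_finsum lookup_sum gr_eq Pi_def)
        also have "\<dots> = (\<Sum>l\<in>{l. c l \<noteq> \<zero>\<^bsub>M\<^esub>}. if l = m then Poly_Mapping.lookup (\<kappa> (c m) x) m else 0)"
          using c(1) x by (intro sum.cong) (auto simp: gr_eq homog_iff)
        also have "\<dots> = Poly_Mapping.lookup (\<kappa> (c m) x) m"
          using c(2) that by simp
        finally have "Poly_Mapping.lookup (\<kappa> (c m) x) m = 0"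
          using v x m by (auto simp: poly_times_x_iff)
        moreover have "\<kappa> (c m) x \<in> homog m" using c(1)[of m] x by (auto simp: gr_eq)
        ultimately show "\<kappa> (c m) x = \<kappa> \<zero>\<^bsub>M\<^esub> x"
          using homog_eq_monomial[of "\<kappa> (c m) x" m] x by (simp add: coord_zero)
      qed (use c(1)[of m] in \<open>auto simp: gr_eq\<close>)
      then show False using that by simp
    qed
    then have gen: "c m \<in> ?G" if "c m \<noteq> \<zero>\<^bsub>M\<^esub>" for m
      using c(1)[of m] that by (auto intro: generate.incl)
    have "finsum M c A \<in> ?G" if "finite A" "A \<subseteq> {m. c m \<noteq> \<zero>\<^bsub>M\<^esub>}" for A
      using that
    proof (induction A rule: finite_induct)
      case empty
      then show ?case using generate.one[of "add_monoid M"] by simp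
    next
      case (insert a A)
      have "c m \<in> carrier M" for m using c(1)[of m] by (auto simp: gr_eq)
      then show ?case using insert generate.eng[of "c a" "add_monoid M" _ "finsum M c A"] gen
        by (auto simp: Pi_def)
    qed
    then show "v \<in> ?G" using c by blast
  qed
qed

lemma row_lattice_trunc:
  fixes M :: "('k::field laurent mat, 'm) gmod" and J :: "'j set"
  assumes "row_lattice n d M J \<kappa> f"
    and nonneg: "\<And>i j. i < n \<Longrightarrow> j < n \<Longrightarrow> 0 \<le> d i j"
  shows "row_lattice n d (trunc M) J \<kappa> (\<lambda>x. max (f x) 0)"
proof -
  interpret row_lattice n d M J \<kappa> f by fact
  let ?C = "{v \<in> carrier M. \<forall>x\<in>J \<times> {..<n}. \<kappa> v x \<in> poly_times_x (max (f x) 0)}"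
  have [simp]: "carrier (trunc M) = ?C" "zero (trunc M) = zero M"
    "add (trunc M) = add M" "ract (trunc M) = ract M"
    "gr (trunc M) = (\<lambda>m. if 0 \<le> m then gr M m else {\<zero>\<^bsub>M\<^esub>})"
    unfolding trunc_carrier[symmetric] by (simp_all add: trunc_def)
  have low: "(poly_times_x (max (f x) 0) :: 'k laurent set) \<subseteq> poly_times_x (f x)" for x
    by (auto intro: poly_times_x_mono)
  \<comment> \<open>The order acts on polynomial rows because it is itself nonnegatively graded.\<close>
  have act_nonneg: "\<kappa> (ract M v a) (j, l) \<in> poly_times_x (max (f (j, l)) 0)"
    if v: "v \<in> ?C" and a: "a \<in> carrier (tiled_order n d)" and jl: "j \<in> J" "l < n" for v a j l
  proof -
    have "\<kappa> (ract M v a) (j, l) \<in> poly_times_x (f (j, l))"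
      using v a jl by (intro coord_in act_closed) auto
    moreover have "\<kappa> (ract M v a) (j, l) \<in> poly_times_x 0"
    proof -
      have "\<kappa> v (j, l') * a $$ (l', l) \<in> poly_times_x 0" if "l' < n" for l'
      proof -
        have "\<kappa> v (j, l') * a $$ (l', l) \<in> poly_times_x (max (f (j, l')) 0 + d l' l)"
          using v a jl that by (intro poly_times_x_mult tiled_orderD(3)) auto
        then show ?thesis using nonneg[of l' l] that jl by (auto intro: poly_times_x_mono)
      qed
      then show ?thesis using v a jl by (auto simp: act intro: poly_times_x_sum)
    qed
    ultimately show ?thesis by (auto simp: max_def)
  qed
  show ?thesis
  proof (unfold_locales, goal_cases)
    case (3 v w)
    then show ?case by (intro coord_inj) auto
  next
    case (4 F)
    then have "\<exists>v\<in>carrier M. \<forall>x\<in>J \<times> {..<n}. \<kappa> v x = F x"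
      using low by (intro coord_surj) blast
    then obtain v where "v \<in> carrier M" "\<forall>x\<in>J \<times> {..<n}. \<kappa> v x = F x" by blast
    then show ?case using 4 by (intro bexI[of _ v]) auto
  next
    case (9 m)
    have "v = \<zero>\<^bsub>M\<^esub>" if "v \<in> ?C" "\<forall>x\<in>J \<times> {..<n}. \<kappa> v x \<in> homog m" "\<not> 0 \<le> m" for v
    proof (rule coord_inj)
      fix x assume "x \<in> J \<times> {..<n}"
      then show "\<kappa> v x = \<kappa> \<zero>\<^bsub>M\<^esub> x"
        using that homog_Int_poly_times_x[of "\<kappa> v x" m "max (f x) 0"] by (auto simp: coord_zero)
    qed (use that in auto)
    moreover have "\<kappa> v x \<in> poly_times_x (max (f x) 0)"
      if "v \<in> gr M m" "0 \<le> m" "x \<in> J \<times> {..<n}" for v x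
      using that coord_in[of v x] by (auto simp: gr_eq homog_iff poly_times_x_iff max_def)
    ultimately show ?case
      by (auto simp: gr_eq coord_zero)
  next
    case (12 v a)
    then show ?case using act_nonneg by (auto intro: act_closed)
  qed (auto simp: finite_index tiled finite_rows coord_zero coord_add act
      intro: poly_times_x_add)
qed

lemma row_lattice_row_proj:
  assumes tiled: "tiled_exponents n d" and i: "i < n"
  shows "row_lattice n d (row_proj n d i :: ('k::field laurent mat, 'k laurent mat) gmod) {()}
           (\<lambda>v (_, l). v $$ (i, l)) (\<lambda>(_, l). d i l)"
proof -
  let ?A = "tiled_order n d :: ('k, 'k laurent mat) graded_algebra"
  have dim: "dim_row (diag_unit n i) = n" "dim_col (diag_unit n i) = n"
    by (simp_all add: diag_unit_def)
  have diag: "(diag_unit n i * a) $$ (r, c) = (if r = i then a $$ (i, c) else 0)"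
    if "a \<in> carrier ?A" "r < n" "c < n" for a r c
  proof -
    have "(diag_unit n i * a) $$ (r, c) = (\<Sum>l<n. diag_unit n i $$ (r, l) * a $$ (l, c))"
      using that by (intro index_mult_mat_sum[of _ n]) (auto simp: diag_unit_def tiled_order_carrier)
    also have "\<dots> = (\<Sum>l<n. if l = i then (if r = i then a $$ (i, c) else 0) else 0)"
      using that i by (intro sum.cong) (auto simp: diag_unit_def)
    finally show ?thesis using i by simp
  qed
  \<comment> \<open>The right ideal generated by the idempotent at i consists of the matrices concentrated in row i.\<close>
  define C where "C = {a \<in> carrier ?A. \<forall>r<n. \<forall>c<n. r \<noteq> i \<longrightarrow> a $$ (r, c) = 0}"
  have C: "(\<lambda>a. diag_unit n i * a) ` carrier ?A = C"
  proof (intro subset_antisym subsetI)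
    fix v assume "v \<in> (\<lambda>a. diag_unit n i * a) ` carrier ?A"
    then obtain a where a: "a \<in> carrier ?A" "v = diag_unit n i * a" by auto
    then have "v \<in> carrier_mat n n" by (auto simp: tiled_order_carrier diag_unit_def)
    with a i show "v \<in> C" by (auto simp: C_def tiled_order_carrier diag)
  next
    fix v assume v: "v \<in> C"
    have "v = diag_unit n i * v"
      using v by (intro eq_matI) (auto simp: C_def diag dim tiled_orderD simp del: index_mult_mat(1))
    then show "v \<in> (\<lambda>a. diag_unit n i * a) ` carrier ?A" using v by (auto simp: C_def)
  qed
  have [simp]: "carrier (row_proj n d i :: ('k laurent mat, 'k laurent mat) gmod) = C"
    "zero (row_proj n d i :: ('k laurent mat, 'k laurent mat) gmod) = 0\<^sub>m n n"
    "add (row_proj n d i :: ('k laurent mat, 'k laurent mat) gmod) = (+)"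
    "ract (row_proj n d i :: ('k laurent mat, 'k laurent mat) gmod) = (*)"
    "gr (row_proj n d i :: ('k laurent mat, 'k laurent mat) gmod) = (\<lambda>m. C \<inter> deg_part ?A m)"
    using C by (simp_all add: row_proj_def right_ideal_def)
  have mult: "(v * a) $$ (r, c) = (\<Sum>l<n. v $$ (r, l) * a $$ (l, c))"
    if "v \<in> C" "a \<in> carrier ?A" "r < n" "c < n" for v a r c
    using that by (intro tiled_order_mult_index) (auto simp: C_def)
  show ?thesis
  proof (unfold_locales, goal_cases)
    case (2 v x)
    then show ?case using i by (auto simp: C_def tiled_order_carrier)
  next
    case (3 v w)
    show ?case
    proof (rule eq_matI)
      fix r c assume "r < dim_row w" "c < dim_col w"
      then have "r < n" "c < n" using 3 by (auto simp: C_def tiled_order_carrier)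
      then show "v $$ (r, c) = w $$ (r, c)"
        using 3(1,2) 3(3)[of "((), c)"] by (cases "r = i") (auto simp: C_def)
    qed (use 3 in \<open>auto simp: C_def tiled_order_carrier\<close>)
  next
    case (4 F)
    let ?v = "mat n n (\<lambda>(r, c). if r = i then F ((), c) else 0)"
    have "?v \<in> C" using 4 by (fastforce simp: C_def tiled_order_carrier)
    then show ?case using i by (intro bexI[of _ ?v]) auto
  next
    case (7 v w)
    then show ?case by (auto simp: C_def tiled_order_carrier intro!: poly_times_x_add)
  next
    case (8 v w x)
    then show ?case using i by (auto simp: C_def tiled_order_carrier)
  next
    case (9 m)
    have "(\<forall>r<n. \<forall>c<n. v $$ (r, c) \<in> homog m) \<longleftrightarrow> (\<forall>c<n. v $$ (i, c) \<in> homog m)" if "v \<in> C" for v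
      using that i by (auto simp: C_def) (metis poly_times_x_simps(2))
    then show ?case by (auto simp: C_def tiled_order_deg)
  next
    case (12 v a)
    have "v * a \<in> carrier ?A"
      using 12 by (intro tiled_order_mult_closed[OF tiled]) (auto simp: C_def)
    moreover have "(v * a) $$ (r, c) = 0" if "r < n" "c < n" "r \<noteq> i" for r c
      using that 12 by (simp add: mult) (simp add: C_def)
    ultimately show ?case by (simp add: C_def)
  next
    case (13 v a j l)
    then show ?case using i by (simp add: mult)
  qed (use tiled i in \<open>auto simp: C_def tiled_order_carrier\<close>)
qed

lemma row_lattice_row_module:
  assumes tiled: "tiled_exponents n d" and nonneg: "\<And>i j. i < n \<Longrightarrow> j < n \<Longrightarrow> 0 \<le> d i j"
  shows "row_lattice n d (row_module n :: ('k::field laurent mat, 'k laurent mat) gmod) {()}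
           (\<lambda>v (_, l). v $$ (0, l)) (\<lambda>_. 0)"
proof -
  define C where "C = {v \<in> carrier_mat 1 n. \<forall>j<n. v $$ (0, j) \<in> (poly_times_x 0 :: 'k laurent set)}"
  have [simp]: "carrier (row_module n :: ('k laurent mat, 'k laurent mat) gmod) = C"
    "zero (row_module n :: ('k laurent mat, 'k laurent mat) gmod) = 0\<^sub>m 1 n"
    "add (row_module n :: ('k laurent mat, 'k laurent mat) gmod) = (+)"
    "ract (row_module n :: ('k laurent mat, 'k laurent mat) gmod) = (*)"
    "gr (row_module n :: ('k laurent mat, 'k laurent mat) gmod)
       = (\<lambda>m. {v \<in> C. \<forall>j<n. v $$ (0, j) \<in> homog m})"
    by (simp_all add: row_module_def C_def poly_times_x_0)
  have mult: "(v * a) $$ (0, c) = (\<Sum>l<n. v $$ (0, l) * a $$ (l, c))"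
    if "v \<in> C" "a \<in> carrier (tiled_order n d)" "c < n" for v c and a :: "'k laurent mat"
    using that by (intro index_mult_mat_sum[of _ 1]) (auto simp: C_def tiled_order_carrier)
  show ?thesis
  proof (unfold_locales, goal_cases)
    case (3 v w)
    show ?case
    proof (rule eq_matI)
      fix r c assume "r < dim_row w" "c < dim_col w"
      then have "r = 0" "c < n" using 3 by (auto simp: C_def)
      then show "v $$ (r, c) = w $$ (r, c)" using 3(3)[of "((), c)"] by auto
    qed (use 3 in \<open>auto simp: C_def\<close>)
  next
    case (4 F)
    let ?v = "mat 1 n (\<lambda>(r, c). F ((), c))"
    have "?v \<in> C" using 4 by (auto simp: C_def)
    then show ?case by (intro bexI[of _ ?v]) auto
  next
    case (7 v w)
    then show ?case by (auto simp: C_def intro!: poly_times_x_add)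
  next
    case (12 v a)
    have "v $$ (0, l) * a $$ (l, c) \<in> poly_times_x 0" if "l < n" "c < n" for l c
    proof -
      have "v $$ (0, l) * a $$ (l, c) \<in> poly_times_x (0 + d l c)"
        using 12 that by (intro poly_times_x_mult tiled_orderD(3)[of a n d]) (auto simp: C_def)
      then show ?thesis using nonneg[OF that] by (auto intro: poly_times_x_mono)
    qed
    then have "(v * a) $$ (0, c) \<in> poly_times_x 0" if "c < n" for c
      using 12 that by (auto simp: mult intro: poly_times_x_sum)
    moreover have "v * a \<in> carrier_mat 1 n" using 12 by (auto simp: C_def tiled_order_carrier)
    ultimately show ?case by (simp add: C_def)
  next
    case (13 v a j l)
    then show ?case by (simp add: mult)
  qed (use tiled in \<open>auto simp: C_def\<close>)
qed

lemma row_lattice_regular: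
  assumes tiled: "tiled_exponents n d"
  shows "row_lattice n d
           (regular (tiled_order n d) :: ('k::field laurent mat, 'k laurent mat) gmod) {..<n}
           (\<lambda>v (i, l). v $$ (i, l)) (\<lambda>(i, l). d i l)"
proof -
  let ?A = "tiled_order n d :: ('k, 'k laurent mat) graded_algebra"
  have [simp]: "carrier (regular ?A) = carrier ?A" "zero (regular ?A) = 0\<^sub>m n n"
    "add (regular ?A) = (+)" "ract (regular ?A) = (*)"
    "gr (regular ?A) = (\<lambda>m. carrier ?A \<inter> deg_part ?A m)"
    by (simp_all add: regular_def right_ideal_def)
  show ?thesis
  proof (unfold_locales, goal_cases)
    case (3 v w)
    then show ?case by (intro eq_matI) (auto simp: tiled_order_carrier)
  next
    case (4 F)
    have "mat n n F \<in> carrier ?A" using 4 by (fastforce simp: tiled_order_carrier)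
    then show ?case by (intro bexI[of _ "mat n n F"]) auto
  next
    case (7 v w)
    then show ?case by (simp add: tiled_order_add_closed[OF tiled])
  next
    case (12 v a)
    then show ?case by (simp add: tiled_order_mult_closed[OF tiled])
  next
    case (13 v a j l)
    then show ?case by (simp add: tiled_order_mult_index)
  qed (use tiled in \<open>auto simp: tiled_order_carrier tiled_order_deg\<close>)
qed

section \<open>Projective modules and Cohen-Macaulay modules\<close>

lemma row_lattice_free:
  fixes r :: nat
  assumes tiled: "tiled_exponents n d"
  shows "row_lattice n d
           (direct_sum {..<r} (\<lambda>s. shift (regular (tiled_order n d)
              :: ('k::field laurent mat, 'k laurent mat) gmod) (t s)))
           ({..<r} \<times> {..<n})
           (\<lambda>v ((s, i), l). Poly_Mapping.single (- t s) 1 * v s $$ (i, l))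
           (\<lambda>((s, i), l). d i l - t s)"
  using row_lattice_direct_sum[OF finite_lessThan tiled
      row_lattice_shift[OF row_lattice_regular[OF tiled]], of r t]
  by (simp add: case_prod_beta)

lemma monomial_sum:
  "Poly_Mapping.single m (\<Sum>a\<in>A. c a :: 'k::field) = (\<Sum>a\<in>A. Poly_Mapping.single m (c a))"
  by (induction A rule: infinite_finite_induct) (auto simp: single_add)

text \<open>
  Composition of homomorphisms corresponds to the product of their matrices.
\<close>
lemma matrix_compose_expansion:
  fixes a :: "'q \<Rightarrow> 'k::field"
  shows "(\<Sum>q\<in>Q. Poly_Mapping.single 0 (a q) * (\<Sum>s\<in>S. Poly_Mapping.single 0 (b q s) * F s))
       = (\<Sum>s\<in>S. Poly_Mapping.single (0::int) (\<Sum>q\<in>Q. a q * b q s) * F s)"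
proof -
  have "(\<Sum>q\<in>Q. Poly_Mapping.single 0 (a q) * (\<Sum>s\<in>S. Poly_Mapping.single 0 (b q s) * F s))
      = (\<Sum>q\<in>Q. \<Sum>s\<in>S. Poly_Mapping.single 0 (a q * b q s) * F s)"
    by (simp add: sum_distrib_left mult.assoc[symmetric] mult_single)
  also have "\<dots> = (\<Sum>s\<in>S. \<Sum>q\<in>Q. Poly_Mapping.single 0 (a q * b q s) * F s)"
    by (rule sum.swap)
  finally show ?thesis by (simp add: monomial_sum sum_distrib_right)
qed

lemma poly_algebra_sel [simp]:
  "carrier poly_algebra = poly_carrier" "monoid.mult poly_algebra = (*)"
  "one poly_algebra = 1" "zero poly_algebra = 0" "add poly_algebra = (+)"
  "deg_part poly_algebra m = poly_carrier \<inter> homog m"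
  by (simp_all add: poly_algebra_def)

lemma poly_carrier_closed:
  fixes p q :: "'k::field laurent"
  shows "1 \<in> (poly_carrier :: 'k laurent set)" "0 \<in> (poly_carrier :: 'k laurent set)"
    "p \<in> poly_carrier \<Longrightarrow> q \<in> poly_carrier \<Longrightarrow> p * q \<in> poly_carrier"
    "p \<in> poly_carrier \<Longrightarrow> q \<in> poly_carrier \<Longrightarrow> p + q \<in> poly_carrier"
  using poly_times_x_mult[of p 0 q 0] poly_times_x_add[of p 0 q]
  by (auto simp: poly_times_x_0[symmetric] single_one[symmetric] simp del: single_one)

lemma restrict_scalars_sel [simp]:
  "carrier (restrict_scalars h M) = carrier M" "zero (restrict_scalars h M) = zero M"
  "add (restrict_scalars h M) = add M" "gr (restrict_scalars h M) = gr M"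
  "ract (restrict_scalars h M) = (\<lambda>v b. ract M v (h b))"
  by (simp_all add: restrict_scalars_def)

context row_lattice
begin

lemma basis_inj: "inj_on basis (J \<times> {..<n})"
proof (rule inj_onI)
  fix x y assume "x \<in> J \<times> {..<n}" "y \<in> J \<times> {..<n}" "basis x = basis y"
  then have "\<kappa> (basis y) x = Poly_Mapping.single (f x) 1" using coord_basis[of x x] by simp
  then have "(if x = y then Poly_Mapping.single (f y) 1 else 0) = Poly_Mapping.single (f x) (1::'k)"
    using coord_basis[of x y] \<open>x \<in> J \<times> {..<n}\<close> by simp
  then show "x = y" by (metis lookup_single_eq lookup_zero zero_neq_one)
qed

lemma fin_gen: "fin_gen (tiled_order n d) M"
  unfolding fin_gen_def
proof (intro exI[of _ "basis ` (J \<times> {..<n})"] conjI ballI)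
  let ?X = "J \<times> {..<n}"
  fix v assume v: "v \<in> carrier M"
  let ?c = "\<lambda>w. scalar_emb n (coeff_at v (inv_into ?X basis w))"
  have c: "?c \<in> basis ` ?X \<rightarrow> carrier (tiled_order n d)"
    using v basis_inj
    by (auto intro!: scalar_emb_closed[OF tiled] coeff_at_closed simp: inv_into_f_f)
  have "(\<Oplus>\<^bsub>M\<^esub>w\<in>basis ` ?X. ract M w (?c w))
      = (\<Oplus>\<^bsub>M\<^esub>x\<in>?X. ract M (basis x) (?c (basis x)))"
    using c by (intro finsum_reindex basis_inj) (auto intro!: act_closed basis_closed)
  also have "\<dots> = (\<Oplus>\<^bsub>M\<^esub>x\<in>?X. ract M (basis x) (scalar_emb n (coeff_at v x)))"
    using v by (intro finsum_cong') (auto simp: inv_into_f_f[OF basis_inj]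
        intro!: act_closed basis_closed scalar_emb_closed[OF tiled] coeff_at_closed)
  finally have "v = (\<Oplus>\<^bsub>M\<^esub>w\<in>basis ` ?X. ract M w (?c w))" using basis_expansion[OF v] by simp
  with c show "\<exists>c\<in>basis ` ?X \<rightarrow> carrier (tiled_order n d).
      v = (\<Oplus>\<^bsub>M\<^esub>w\<in>basis ` ?X. ract M w (c w))" by (intro bexI[of _ ?c])
qed (auto simp: finite_index basis_closed)

text \<open>
  A row lattice is free over \<open>R\<close>; an enumeration of the coordinates identifies it with a direct sum
  of shifts of \<open>R\<close>, the shifts being given by the exponents.
\<close>
lemma graded_projective_over_polynomials:
  "graded_projective poly_algebra (restrict_scalars (scalar_emb n) M)"
proof -
  let ?N = "restrict_scalars (scalar_emb n) M"
  let ?X = "J \<times> {..<n}"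
  interpret N: coordinates ?N ?X \<kappa> f
    using coordinates_axioms by (auto simp: coordinates_def)
  have act_closed': "ract M v (scalar_emb n p) \<in> carrier M"
    if "v \<in> carrier M" "p \<in> poly_carrier" for v p
    using that by (intro act_closed scalar_emb_closed[OF tiled])
  have act': "\<kappa> (ract M v (scalar_emb n p)) x = \<kappa> v x * p"
    if "v \<in> carrier M" "p \<in> poly_carrier" "x \<in> ?X" for v p x
    using that act_scalar_emb[of v p] by (cases x) auto
  have graded: "graded_module poly_algebra ?N"
  proof (rule N.graded_moduleI)
    let ?\<rho> = "\<lambda>p x y. if x = y then p else (0 :: 'k laurent)"
    fix v and p :: "'k laurent" and x assume vpx: "v \<in> carrier ?N" "p \<in> carrier poly_algebra" "x \<in> ?X"
    have "(\<Sum>y\<in>?X. \<kappa> v y * ?\<rho> p y x) = (\<Sum>y\<in>?X. if y = x then \<kappa> v x * p else 0)"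
      by (intro sum.cong) auto
    then show "\<kappa> (ract ?N v p) x = (\<Sum>y\<in>?X. \<kappa> v y * ?\<rho> p y x)"
      using vpx finite_index by (simp add: act')
  next
    let ?\<rho> = "\<lambda>p x y. if x = y then p else (0 :: 'k laurent)"
    fix p q :: "'k laurent" and x y assume *: "x \<in> ?X" "y \<in> ?X"
    have "(\<Sum>z\<in>?X. ?\<rho> p y z * ?\<rho> q z x) = (\<Sum>z\<in>?X. if z = y then p * ?\<rho> q y x else 0)"
      by (intro sum.cong) auto
    then show "?\<rho> (p \<otimes>\<^bsub>poly_algebra\<^esub> q) y x = (\<Sum>z\<in>?X. ?\<rho> p y z * ?\<rho> q z x)"
      using * finite_index by simp
  qed (auto simp: poly_carrier_closed act_closed')
  obtain e where e: "bij_betw e {..<card ?X} ?X"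
    using ex_bij_betw_nat_finite[OF finite_index] by (auto simp: atLeast0LessThan)
  define e' where "e' = inv_into {..<card ?X} e"
  have e_in: "e s \<in> ?X" if "s < card ?X" for s using e that by (auto simp: bij_betw_def)
  have e'_in: "e' x < card ?X" and e_e': "e (e' x) = x" if "x \<in> ?X" for x
    using e that by (auto simp: e'_def bij_betw_def intro: f_inv_into_f inv_into_into
        [where A = "{..<card ?X}" and f = e, simplified])
  define F :: "('k laurent, nat \<Rightarrow> 'k laurent) gmod"
    where "F = direct_sum {..<card ?X} (\<lambda>s. shift (regular poly_algebra) (- f (e s)))"
  have F: "carrier F = (\<Pi>\<^sub>E s\<in>{..<card ?X}. (poly_carrier :: 'k laurent set))"
    "add F = (\<lambda>v w. \<lambda>s\<in>{..<card ?X}. v s + w s)"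
    "ract F = (\<lambda>v a. \<lambda>s\<in>{..<card ?X}. v s * a)"
    "gr F = (\<lambda>m. \<Pi>\<^sub>E s\<in>{..<card ?X}. poly_carrier \<inter> homog (m - f (e s)))"
    by (simp_all add: F_def direct_sum_def shift_def regular_def right_ideal_def)
  let ?i = "\<lambda>v\<in>carrier M. \<lambda>s\<in>{..<card ?X}. coeff_at v (e s)"
  define P :: "(nat \<Rightarrow> 'k laurent) \<Rightarrow> 'j \<times> nat \<Rightarrow> 'k laurent"
    where "P w x = Poly_Mapping.single (f x) 1 * w (e' x)" for w x
  let ?p = "\<lambda>w\<in>carrier F. vec (P w)"
  have P: "P w x \<in> poly_times_x (f x)" if "w \<in> carrier F" "x \<in> ?X" for w x
    using that e'_in[of x]
    by (auto simp: P_def F PiE_iff poly_times_x_0 intro!: monomial_mult_poly_times_x[of _ 0])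
  have vec: "vec (P w) \<in> carrier M" "x \<in> ?X \<Longrightarrow> \<kappa> (vec (P w)) x = P w x"
    if "w \<in> carrier F" for w x
    using vec_closed[of "P w"] coord_vec[of "P w"] P[OF that] by auto
  have i: "?i \<in> graded_hom poly_algebra ?N F"
    unfolding graded_hom_def module_hom_def
  proof (intro CollectI conjI ballI allI subsetI)
    fix m w assume "w \<in> ?i ` gr ?N m"
    then obtain v where v: "v \<in> carrier M" "\<And>x. x \<in> ?X \<Longrightarrow> \<kappa> v x \<in> homog m" "w = ?i v"
      by (auto simp: gr_eq)
    have "coeff_at v (e s) \<in> homog (m - f (e s))" if "s < card ?X" for s
      using v(2)[OF e_in[OF that]] unfolding coeff_at_def by (rule monomial_mult_homog) simp
    then show "w \<in> gr F m" using v e_in by (auto simp: F coeff_at_closed)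
  qed (auto simp: F coeff_at_closed e_in coeff_at_def coord_add act' distrib_left mult.assoc
        add_closed act_closed' coeff_at_closed[unfolded coeff_at_def])
  have F_add: "v \<oplus>\<^bsub>F\<^esub> w \<in> carrier F" if "v \<in> carrier F" "w \<in> carrier F" for v w
    using that by (auto simp: F PiE_iff poly_carrier_closed)
  have F_act: "ract F v a \<in> carrier F" if "v \<in> carrier F" "a \<in> poly_carrier" for v a
    using that by (auto simp: F PiE_iff poly_carrier_closed)
  have p: "?p \<in> graded_hom poly_algebra F ?N"
    unfolding graded_hom_def module_hom_def
  proof (intro CollectI conjI ballI allI subsetI)
    show "?p \<in> carrier F \<rightarrow>\<^sub>E carrier ?N" using vec by auto
  next
    fix v w assume vw: "v \<in> carrier F" "w \<in> carrier F"
    have "vec (P (v \<oplus>\<^bsub>F\<^esub> w)) = vec (P v) \<oplus>\<^bsub>M\<^esub> vec (P w)"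
      using vw F_add[OF vw]
      by (intro coord_inj) (auto simp: vec add_closed coord_add, auto simp: P_def F e'_in distrib_left)
    then show "?p (v \<oplus>\<^bsub>F\<^esub> w) = ?p v \<oplus>\<^bsub>?N\<^esub> ?p w" using vw F_add[OF vw] by simp
  next
    fix v and a :: "'k laurent" assume va: "v \<in> carrier F" "a \<in> carrier poly_algebra"
    then have a: "a \<in> poly_carrier" by simp
    have "vec (P (ract F v a)) = ract M (vec (P v)) (scalar_emb n a)"
      using va F_act[OF va(1) a]
      by (intro coord_inj) (auto simp: vec act_closed' act', auto simp: P_def F e'_in mult.assoc)
    then show "?p (ract F v a) = ract ?N (?p v) a" using va F_act[OF va(1) a] by simp
  next
    fix m w assume "w \<in> ?p ` gr F m"
    then obtain v where v: "v \<in> gr F m" "w = ?p v" by blast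
    then have vF: "v \<in> carrier F" by (auto simp: F PiE_iff)
    have "P v x \<in> homog m" if "x \<in> ?X" for x
    proof -
      have "v (e' x) \<in> homog (m - f x)" 
        using v(1) e'_in[OF that] by (subst (2) e_e'[OF that, symmetric]) (auto simp: F PiE_iff)
      then show ?thesis unfolding P_def by (rule monomial_mult_homog) simp
    qed
    then show "w \<in> gr ?N m" using v vF vec[OF vF] by (auto simp: gr_eq)
  qed
  have "?p (?i v) = v" if v: "v \<in> carrier M" for v
  proof -
    have iv: "?i v \<in> carrier F" using v by (auto simp: F coeff_at_closed e_in)
    have "P (?i v) x = \<kappa> v x" if "x \<in> ?X" for x
      using that v e'_in[OF that] e_e'[OF that]
      by (simp add: P_def coeff_at_def monomial_mult_cancel)
    then show ?thesis using v iv vec[OF iv] by (auto intro!: coord_inj)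
  qed
  then have "\<exists>i\<in>graded_hom poly_algebra ?N F. \<exists>p\<in>graded_hom poly_algebra F ?N.
      \<forall>v\<in>carrier ?N. p (i v) = v"
    by (intro bexI[OF _ i] bexI[OF _ p]) simp
  with graded show ?thesis
    unfolding graded_projective_def Let_def F_def by (intro conjI exI)
qed

lemma graded_CM: "graded_CM n d M"
  unfolding graded_CM_def Let_def
  using graded_module fin_gen graded_projective_over_polynomials by blast

text \<open>
  A row whose exponents are those of \<open>e_b A\<close> up to a constant is isomorphic to a shift of \<open>e_b A\<close>
  and is thus a direct summand of a shift of the order.
\<close>
lemma graded_projectiveI:
  assumes rows: "\<And>j. j \<in> J \<Longrightarrow> \<exists>b<n. \<exists>c. \<forall>l<n. f (j, l) = d b l - c"
  shows "graded_projective (tiled_order n d) M"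
proof -
  obtain b c where bc: "\<And>j. j \<in> J \<Longrightarrow> b j < n"
    "\<And>j l. j \<in> J \<Longrightarrow> l < n \<Longrightarrow> f (j, l) = d (b j) l - c j"
    using rows by metis
  obtain e where e: "bij_betw e {..<card J} J"
    using ex_bij_betw_nat_finite[OF finite_rows] by (auto simp: atLeast0LessThan)
  have e_in: "e s \<in> J" if "s < card J" for s using e that by (auto simp: bij_betw_def)
  define F :: "('k laurent mat, nat \<Rightarrow> 'k laurent mat) gmod"
    where "F = direct_sum {..<card J} (\<lambda>s. shift (regular (tiled_order n d)) (c (e s)))"
  let ?K = "{..<card J} \<times> {..<n}"
  let ?\<kappa>' = "\<lambda>v ((s, i), l). Poly_Mapping.single (- c (e s)) 1 * v s $$ (i, l)"
  let ?f' = "\<lambda>((s, i), l). d i l - c (e s)"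
  interpret F: row_lattice n d F ?K ?\<kappa>' ?f'
    unfolding F_def by (rule row_lattice_free[OF tiled])
  interpret MF: row_lattice_pair n d M J \<kappa> f F ?K ?\<kappa>' ?f' by unfold_locales
  interpret FM: row_lattice_pair n d F ?K ?\<kappa>' ?f' M J \<kappa> f by unfold_locales
  \<comment> \<open>The inclusion of row j as row b j of the summand with number k, where e k = j. Its transpose is
    the projection.\<close>
  define inc :: "nat \<times> nat \<Rightarrow> 'j \<Rightarrow> 'k" where "inc q j = (if q \<in> ?K \<and> e (fst q) = j \<and> snd q = b j then 1 else 0)"
    for q j
  have inc_le: "?f' (q, l) = f (j, l)" if "inc q j \<noteq> 0" "j \<in> J" "l < n" for q j l
    using that bc by (auto simp: inc_def case_prod_beta split: if_splits)
  have inc_hom: "MF.hom_of inc \<in> MF.Hom"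
    using inc_le by (intro MF.hom_of_hom) auto
  have proj_hom: "FM.hom_of (\<lambda>j q. inc q j) \<in> FM.Hom"
    using inc_le by (intro FM.hom_of_hom) auto
  have orth: "(\<Sum>q\<in>?K. inc q t * inc q s) = (if s = t then 1 else 0)" if t: "t \<in> J" for s t
  proof -
    have "t \<in> e ` {..<card J}" using e t by (simp add: bij_betw_def)
    then obtain k where k: "k < card J" "e k = t" by auto
    have "inc q t * inc q s = (if q = (k, b t) then if s = t then 1 else 0 else 0)" if "q \<in> ?K" for q
    proof -
      obtain k' i where q: "q = (k', i)" by (cases q)
      have "e k' = t \<longleftrightarrow> k' = k"
        using e k that q by (auto simp: bij_betw_def inj_on_def)
      then show ?thesis using that k by (auto simp: inc_def q)
    qed
    then have "(\<Sum>q\<in>?K. inc q t * inc q s)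
        = (\<Sum>q\<in>?K. if q = (k, b t) then if s = t then 1 else 0 else 0)" by (rule sum.cong[OF refl])
    then show ?thesis using k bc(1)[OF t] by simp
  qed
  have "FM.hom_of (\<lambda>j q. inc q j) (MF.hom_of inc v) = v" if v: "v \<in> carrier M" for v
  proof (rule row_eqI[OF _ v])
    have iv: "MF.hom_of inc v \<in> carrier F" by (rule module_homD(2)[OF graded_homD(1)[OF inc_hom] v])
    show "FM.hom_of (\<lambda>j q. inc q j) (MF.hom_of inc v) \<in> carrier M"
      by (rule module_homD(2)[OF graded_homD(1)[OF proj_hom] iv])
    fix t l assume t: "t \<in> J" and l: "l < n"
    have "\<kappa> (FM.hom_of (\<lambda>j q. inc q j) (MF.hom_of inc v)) (t, l)
        = (\<Sum>q\<in>?K. Poly_Mapping.single 0 (inc q t) * ?\<kappa>' (MF.hom_of inc v) (q, l))"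
      using t l iv inc_le by (intro FM.coord_hom_of) force+
    also have "\<dots> = (\<Sum>q\<in>?K. Poly_Mapping.single 0 (inc q t)
        * (\<Sum>s\<in>J. Poly_Mapping.single 0 (inc q s) * \<kappa> v (s, l)))"
      using l v inc_le by (intro sum.cong refl arg_cong[where f = "(*) _"] MF.coord_hom_of) auto
    also have "\<dots> = (\<Sum>s\<in>J. Poly_Mapping.single 0 (\<Sum>q\<in>?K. inc q t * inc q s) * \<kappa> v (s, l))"
      by (rule matrix_compose_expansion)
    also have "\<dots> = (\<Sum>s\<in>J. if s = t then \<kappa> v (s, l) else 0)"
      using orth[OF t] by (intro sum.cong refl) auto
    finally show "\<kappa> (FM.hom_of (\<lambda>j q. inc q j) (MF.hom_of inc v)) (t, l) = \<kappa> v (t, l)"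
      using t finite_rows by simp
  qed
  then have "\<exists>i\<in>MF.Hom. \<exists>p\<in>FM.Hom. \<forall>v\<in>carrier M. p (i v) = v"
    by (intro bexI[OF _ inc_hom] bexI[OF _ proj_hom]) simp
  with graded_module show ?thesis
    unfolding graded_projective_def Let_def F_def by (intro conjI exI)
qed

end

section \<open>Maps factoring through projectives\<close>

context row_lattice
begin

text \<open>
  A larger row has smaller exponents. The statement \<open>projective_between s s\<close> says that row \<open>s\<close> is
  itself a shift of a row of the order, i.e. that it is projective.
\<close>
definition projective_between :: "'j \<Rightarrow> 'j \<Rightarrow> bool" where
  "projective_between s t \<longleftrightarrow>
     (\<exists>b<n. \<exists>c. \<forall>l<n. f (t, l) \<le> d b l - c \<and> d b l - c \<le> f (s, l))"

sublocale self: row_lattice_pair n d M J \<kappa> f M J \<kappa> f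
  by unfold_locales

text \<open>
  A map through a projective factors through a free module, which is a row lattice whose rows are
  shifts of rows of the order. The coefficient is then a sum of products over these rows, and a
  nonzero product provides a row that lies between \<open>s\<close> and \<open>t\<close>.
\<close>
lemma proj_ideal_coeff:
  assumes \<phi>: "\<phi> \<in> proj_ideal n d M" and s: "s \<in> J" and t: "t \<in> J"
    and nz: "self.coeff \<phi> t s \<noteq> 0"
  shows "projective_between s t"
proof -
  let ?A = "tiled_order n d :: ('k, 'k laurent mat) graded_algebra"
  obtain Q :: "('k laurent mat, nat \<Rightarrow> 'k laurent mat) gmod" and g h
    where Q: "graded_projective ?A Q" and g: "g \<in> graded_hom ?A M Q" and h: "h \<in> graded_hom ?A Q M"
      and \<phi>_eq: "\<phi> = compose (carrier M) h g"
    using \<phi> unfolding proj_ideal_def Let_def by blast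
  obtain r :: nat and c i p where
    i: "i \<in> graded_hom ?A Q (direct_sum {..<r} (\<lambda>s. shift (regular ?A) (c s)))" and
    p: "p \<in> graded_hom ?A (direct_sum {..<r} (\<lambda>s. shift (regular ?A) (c s))) Q" and
    pi: "\<forall>v\<in>carrier Q. p (i v) = v"
    using Q unfolding graded_projective_def Let_def by blast
  define F where "F = direct_sum {..<r} (\<lambda>s. shift (regular ?A) (c s))"
  let ?K = "{..<r} \<times> {..<n}"
  let ?\<kappa>' = "\<lambda>v ((s, i), l). Poly_Mapping.single (- c s) 1 * v s $$ (i, l)"
  let ?f' = "\<lambda>((s, i), l). d i l - c s"
  interpret F: row_lattice n d F ?K ?\<kappa>' ?f'
    unfolding F_def by (rule row_lattice_free[OF tiled])
  interpret MF: row_lattice_pair n d M J \<kappa> f F ?K ?\<kappa>' ?f' by unfold_locales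
  interpret FM: row_lattice_pair n d F ?K ?\<kappa>' ?f' M J \<kappa> f by unfold_locales
  define g' where "g' = compose (carrier M) i g"
  define h' where "h' = compose (carrier F) h p"
  have g': "g' \<in> MF.Hom" unfolding g'_def
    using g i by (intro compose_graded_hom[where N = Q])
      (auto simp: F_def add_closed act_closed gr_eq)
  have h': "h' \<in> FM.Hom" unfolding h'_def
    using h p F.add_closed F.act_closed F.gr_subset
    by (intro compose_graded_hom[where N = Q]) (auto simp: F_def)
  have \<phi>v: "\<phi> v = h' (g' v)" if v: "v \<in> carrier M" for v
    using v module_homD(2)[OF graded_homD(1)[OF g] v] pi module_homD(2)[OF graded_homD(1)[OF g'] v]
    by (simp add: \<phi>_eq h'_def g'_def compose_eq)
  have "self.coeff \<phi> t s = (\<Sum>q\<in>?K. FM.coeff h' t q * MF.coeff g' q s)"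
  proof (rule self.coeff_eqI[OF _ s])
    fix v assume v: "v \<in> carrier M"
    have "\<kappa> (\<phi> v) (t, 0) = (\<Sum>q\<in>?K. Poly_Mapping.single 0 (FM.coeff h' t q) * ?\<kappa>' (g' v) (q, 0))"
      using \<phi>v[OF v] FM.coord_hom[OF h' module_homD(2)[OF graded_homD(1)[OF g'] v] t n_pos] by simp
    also have "\<dots> = (\<Sum>q\<in>?K. Poly_Mapping.single 0 (FM.coeff h' t q)
        * (\<Sum>s\<in>J. Poly_Mapping.single 0 (MF.coeff g' q s) * \<kappa> v (s, 0)))"
      by (intro sum.cong refl arg_cong[where f = "(*) _"] MF.coord_hom[OF g' v _ n_pos]) auto
    also have "\<dots> = (\<Sum>s\<in>J. Poly_Mapping.single 0 (\<Sum>q\<in>?K. FM.coeff h' t q * MF.coeff g' q s)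
        * \<kappa> v (s, 0))"
      by (rule matrix_compose_expansion)
    finally show "\<kappa> (\<phi> v) (t, 0) = (\<Sum>s\<in>J. Poly_Mapping.single 0
        (\<Sum>q\<in>?K. FM.coeff h' t q * MF.coeff g' q s) * \<kappa> v (s, 0))" .
  qed
  then obtain q where q: "q \<in> ?K" "FM.coeff h' t q * MF.coeff g' q s \<noteq> 0"
    using nz by (auto elim: sum.not_neutral_contains_not_neutral)
  obtain a b where ab: "q = (a, b)" "b < n" using q(1) by auto
  have "f (t, l) \<le> ?f' (q, l)" "?f' (q, l) \<le> f (s, l)" if "l < n" for l
    using FM.coeff_nonzero_le[OF h' q(1) t that] MF.coeff_nonzero_le[OF g' s q(1) that] q(2) by auto
  then show ?thesis
    unfolding projective_between_def using ab by auto
qed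

text \<open>
  For every pair \<open>(t, s)\<close> with a nonzero coefficient there is a shifted row of the order through
  which this component of \<open>\<phi>\<close> factors. The whole map factors through the free module with one
  summand for each pair.
\<close>
lemma proj_idealI:
  assumes \<phi>: "\<phi> \<in> self.Hom"
    and between: "\<And>s t. s \<in> J \<Longrightarrow> t \<in> J \<Longrightarrow> self.coeff \<phi> t s \<noteq> 0 \<Longrightarrow> projective_between s t"
  shows "\<phi> \<in> proj_ideal n d M"
proof -
  let ?A = "tiled_order n d :: ('k, 'k laurent mat) graded_algebra"
  have "\<forall>t s. \<exists>b c. s \<in> J \<and> t \<in> J \<and> self.coeff \<phi> t s \<noteq> 0 \<longrightarrow>
      b < n \<and> (\<forall>l<n. f (t, l) \<le> d b l - c \<and> d b l - c \<le> f (s, l))"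
    using between unfolding projective_between_def by blast
  then obtain b c where bc: "\<And>s t. s \<in> J \<and> t \<in> J \<and> self.coeff \<phi> t s \<noteq> 0 \<longrightarrow>
      b t s < n \<and> (\<forall>l<n. f (t, l) \<le> d (b t s) l - c t s \<and> d (b t s) l - c t s \<le> f (s, l))"
    by metis
  obtain e where e: "bij_betw e {..<card (J \<times> J)} (J \<times> J)"
    using ex_bij_betw_nat_finite[of "J \<times> J"] finite_rows by (auto simp: atLeast0LessThan)
  define F :: "('k laurent mat, nat \<Rightarrow> 'k laurent mat) gmod" where
    "F = direct_sum {..<card (J \<times> J)} (\<lambda>k. shift (regular ?A) (case e k of (t, s) \<Rightarrow> c t s))"
  let ?K = "{..<card (J \<times> J)} \<times> {..<n}"
  let ?\<kappa>' = "\<lambda>v ((k, i), l). Poly_Mapping.single (- (case e k of (t, s) \<Rightarrow> c t s)) 1 * v k $$ (i, l)"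
  let ?f' = "\<lambda>((k, i), l). d i l - (case e k of (t, s) \<Rightarrow> c t s)"
  interpret F: row_lattice n d F ?K ?\<kappa>' ?f'
    unfolding F_def by (rule row_lattice_free[OF tiled])
  interpret MF: row_lattice_pair n d M J \<kappa> f F ?K ?\<kappa>' ?f' by unfold_locales
  interpret FM: row_lattice_pair n d F ?K ?\<kappa>' ?f' M J \<kappa> f by unfold_locales
  \<comment> \<open>The row i of the summand with number k is used if the pair e k = (t, s) has a nonzero
    coefficient and i is the row chosen for this pair.\<close>
  define hit where "hit q = (case e (fst q) of (t, s) \<Rightarrow> self.coeff \<phi> t s \<noteq> 0 \<and> snd q = b t s)"
    for q :: "nat \<times> nat"
  define x where "x q s = (if hit q \<and> snd (e (fst q)) = s then self.coeff \<phi> (fst (e (fst q))) s else 0)"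
    for q :: "nat \<times> nat" and s
  define y where "y t q = (if hit q \<and> fst (e (fst q)) = t then 1 else 0 :: 'k)"
    for q :: "nat \<times> nat" and t
  have e_in: "e k \<in> J \<times> J" if "k < card (J \<times> J)" for k using e that by (auto simp: bij_betw_def)
  have between': "f (t, l) \<le> ?f' (q, l) \<and> ?f' (q, l) \<le> f (s, l)"
    if "hit q" "q \<in> ?K" "e (fst q) = (t, s)" "l < n" for q s t l
    using bc[of s t] e_in[of "fst q"] that by (auto simp: hit_def case_prod_beta)
  have x_le: "?f' (q, l) \<le> f (s, l)" if "s \<in> J" "q \<in> ?K" "l < n" "x q s \<noteq> 0" for q s l
    using between'[of q "fst (e (fst q))" s l] that by (auto simp: x_def split: if_splits)
  have y_le: "f (t, l) \<le> ?f' (q, l)" if "q \<in> ?K" "t \<in> J" "l < n" "y t q \<noteq> 0" for q t l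
    using between'[of q t "snd (e (fst q))" l] that by (auto simp: y_def split: if_splits)
  have x: "MF.hom_of x \<in> MF.Hom" by (rule MF.hom_of_hom) (use x_le in blast)
  have y: "FM.hom_of y \<in> FM.Hom" by (rule FM.hom_of_hom) (use y_le in blast)
  have yx: "(\<Sum>q\<in>?K. y t q * x q s) = self.coeff \<phi> t s" if ts: "t \<in> J" "s \<in> J" for t s
  proof (cases "self.coeff \<phi> t s = 0")
    case True
    then have "y t q * x q s = 0" for q by (auto simp: y_def x_def)
    then show ?thesis by (simp only: True sum.neutral_const)
  next
    case False
    have "(t, s) \<in> e ` {..<card (J \<times> J)}" using e ts by (simp add: bij_betw_def)
    then obtain k where k: "k < card (J \<times> J)" "e k = (t, s)" by auto
    have "y t q * x q s = (if q = (k, b t s) then self.coeff \<phi> t s else 0)" if "q \<in> ?K" for q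
    proof -
      obtain k' i where q: "q = (k', i)" by (cases q)
      have "e k' = (t, s) \<longleftrightarrow> k' = k" using e k that q by (auto simp: bij_betw_def inj_on_def)
      then show ?thesis using False k by (auto simp: y_def x_def hit_def q split: prod.splits)
    qed
    then have "(\<Sum>q\<in>?K. y t q * x q s) = (\<Sum>q\<in>?K. if q = (k, b t s) then self.coeff \<phi> t s else 0)"
      by (rule sum.cong[OF refl])
    then show ?thesis using k bc[of s t] ts False by simp
  qed
  have "\<phi> = compose (carrier M) (FM.hom_of y) (MF.hom_of x)"
  proof (rule PiE_ext[OF module_homD(1)[OF graded_homD(1)[OF \<phi>]]])
    show comp: "compose (carrier M) (FM.hom_of y) (MF.hom_of x) \<in> carrier M \<rightarrow>\<^sub>E carrier M"
      using module_homD(2)[OF graded_homD(1)[OF x]] module_homD(2)[OF graded_homD(1)[OF y]]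
      by (auto simp: compose_def)
    fix v assume v: "v \<in> carrier M"
    have xv: "MF.hom_of x v \<in> carrier F" by (rule module_homD(2)[OF graded_homD(1)[OF x] v])
    have "\<phi> v = FM.hom_of y (MF.hom_of x v)"
    proof (rule row_eqI)
      show "\<phi> v \<in> carrier M" by (rule module_homD(2)[OF graded_homD(1)[OF \<phi>] v])
      show "FM.hom_of y (MF.hom_of x v) \<in> carrier M"
        by (rule module_homD(2)[OF graded_homD(1)[OF y] xv])
      fix t l assume t: "t \<in> J" and l: "l < n"
      have cx: "MF.coeff (MF.hom_of x) q s = x q s" if "q \<in> ?K" "s \<in> J" for q s
        by (rule MF.coeff_hom_of[OF _ that(2,1)]) (use x_le in blast)
      have cy: "FM.coeff (FM.hom_of y) t q = y t q" if "q \<in> ?K" for q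
        by (rule FM.coeff_hom_of[OF _ that t]) (use y_le in blast)
      have "\<kappa> (FM.hom_of y (MF.hom_of x v)) (t, l)
          = (\<Sum>q\<in>?K. Poly_Mapping.single 0 (y t q) * ?\<kappa>' (MF.hom_of x v) (q, l))"
        using FM.coord_hom[OF y xv t l] cy by simp
      also have "\<dots> = (\<Sum>q\<in>?K. Poly_Mapping.single 0 (y t q)
          * (\<Sum>s\<in>J. Poly_Mapping.single 0 (x q s) * \<kappa> v (s, l)))"
      proof (intro sum.cong refl arg_cong[where f = "(*) _"])
        fix q assume q: "q \<in> ?K"
        show "?\<kappa>' (MF.hom_of x v) (q, l) = (\<Sum>s\<in>J. Poly_Mapping.single 0 (x q s) * \<kappa> v (s, l))"
          using MF.coord_hom[OF x v q l] cx[OF q] by simp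
      qed
      also have "\<dots> = (\<Sum>s\<in>J. Poly_Mapping.single 0 (\<Sum>q\<in>?K. y t q * x q s) * \<kappa> v (s, l))"
        by (rule matrix_compose_expansion)
      also have "\<dots> = \<kappa> (\<phi> v) (t, l)"
        using self.coord_hom[OF \<phi> v t l] yx[OF t] by simp
      finally show "\<kappa> (\<phi> v) (t, l) = \<kappa> (FM.hom_of y (MF.hom_of x v)) (t, l)" by simp
    qed
    then show "\<phi> v = compose (carrier M) (FM.hom_of y) (MF.hom_of x) v"
      using v by (simp add: compose_eq)
  qed
  moreover have "graded_projective ?A F"
    by (rule F.graded_projectiveI) auto
  ultimately show ?thesis
    unfolding proj_ideal_def Let_def using \<phi> F.graded_CM x y by blast
qed

lemma coeff_compose:
  assumes \<phi>: "\<phi> \<in> self.Hom" and \<psi>: "\<psi> \<in> self.Hom" and s: "s \<in> J" and t: "t \<in> J"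
  shows "self.coeff (compose (carrier M) \<psi> \<phi>) t s = (\<Sum>q\<in>J. self.coeff \<psi> t q * self.coeff \<phi> q s)"
proof (rule self.coeff_eqI[OF _ s])
  fix v assume v: "v \<in> carrier M"
  have "\<kappa> (compose (carrier M) \<psi> \<phi> v) (t, 0)
      = (\<Sum>q\<in>J. Poly_Mapping.single 0 (self.coeff \<psi> t q)
          * (\<Sum>s\<in>J. Poly_Mapping.single 0 (self.coeff \<phi> q s) * \<kappa> v (s, 0)))"
    using self.coord_hom[OF \<psi> module_homD(2)[OF graded_homD(1)[OF \<phi>] v] t n_pos] v
      self.coord_hom[OF \<phi> v _ n_pos] by (simp add: compose_eq)
  then show "\<kappa> (compose (carrier M) \<psi> \<phi> v) (t, 0) = (\<Sum>s\<in>J. Poly_Mapping.single 0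
      (\<Sum>q\<in>J. self.coeff \<psi> t q * self.coeff \<phi> q s) * \<kappa> v (s, 0))"
    by (simp add: matrix_compose_expansion)
qed

section \<open>The endomorphism algebra\<close>

abbreviation "End \<equiv> graded_End (tiled_order n d :: ('k, 'k laurent mat) graded_algebra) M"

lemma End_sel [simp]:
  "carrier End = self.Hom" "monoid.mult End = (\<lambda>f g. compose (carrier M) f g)"
  "one End = (\<lambda>v\<in>carrier M. v)" "zero End = (\<lambda>v\<in>carrier M. \<zero>\<^bsub>M\<^esub>)"
  "add End = (\<lambda>f g. \<lambda>v\<in>carrier M. f v \<oplus>\<^bsub>M\<^esub> g v)"
  by (simp_all add: graded_End_def)

lemma End_eqI:
  assumes "\<phi> \<in> self.Hom" "\<psi> \<in> self.Hom" "\<And>v. v \<in> carrier M \<Longrightarrow> \<phi> v = \<psi> v"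
  shows "\<phi> = \<psi>"
  using module_homD(1)[OF graded_homD(1)[OF assms(1)]] module_homD(1)[OF graded_homD(1)[OF assms(2)]]
    assms(3) by (rule PiE_ext)

lemma End_closed: "\<phi> \<in> self.Hom \<Longrightarrow> v \<in> carrier M \<Longrightarrow> \<phi> v \<in> carrier M"
  by (rule module_homD(2)[OF graded_homD(1)])

text \<open>
  This turns closure properties of the endomorphism algebra into computations with coordinates and
  gives the coefficients of the result at the same time.
\<close>
lemma graded_hom_of_coords:
  assumes closed: "\<And>v. v \<in> carrier M \<Longrightarrow> \<phi> v \<in> carrier M"
    and coords: "\<And>v t l. v \<in> carrier M \<Longrightarrow> t \<in> J \<Longrightarrow> l < n \<Longrightarrow>
          \<kappa> (\<phi> v) (t, l) = (\<Sum>s\<in>J. Poly_Mapping.single 0 (c t s) * \<kappa> v (s, l))"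
    and c: "\<And>s t l. s \<in> J \<Longrightarrow> t \<in> J \<Longrightarrow> l < n \<Longrightarrow> c t s \<noteq> 0 \<Longrightarrow> f (t, l) \<le> f (s, l)"
  shows "restrict \<phi> (carrier M) \<in> self.Hom"
    and "s \<in> J \<Longrightarrow> t \<in> J \<Longrightarrow> self.coeff (restrict \<phi> (carrier M)) t s = c t s"
proof -
  have "restrict \<phi> (carrier M) = self.hom_of c"
  proof (rule ext)
    fix v
    show "restrict \<phi> (carrier M) v = self.hom_of c v"
    proof (cases "v \<in> carrier M")
      case True
      then show ?thesis using closed self.hom_of_closed[of c v] c
        by (auto intro!: row_eqI simp: coords self.coord_hom_of)
    qed (simp add: self.hom_of_def)
  qed
  then show "restrict \<phi> (carrier M) \<in> self.Hom"
    "s \<in> J \<Longrightarrow> t \<in> J \<Longrightarrow> self.coeff (restrict \<phi> (carrier M)) t s = c t s"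
    using self.hom_of_hom[of c] self.coeff_hom_of[of c] c by auto
qed

lemma
  assumes \<phi>: "\<phi> \<in> self.Hom" and \<psi>: "\<psi> \<in> self.Hom"
  shows End_add_closed: "(\<lambda>v\<in>carrier M. \<phi> v \<oplus>\<^bsub>M\<^esub> \<psi> v) \<in> self.Hom"
    and coeff_add: "s \<in> J \<Longrightarrow> t \<in> J \<Longrightarrow>
          self.coeff (\<lambda>v\<in>carrier M. \<phi> v \<oplus>\<^bsub>M\<^esub> \<psi> v) t s = self.coeff \<phi> t s + self.coeff \<psi> t s"
proof -
  have "\<kappa> (\<phi> v \<oplus>\<^bsub>M\<^esub> \<psi> v) (t, l)
      = (\<Sum>s\<in>J. Poly_Mapping.single 0 (self.coeff \<phi> t s + self.coeff \<psi> t s) * \<kappa> v (s, l))"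
    if "v \<in> carrier M" "t \<in> J" "l < n" for v t l
    using that \<phi> \<psi>
    by (simp add: coord_add End_closed self.coord_hom single_add distrib_right sum.distrib)
  note * = graded_hom_of_coords[where c = "\<lambda>t s. self.coeff \<phi> t s + self.coeff \<psi> t s"
      and \<phi> = "\<lambda>v. \<phi> v \<oplus>\<^bsub>M\<^esub> \<psi> v", OF _ this]
  have le: "f (t, l) \<le> f (s, l)"
    if "s \<in> J" "t \<in> J" "l < n" "self.coeff \<phi> t s + self.coeff \<psi> t s \<noteq> 0" for s t l
  proof -
    have "self.coeff \<phi> t s \<noteq> 0 \<or> self.coeff \<psi> t s \<noteq> 0" using that(4) by auto
    then show ?thesis using self.coeff_nonzero_le \<phi> \<psi> that(1-3) by blast
  qed
  show "(\<lambda>v\<in>carrier M. \<phi> v \<oplus>\<^bsub>M\<^esub> \<psi> v) \<in> self.Hom"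
    using \<phi> \<psi> le by (intro *(1)) (auto intro: add_closed End_closed)
  show "s \<in> J \<Longrightarrow> t \<in> J \<Longrightarrow>
          self.coeff (\<lambda>v\<in>carrier M. \<phi> v \<oplus>\<^bsub>M\<^esub> \<psi> v) t s = self.coeff \<phi> t s + self.coeff \<psi> t s"
    using \<phi> \<psi> le by (intro *(2)) (auto intro: add_closed End_closed)
qed

lemma
  assumes \<phi>: "\<phi> \<in> self.Hom"
  shows End_smult_closed: "x \<odot>\<^bsub>End\<^esub> \<phi> \<in> self.Hom"
    and coeff_smult: "s \<in> J \<Longrightarrow> t \<in> J \<Longrightarrow> self.coeff (x \<odot>\<^bsub>End\<^esub> \<phi>) t s = x * self.coeff \<phi> t s"
proof -
  have eq: "x \<odot>\<^bsub>End\<^esub> \<phi>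
      = (\<lambda>v\<in>carrier M. ract M (\<phi> v) (scalar_emb n (Poly_Mapping.single 0 x)))"
    by (simp add: graded_End_def scalar_emb_def)
  have p: "Poly_Mapping.single 0 x \<in> poly_carrier" by (simp add: poly_times_x_0[symmetric])
  have "\<kappa> (ract M (\<phi> v) (scalar_emb n (Poly_Mapping.single 0 x))) (t, l)
      = (\<Sum>s\<in>J. Poly_Mapping.single 0 (x * self.coeff \<phi> t s) * \<kappa> v (s, l))"
    if "v \<in> carrier M" "t \<in> J" "l < n" for v t l
  proof -
    have *: "Poly_Mapping.single 0 a * g * Poly_Mapping.single 0 x = Poly_Mapping.single 0 (x * a) * g"
      for a and g :: "'k laurent"
      by (subst mult.commute) (simp add: mult.assoc[symmetric] mult_single)
    have "\<kappa> (ract M (\<phi> v) (scalar_emb n (Poly_Mapping.single 0 x))) (t, l)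
        = (\<Sum>s\<in>J. Poly_Mapping.single 0 (self.coeff \<phi> t s) * \<kappa> v (s, l) * Poly_Mapping.single 0 x)"
      using that \<phi> p by (simp add: act_scalar_emb End_closed self.coord_hom sum_distrib_right)
    then show ?thesis by (simp only: *)
  qed
  note * = graded_hom_of_coords[where c = "\<lambda>t s. x * self.coeff \<phi> t s"
      and \<phi> = "\<lambda>v. ract M (\<phi> v) (scalar_emb n (Poly_Mapping.single 0 x))", OF _ this]
  have closed: "ract M (\<phi> v) (scalar_emb n (Poly_Mapping.single 0 x)) \<in> carrier M"
    if "v \<in> carrier M" for v
    using p that by (intro act_closed End_closed[OF \<phi>] scalar_emb_closed[OF tiled])
  have le: "f (t, l) \<le> f (s, l)"
    if "s \<in> J" "t \<in> J" "l < n" "x * self.coeff \<phi> t s \<noteq> 0" for s t l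
    using self.coeff_nonzero_le[OF \<phi> that(1-3)] that(4) by auto
  show "x \<odot>\<^bsub>End\<^esub> \<phi> \<in> self.Hom"
    unfolding eq by (rule *(1)) (use closed le in auto)
  show "s \<in> J \<Longrightarrow> t \<in> J \<Longrightarrow> self.coeff (x \<odot>\<^bsub>End\<^esub> \<phi>) t s = x * self.coeff \<phi> t s"
    unfolding eq by (rule *(2)) (use closed le in auto)
qed

lemma
  shows End_one_closed: "(\<lambda>v\<in>carrier M. v) \<in> self.Hom"
    and coeff_one: "s \<in> J \<Longrightarrow> t \<in> J \<Longrightarrow>
          self.coeff (\<lambda>v\<in>carrier M. v) t s = (if t = s then 1 else 0)"
proof -
  have "\<kappa> v (t, l) = (\<Sum>s\<in>J. Poly_Mapping.single 0 (if t = s then 1 else 0) * \<kappa> v (s, l))"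
    if "v \<in> carrier M" "t \<in> J" "l < n" for v t l
  proof -
    have "(\<Sum>s\<in>J. Poly_Mapping.single 0 (if t = s then 1 else 0) * \<kappa> v (s, l))
        = (\<Sum>s\<in>J. if s = t then \<kappa> v (t, l) else 0)" by (intro sum.cong) auto
    then show ?thesis using that finite_rows by simp
  qed
  note * = graded_hom_of_coords[where c = "\<lambda>t s. if t = s then 1 else 0" and \<phi> = "\<lambda>v. v", OF _ this]
  show "(\<lambda>v\<in>carrier M. v) \<in> self.Hom" by (intro *(1)) (auto split: if_splits)
  show "s \<in> J \<Longrightarrow> t \<in> J \<Longrightarrow> self.coeff (\<lambda>v\<in>carrier M. v) t s = (if t = s then 1 else 0)"
    by (intro *(2)) (auto split: if_splits)
qed

lemma compose_closed:
  assumes "\<phi> \<in> self.Hom" "\<psi> \<in> self.Hom"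
  shows "compose (carrier M) \<psi> \<phi> \<in> self.Hom"
  using assms by (rule compose_graded_hom) (auto intro: add_closed act_closed simp: gr_eq)

lemma End_zero_closed: "(\<lambda>v\<in>carrier M. \<zero>\<^bsub>M\<^esub>) \<in> self.Hom"
  by (rule graded_hom_of_coords(1)[where c = "\<lambda>_ _. 0"]) (auto simp: zero_closed coord_zero)

lemma End_ring: "ring End"
proof (rule ringI)
  show "abelian_group End"
  proof (rule abelian_groupI)
    fix \<phi> assume \<phi>: "\<phi> \<in> carrier End"
    let ?\<psi> = "self.hom_of (\<lambda>t s. - self.coeff \<phi> t s)"
    have \<psi>: "?\<psi> \<in> self.Hom" using \<phi> self.coeff_nonzero_le by (intro self.hom_of_hom) auto
    have c: "self.coeff ?\<psi> t s = - self.coeff \<phi> t s" if "s \<in> J" "t \<in> J" for s t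
      using \<phi> that self.coeff_nonzero_le by (intro self.coeff_hom_of) auto
    have "?\<psi> v \<oplus>\<^bsub>M\<^esub> \<phi> v = \<zero>\<^bsub>M\<^esub>" if v: "v \<in> carrier M" for v
    proof (rule row_eqI)
      fix t l assume t: "t \<in> J" and l: "l < n"
      have "\<kappa> (?\<psi> v) (t, l) = - \<kappa> (\<phi> v) (t, l)"
        using \<phi> \<psi> v t l by (simp add: self.coord_hom c single_uminus sum_negf)
      then show "\<kappa> (?\<psi> v \<oplus>\<^bsub>M\<^esub> \<phi> v) (t, l) = \<kappa> \<zero>\<^bsub>M\<^esub> (t, l)"
        using \<phi> \<psi> v t l by (simp add: coord_add End_closed coord_zero)
    qed (use \<phi> \<psi> v in \<open>auto intro: add_closed End_closed zero_closed\<close>)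
    then have "?\<psi> \<oplus>\<^bsub>End\<^esub> \<phi> = \<zero>\<^bsub>End\<^esub>" by (auto simp: fun_eq_iff)
    with \<psi> show "\<exists>\<psi>\<in>carrier End. \<psi> \<oplus>\<^bsub>End\<^esub> \<phi> = \<zero>\<^bsub>End\<^esub>" by auto
  next
    fix \<phi> assume \<phi>: "\<phi> \<in> carrier End"
    then have "\<zero>\<^bsub>End\<^esub> \<oplus>\<^bsub>End\<^esub> \<phi> \<in> self.Hom" by (simp add: End_add_closed End_zero_closed del: restrict_apply)
    then show "\<zero>\<^bsub>End\<^esub> \<oplus>\<^bsub>End\<^esub> \<phi> = \<phi>" using \<phi> by (intro End_eqI) (auto simp: End_closed)
  qed (auto simp: End_add_closed End_zero_closed End_closed a_ac fun_eq_iff)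
  show "Group.monoid End"
  proof (rule monoidI)
    fix \<phi> \<psi> \<chi> assume "\<phi> \<in> carrier End" "\<psi> \<in> carrier End" "\<chi> \<in> carrier End"
    then show "\<phi> \<otimes>\<^bsub>End\<^esub> \<psi> \<otimes>\<^bsub>End\<^esub> \<chi> = \<phi> \<otimes>\<^bsub>End\<^esub> (\<psi> \<otimes>\<^bsub>End\<^esub> \<chi>)"
      by (auto simp: fun_eq_iff compose_def End_closed)
  next
    fix \<phi> assume \<phi>: "\<phi> \<in> carrier End"
    then show "\<one>\<^bsub>End\<^esub> \<otimes>\<^bsub>End\<^esub> \<phi> = \<phi>" "\<phi> \<otimes>\<^bsub>End\<^esub> \<one>\<^bsub>End\<^esub> = \<phi>"
      using compose_closed[OF _ End_one_closed, of \<phi>] compose_closed[OF End_one_closed, of \<phi>]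
      by (auto intro!: End_eqI simp: compose_eq End_closed)
  qed (auto simp: compose_closed End_one_closed)
next
  fix \<phi> \<psi> \<chi> assume "\<phi> \<in> carrier End" "\<psi> \<in> carrier End" "\<chi> \<in> carrier End"
  then show "(\<phi> \<oplus>\<^bsub>End\<^esub> \<psi>) \<otimes>\<^bsub>End\<^esub> \<chi> = \<phi> \<otimes>\<^bsub>End\<^esub> \<chi> \<oplus>\<^bsub>End\<^esub> \<psi> \<otimes>\<^bsub>End\<^esub> \<chi>"
    "\<chi> \<otimes>\<^bsub>End\<^esub> (\<phi> \<oplus>\<^bsub>End\<^esub> \<psi>) = \<chi> \<otimes>\<^bsub>End\<^esub> \<phi> \<oplus>\<^bsub>End\<^esub> \<chi> \<otimes>\<^bsub>End\<^esub> \<psi>"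
    using module_homD(3)[OF graded_homD(1), of \<chi> "tiled_order n d" M M]
    by (auto simp: fun_eq_iff compose_def End_closed add_closed)
qed

end

section \<open>Quotients of endomorphism algebras and incidence algebras\<close>

text \<open>
  The isomorphism theorem, in a form that includes the scalar multiplication. Both directions are
  stated because the inverse of an isomorphism is a homomorphism only after the quotient is known
  to be closed under its operations.
\<close>
lemma quotient_algebra_isomorphic:
  fixes B :: "('k, 'b) module" and C :: "('k, 'c) module"
  assumes B: "ring B" and h: "h \<in> Ring.ring_hom B C" and surj: "h ` carrier B = carrier C"
    and zero: "h \<zero>\<^bsub>B\<^esub> = \<zero>\<^bsub>C\<^esub>"
    and smult_closed: "\<And>c b. b \<in> carrier B \<Longrightarrow> c \<odot>\<^bsub>B\<^esub> b \<in> carrier B"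
    and h_smult: "\<And>c b. b \<in> carrier B \<Longrightarrow> h (c \<odot>\<^bsub>B\<^esub> b) = c \<odot>\<^bsub>C\<^esub> h b"
    and K: "K = {b \<in> carrier B. h b = \<zero>\<^bsub>C\<^esub>}"
  shows "algebra_isomorphic (quotient_algebra B K) C"
    and "algebra_isomorphic C (quotient_algebra B K)"
proof -
  have "C\<lparr>carrier := h ` carrier B, zero := h \<zero>\<^bsub>B\<^esub>\<rparr> = C" using surj zero by simp
  then have C: "ring C" using ring.ring_hom_imp_img_ring[OF B h] by simp
  interpret ring_hom_ring B C h using B C h by (rule ring_hom_ringI2)
  have K': "K = a_kernel B C h" by (simp only: K a_kernel_def')
  let ?Q = "B Quot K" and ?Q' = "quotient_algebra B K"
  let ?g = "\<lambda>X. the_elem (h ` X)"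
  have Q'_sel: "carrier ?Q' = carrier ?Q" "monoid.mult ?Q' = monoid.mult ?Q" "one ?Q' = one ?Q"
    "add ?Q' = add ?Q" "c \<odot>\<^bsub>?Q'\<^esub> X = (\<Union>b\<in>X. K +>\<^bsub>B\<^esub> (c \<odot>\<^bsub>B\<^esub> b))" for c X
    by (simp_all add: quotient_algebra_def Let_def)
  have g: "?g \<in> ring_iso ?Q C" unfolding K' by (rule FactRing_iso_set[OF surj])
  have coset: "\<exists>b\<in>carrier B. X = K +>\<^bsub>B\<^esub> b" if "X \<in> carrier ?Q" for X
    using that by (auto simp: FactRing_def A_RCOSETS_def')
  have bij: "bij_betw ?g (carrier ?Q) (carrier C)" using g by (simp add: ring_iso_def)
  have coset_in: "K +>\<^bsub>B\<^esub> x \<in> carrier ?Q" if "x \<in> carrier B" for x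
    using that by (auto simp: FactRing_def A_RCOSETS_def')
  have g_coset: "?g (K +>\<^bsub>B\<^esub> x) = h x" if "x \<in> carrier B" for x
    unfolding K' by (rule the_elem_simp[OF that])
  have coset_eq: "K +>\<^bsub>B\<^esub> x = K +>\<^bsub>B\<^esub> y"
    if "x \<in> carrier B" "y \<in> carrier B" "h x = h y" for x y
    using bij_betw_imp_inj_on[OF bij] coset_in[OF that(1)] coset_in[OF that(2)]
      g_coset[OF that(1)] g_coset[OF that(2)] that(3)
    by (simp only: inj_on_eq_iff[symmetric, where f = ?g])
  have smult: "c \<odot>\<^bsub>?Q'\<^esub> (K +>\<^bsub>B\<^esub> b) = K +>\<^bsub>B\<^esub> (c \<odot>\<^bsub>B\<^esub> b)" if b: "b \<in> carrier B" for c b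
  proof -
    have eq: "K +>\<^bsub>B\<^esub> (c \<odot>\<^bsub>B\<^esub> b') = K +>\<^bsub>B\<^esub> (c \<odot>\<^bsub>B\<^esub> b)" if b': "b' \<in> K +>\<^bsub>B\<^esub> b" for b'
    proof -
      obtain k where k: "k \<in> carrier B" "h k = \<zero>\<^bsub>C\<^esub>" "b' = k \<oplus>\<^bsub>B\<^esub> b"
        using b' unfolding a_r_coset_def' K by auto
      then have "b' \<in> carrier B" "h b' = h b" using b by simp_all
      then show ?thesis using b by (intro coset_eq smult_closed) (simp_all add: h_smult)
    qed
    have "\<zero>\<^bsub>B\<^esub> \<oplus>\<^bsub>B\<^esub> b \<in> K +>\<^bsub>B\<^esub> b"
      unfolding a_r_coset_def' K using zero by blast
    then have ne: "K +>\<^bsub>B\<^esub> b \<noteq> {}" by blast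
    have "c \<odot>\<^bsub>?Q'\<^esub> (K +>\<^bsub>B\<^esub> b) = (\<Union>b'\<in>K +>\<^bsub>B\<^esub> b. K +>\<^bsub>B\<^esub> (c \<odot>\<^bsub>B\<^esub> b))"
      unfolding Q'_sel by (rule SUP_cong[OF refl eq])
    also have "\<dots> = K +>\<^bsub>B\<^esub> (c \<odot>\<^bsub>B\<^esub> b)" using ne by simp
    finally show ?thesis .
  qed
  have g_smult: "?g (c \<odot>\<^bsub>?Q'\<^esub> X) = c \<odot>\<^bsub>C\<^esub> ?g X" and smult_X: "c \<odot>\<^bsub>?Q'\<^esub> X \<in> carrier ?Q"
    if X: "X \<in> carrier ?Q" for c X
  proof -
    obtain b where b: "b \<in> carrier B" "X = K +>\<^bsub>B\<^esub> b" using coset[OF X] by blast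
    show "?g (c \<odot>\<^bsub>?Q'\<^esub> X) = c \<odot>\<^bsub>C\<^esub> ?g X"
      unfolding b(2) smult[OF b(1)] g_coset[OF b(1)] g_coset[OF smult_closed[OF b(1)]]
      by (rule h_smult[OF b(1)])
    show "c \<odot>\<^bsub>?Q'\<^esub> X \<in> carrier ?Q"
      unfolding b(2) smult[OF b(1)] by (rule coset_in[OF smult_closed[OF b(1)]])
  qed
  have "?g \<in> ring_iso ?Q' C"
    using g by (simp add: ring_iso_def Ring.ring_hom_def Q'_sel(1-4))
  then show "algebra_isomorphic ?Q' C"
    unfolding algebra_isomorphic_def using g_smult
    by (intro bexI[of _ ?g]) (simp_all add: Q'_sel(1))
  let ?g' = "inv_into (carrier ?Q) ?g"
  have "ring ?Q" unfolding K' by (rule ideal.quotient_is_ring[OF kernel_is_ideal])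
  then have g': "?g' \<in> ring_iso C ?Q" using g by (rule ring_iso_set_sym)
  then have g'': "?g' \<in> ring_iso C ?Q'" by (simp add: ring_iso_def Ring.ring_hom_def Q'_sel(1-4))
  have "?g' (c \<odot>\<^bsub>C\<^esub> y) = c \<odot>\<^bsub>?Q'\<^esub> ?g' y" if y: "y \<in> carrier C" for c y
  proof -
    have X: "?g' y \<in> carrier ?Q" 
      using bij y inv_into_into[of y ?g "carrier ?Q"] by (simp add: bij_betw_def)
    have "?g (?g' y) = y" by (rule bij_betw_inv_into_right[OF bij y])
    then have "?g' (c \<odot>\<^bsub>C\<^esub> y) = ?g' (?g (c \<odot>\<^bsub>?Q'\<^esub> ?g' y))" by (simp only: g_smult[OF X])
    also have "\<dots> = c \<odot>\<^bsub>?Q'\<^esub> ?g' y"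
      by (rule bij_betw_inv_into_left[OF bij smult_X[OF X]])
    finally show ?thesis .
  qed
  with g'' show "algebra_isomorphic C ?Q'" unfolding algebra_isomorphic_def by blast
qed

lemma algebra_isomorphic_trans:
  assumes "algebra_isomorphic A B" "algebra_isomorphic B C"
  shows "algebra_isomorphic A C"
proof -
  obtain g h where g: "g \<in> ring_iso A B" "\<And>c a. a \<in> carrier A \<Longrightarrow> g (c \<odot>\<^bsub>A\<^esub> a) = c \<odot>\<^bsub>B\<^esub> g a"
    and h: "h \<in> ring_iso B C" "\<And>c b. b \<in> carrier B \<Longrightarrow> h (c \<odot>\<^bsub>B\<^esub> b) = c \<odot>\<^bsub>C\<^esub> h b"
    using assms unfolding algebra_isomorphic_def by blast
  have "g a \<in> carrier B" if "a \<in> carrier A" for a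
    using ring_hom_closed[of g A B a] g(1) that by (auto simp: ring_iso_def)
  then show ?thesis
    unfolding algebra_isomorphic_def
    using ring_iso_set_trans[OF g(1) h(1)] g(2) h(2) by (intro bexI[of _ "h \<circ> g"]) auto
qed

lemma incidence_algebra_sel [simp]:
  "carrier (incidence_algebra P r) = {\<phi>. \<forall>y x. (x, y) \<notin> r \<longrightarrow> \<phi> (y, x) = 0}"
  "monoid.mult (incidence_algebra P r) = (\<lambda>\<phi> \<psi>. \<lambda>(z, x). \<Sum>y\<in>P. \<phi> (z, y) * \<psi> (y, x))"
  "one (incidence_algebra P r) = (\<lambda>(y, x). if y = x \<and> x \<in> P then 1 else 0)"
  "zero (incidence_algebra P r) = (\<lambda>_. 0)"
  "add (incidence_algebra P r) = (\<lambda>\<phi> \<psi> q. \<phi> q + \<psi> q)"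
  "module.smult (incidence_algebra P r) = (\<lambda>c \<phi> q. c * \<phi> q)"
  by (simp_all add: incidence_algebra_def)

context row_lattice
begin

definition nonprojective_rows :: "'j set" where
  "nonprojective_rows = {s \<in> J. \<not> projective_between s s}"

definition row_order :: "'j rel" where
  "row_order = {(s, t). s \<in> nonprojective_rows \<and> t \<in> nonprojective_rows \<and>
     (\<forall>l<n. f (t, l) \<le> f (s, l))}"

text \<open>
  Restricting the matrix of an endomorphism to the nonprojective rows is a surjection onto the
  incidence algebra, and its kernel consists of the maps that factor through projectives. The
  hypothesis enters twice: it makes the restriction multiplicative, and it prevents a nonzero
  entry between nonprojective rows from factoring through a projective.
\<close>
theorem stable_End_incidence:
  assumes sep: "\<And>s t. s \<in> nonprojective_rows \<Longrightarrow> t \<in> nonprojective_rows \<Longrightarrow>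
                  \<not> projective_between s t"
  shows "algebra_isomorphic (stable_End n d M) (incidence_algebra nonprojective_rows row_order)"
    and "algebra_isomorphic (incidence_algebra nonprojective_rows row_order) (stable_End n d M)"
proof -
  let ?S = nonprojective_rows
  let ?C = "incidence_algebra ?S row_order :: ('k, 'j \<times> 'j \<Rightarrow> 'k) module"
  have S: "?S \<subseteq> J" by (auto simp: nonprojective_rows_def)
  define h where "h \<phi> = (\<lambda>(t, s). if s \<in> ?S \<and> t \<in> ?S then self.coeff \<phi> t s else 0)" for \<phi>
  have h_mult: "h (compose (carrier M) \<psi> \<phi>) = (\<lambda>(t, s). \<Sum>q\<in>?S. h \<psi> (t, q) * h \<phi> (q, s))"
    if \<phi>: "\<phi> \<in> self.Hom" and \<psi>: "\<psi> \<in> self.Hom" for \<phi> \<psi>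
  proof (rule ext, clarify)
    fix t s
    show "h (compose (carrier M) \<psi> \<phi>) (t, s) = (\<Sum>q\<in>?S. h \<psi> (t, q) * h \<phi> (q, s))"
    proof (cases "s \<in> ?S \<and> t \<in> ?S")
      case True
      then have st: "s \<in> J" "t \<in> J" using S by auto
      \<comment> \<open>A nonzero product would place the projective row q between s and t.\<close>
      have zero: "self.coeff \<psi> t q * self.coeff \<phi> q s = 0" if q: "q \<in> J - ?S" for q
      proof (rule ccontr)
        assume nz: "\<not> ?thesis"
        obtain b c where "b < n" "\<forall>l<n. f (q, l) \<le> d b l - c \<and> d b l - c \<le> f (q, l)"
          using q unfolding nonprojective_rows_def projective_between_def by blast
        then have bc: "b < n" "\<And>l. l < n \<Longrightarrow> f (q, l) = d b l - c" by (auto intro: order_antisym)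
        have "f (t, l) \<le> f (q, l)" "f (q, l) \<le> f (s, l)" if "l < n" for l
          using self.coeff_nonzero_le[OF \<psi> _ st(2) that] self.coeff_nonzero_le[OF \<phi> st(1) _ that] nz q
          by auto
        then have "projective_between s t" unfolding projective_between_def using bc by fastforce
        then show False using sep True by auto
      qed
      have "h (compose (carrier M) \<psi> \<phi>) (t, s) = (\<Sum>q\<in>J. self.coeff \<psi> t q * self.coeff \<phi> q s)"
        using True st by (simp add: h_def coeff_compose \<phi> \<psi>)
      also have "\<dots> = (\<Sum>q\<in>?S. self.coeff \<psi> t q * self.coeff \<phi> q s)"
        using zero by (intro sum.mono_neutral_right finite_rows S) auto
      also have "\<dots> = (\<Sum>q\<in>?S. h \<psi> (t, q) * h \<phi> (q, s))" using True by (simp add: h_def)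
      finally show ?thesis .
    qed (auto simp: h_def)
  qed
  have hom: "h \<in> Ring.ring_hom End ?C"
  proof (rule ring_hom_memI)
    fix \<phi> assume "\<phi> \<in> carrier End"
    then show "h \<phi> \<in> carrier ?C"
      using self.coeff_nonzero_le S by (fastforce simp: h_def row_order_def)
  next
    fix \<phi> \<psi> assume "\<phi> \<in> carrier End" "\<psi> \<in> carrier End"
    then show "h (\<phi> \<otimes>\<^bsub>End\<^esub> \<psi>) = h \<phi> \<otimes>\<^bsub>?C\<^esub> h \<psi>" by (simp add: h_mult)
    show "h (\<phi> \<oplus>\<^bsub>End\<^esub> \<psi>) = h \<phi> \<oplus>\<^bsub>?C\<^esub> h \<psi>"
      using coeff_add[of \<phi> \<psi>] S \<open>\<phi> \<in> carrier End\<close> \<open>\<psi> \<in> carrier End\<close>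
      by (auto simp: h_def fun_eq_iff)
  next
    show "h \<one>\<^bsub>End\<^esub> = \<one>\<^bsub>?C\<^esub>" 
      using S by (auto simp: h_def fun_eq_iff coeff_one subset_iff)
  qed
  have surj: "h ` carrier End = carrier ?C"
  proof (intro subset_antisym subsetI)
    fix F assume "F \<in> h ` carrier End"
    then show "F \<in> carrier ?C" using ring_hom_closed[OF hom] by blast
  next
    fix F assume F: "F \<in> carrier ?C"
    let ?c = "\<lambda>t s. F (t, s)"
    have F_le: "s \<in> ?S \<and> t \<in> ?S \<and> (\<forall>l<n. f (t, l) \<le> f (s, l))" if "F (t, s) \<noteq> 0" for t s
      using F that by (auto simp: row_order_def)
    have "self.hom_of ?c \<in> self.Hom" using F_le by (intro self.hom_of_hom) blast
    moreover have "self.coeff (self.hom_of ?c) t s = F (t, s)" if "s \<in> J" "t \<in> J" for s t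
      using F_le by (intro self.coeff_hom_of that) blast
    then have "h (self.hom_of ?c) (t, s) = F (t, s)" for t s
      using F_le[of t s] S by (cases "s \<in> ?S \<and> t \<in> ?S") (auto simp: h_def)
    then have "h (self.hom_of ?c) = F" by auto
    ultimately show "F \<in> h ` carrier End" by (metis End_sel(1) imageI)
  qed
  have kernel: "proj_ideal n d M = {\<phi> \<in> carrier End. h \<phi> = \<zero>\<^bsub>?C\<^esub>}"
  proof (intro subset_antisym subsetI)
    fix \<phi> assume \<phi>: "\<phi> \<in> proj_ideal n d M"
    then have "\<phi> \<in> self.Hom" by (simp add: proj_ideal_def Let_def)
    moreover have "h \<phi> (t, s) = 0" for t s
      using proj_ideal_coeff[OF \<phi>, of s t] sep S by (auto simp: h_def)
    ultimately show "\<phi> \<in> {\<phi> \<in> carrier End. h \<phi> = \<zero>\<^bsub>?C\<^esub>}" by auto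
  next
    fix \<phi> assume \<phi>: "\<phi> \<in> {\<phi> \<in> carrier End. h \<phi> = \<zero>\<^bsub>?C\<^esub>}"
    show "\<phi> \<in> proj_ideal n d M"
    proof (rule proj_idealI)
      show hom: "\<phi> \<in> self.Hom" using \<phi> by simp
      fix s t assume st: "s \<in> J" "t \<in> J" and nz: "self.coeff \<phi> t s \<noteq> 0"
      have "h \<phi> (t, s) = 0" using \<phi> by simp
      then have "s \<notin> ?S \<or> t \<notin> ?S" using nz by (auto simp: h_def)
      then obtain q where q: "q = s \<or> q = t" "projective_between q q"
        using st by (auto simp: nonprojective_rows_def)
      have "f (t, l) \<le> f (s, l)" if "l < n" for l
        by (rule self.coeff_nonzero_le[OF hom st that nz])
      then show "projective_between s t"
        using q unfolding projective_between_def by (meson order_trans)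
    qed
  qed
  have smult: "h (x \<odot>\<^bsub>End\<^esub> \<phi>) = x \<odot>\<^bsub>?C\<^esub> h \<phi>" if "\<phi> \<in> carrier End" for x \<phi>
    using that coeff_smult[of \<phi>] S by (auto simp: h_def fun_eq_iff)
  have zero: "h \<zero>\<^bsub>End\<^esub> = \<zero>\<^bsub>?C\<^esub>"
  proof -
    have "self.coeff \<zero>\<^bsub>End\<^esub> t s = 0" if "t \<in> J" "s \<in> J" for t s
      using that n_pos by (intro self.coeff_eqI) (auto simp: coord_zero)
    then show ?thesis using S by (auto simp: h_def fun_eq_iff)
  qed
  have closed: "x \<odot>\<^bsub>End\<^esub> \<phi> \<in> carrier End" if "\<phi> \<in> carrier End" for x \<phi>
    using that End_smult_closed by simp
  show "algebra_isomorphic (stable_End n d M) ?C" "algebra_isomorphic ?C (stable_End n d M)"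
    unfolding stable_End_def
    using quotient_algebra_isomorphic[OF End_ring hom surj zero closed smult kernel] by simp_all
qed

end

lemma incidence_algebra_relabel:
  assumes bij: "bij_betw \<gamma> P S" and r: "r \<subseteq> P \<times> P" and r': "r' \<subseteq> S \<times> S"
    and mono: "\<And>x y. x \<in> P \<Longrightarrow> y \<in> P \<Longrightarrow> (x, y) \<in> r \<longleftrightarrow> (\<gamma> x, \<gamma> y) \<in> r'"
  shows "algebra_isomorphic (incidence_algebra S r' :: ('k::field, _) module) (incidence_algebra P r)"
proof -
  define h where "h F = (\<lambda>(y, x). if x \<in> P \<and> y \<in> P then F (\<gamma> y, \<gamma> x) else 0)"
    for F :: "_ \<Rightarrow> 'k"
  have \<gamma>: "\<gamma> x \<in> S" if "x \<in> P" for x using bij that by (auto simp: bij_betw_def)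
  have "h \<in> Ring.ring_hom (incidence_algebra S r') (incidence_algebra P r)"
  proof (rule ring_hom_memI)
    fix F G :: "_ \<Rightarrow> 'k"
    assume F: "F \<in> carrier (incidence_algebra S r')"
    show "h F \<in> carrier (incidence_algebra P r)" using F mono by (auto simp: h_def)
    have "(\<Sum>y\<in>P. F (\<gamma> z, \<gamma> y) * G (\<gamma> y, \<gamma> x)) = (\<Sum>q\<in>S. F (\<gamma> z, q) * G (q, \<gamma> x))" for x z
      by (rule sum.reindex_bij_betw[OF bij])
    then show "h (F \<otimes>\<^bsub>incidence_algebra S r'\<^esub> G) = h F \<otimes>\<^bsub>incidence_algebra P r\<^esub> h G"
      by (auto simp: h_def fun_eq_iff cong: sum.cong)
    show "h (F \<oplus>\<^bsub>incidence_algebra S r'\<^esub> G) = h F \<oplus>\<^bsub>incidence_algebra P r\<^esub> h G"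
      by (auto simp: h_def fun_eq_iff)
  next
    show "h \<one>\<^bsub>incidence_algebra S r'\<^esub> = \<one>\<^bsub>incidence_algebra P r\<^esub>"
      using \<gamma> bij by (auto simp: h_def fun_eq_iff bij_betw_def inj_on_def)
  qed
  moreover have "bij_betw h (carrier (incidence_algebra S r')) (carrier (incidence_algebra P r))"
  proof (rule bij_betwI[where g = "\<lambda>G (t, s). if s \<in> S \<and> t \<in> S
        then G (inv_into P \<gamma> t, inv_into P \<gamma> s) else 0"])
    have inv: "inv_into P \<gamma> s \<in> P" "\<gamma> (inv_into P \<gamma> s) = s" if "s \<in> S" for s
      using bij that by (auto simp: bij_betw_def inv_into_into f_inv_into_f)
    have inv': "inv_into P \<gamma> (\<gamma> x) = x" if "x \<in> P" for x
      using bij that by (auto simp: bij_betw_def)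
    show "h \<in> carrier (incidence_algebra S r') \<rightarrow> carrier (incidence_algebra P r)"
      using mono by (auto simp: h_def)
    show "(\<lambda>G (t, s). if s \<in> S \<and> t \<in> S then G (inv_into P \<gamma> t, inv_into P \<gamma> s) else 0)
        \<in> carrier (incidence_algebra P r) \<rightarrow> carrier (incidence_algebra S r')"
      using mono inv by auto
    show "(\<lambda>(t, s). if s \<in> S \<and> t \<in> S then h F (inv_into P \<gamma> t, inv_into P \<gamma> s) else 0) = F"
      if "F \<in> carrier (incidence_algebra S r')" for F :: "_ \<Rightarrow> 'k"
    proof (rule ext, clarify)
      fix t s
      have "F (t, s) = 0" if "\<not> (s \<in> S \<and> t \<in> S)"
        using \<open>F \<in> carrier (incidence_algebra S r')\<close> r' that by auto
      then show "(if s \<in> S \<and> t \<in> S then h F (inv_into P \<gamma> t, inv_into P \<gamma> s) else 0) = F (t, s)"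
        using inv by (auto simp: h_def)
    qed
    show "h (\<lambda>(t, s). if s \<in> S \<and> t \<in> S then G (inv_into P \<gamma> t, inv_into P \<gamma> s) else 0) = G"
      if "G \<in> carrier (incidence_algebra P r)" for G :: "_ \<Rightarrow> 'k"
    proof (rule ext, clarify)
      fix y x
      have "G (y, x) = 0" if "\<not> (x \<in> P \<and> y \<in> P)"
        using \<open>G \<in> carrier (incidence_algebra P r)\<close> r that by auto
      then show "h (\<lambda>(t, s). if s \<in> S \<and> t \<in> S then G (inv_into P \<gamma> t, inv_into P \<gamma> s) else 0) (y, x)
          = G (y, x)"
        using inv' \<gamma> by (auto simp: h_def)
    qed
  qed
  ultimately show ?thesis
    unfolding algebra_isomorphic_def ring_iso_def
    by (intro bexI[of _ h]) (auto simp: h_def fun_eq_iff)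
qed

text \<open>
  The existence of a maximum is a property of the algebra: there is an idempotent \<open>e\<close> such that
  \<open>e B e\<close> consists of the multiples of \<open>e\<close>, and \<open>e B f\<close> is nonzero for every nonzero \<open>f\<close>. The
  idempotent \<open>D\<close> at a maximum of \<open>S\<close> has this property. For the corresponding \<open>e\<close> on the side of
  \<open>P\<close>, some idempotent \<open>E p\<close> satisfies \<open>e (E p) e = c e\<close> with \<open>c\<close> nonzero; since \<open>e B (E x)\<close> is
  nonzero, so is \<open>(E p) B (E x)\<close>, which means that \<open>x\<close> lies below \<open>p\<close>.
\<close>
lemma maximum_of_incidence_isomorphic:
  assumes P: "finite P" "partial_order_on P r"
    and S: "finite S" "r' \<subseteq> S \<times> S" and top: "S = {} \<or> has_maximum S r'"
    and iso: "algebra_isomorphic (incidence_algebra S r' :: ('k::field, _) module)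
                (incidence_algebra P r)"
  shows "P = {} \<or> has_maximum P r"
proof (rule disjCI)
  assume no_max: "\<not> has_maximum P r"
  let ?A = "incidence_algebra S r' :: ('k, _) module"
  let ?B = "incidence_algebra P r :: ('k, _) module"
  have r: "r \<subseteq> P \<times> P" "\<And>x. x \<in> P \<Longrightarrow> (x, x) \<in> r" "antisym r"
    using P(2) by (auto simp: partial_order_on_def preorder_on_def refl_on_def)
  obtain h where h: "h \<in> ring_iso ?A ?B"
    and h_smult: "\<And>c a. a \<in> carrier ?A \<Longrightarrow> h (c \<odot>\<^bsub>?A\<^esub> a) = c \<odot>\<^bsub>?B\<^esub> h a"
    using iso unfolding algebra_isomorphic_def by blast
  have bij: "bij_betw h (carrier ?A) (carrier ?B)" and h_hom: "h \<in> Ring.ring_hom ?A ?B"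
    using h by (auto simp: ring_iso_def)
  note h_mult = ring_hom_mult[OF h_hom]
  have zero_A: "(\<lambda>_. 0) \<in> carrier ?A" by simp
  have h_zero: "h (\<lambda>_. 0) = (\<lambda>_. 0)"
    using h_smult[OF zero_A, of 0] by (simp add: fun_eq_iff)
  define E where "E x = (\<lambda>q. if q = (x, x) then 1 else 0 :: 'k)" for x :: 'a
  have E: "E x \<in> carrier ?B" if "x \<in> P" for x using r(2) that by (auto simp: E_def)
  show "P = {}"
  proof (rule ccontr)
    assume "P \<noteq> {}"
    then obtain x0 where x0: "x0 \<in> P" by blast
    have "S \<noteq> {}"
    proof
      assume "S = {}"
      then have "carrier ?A = {\<lambda>_. 0}" using S(2) by (auto simp: fun_eq_iff)
      then have "carrier ?B = {\<lambda>_. 0}" using bij h_zero by (auto simp: bij_betw_def)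
      then have "E x0 = (\<lambda>_. 0)" using E[OF x0] by simp
      then have "E x0 (x0, x0) = 0" by simp
      then show False by (simp add: E_def)
    qed
    with top obtain m where m: "m \<in> S" "\<And>s. s \<in> S \<Longrightarrow> (s, m) \<in> r'"
      by (auto simp: has_maximum_def)
    define D where "D = (\<lambda>q. if q = (m, m) then 1 else 0 :: 'k)"
    have D: "D \<in> carrier ?A" using m by (auto simp: D_def)
    have D_mult: "D \<otimes>\<^bsub>?A\<^esub> F = (\<lambda>(t, s). if t = m then F (m, s) else 0)" for F
    proof (rule ext, clarify)
      fix t s
      have "(D \<otimes>\<^bsub>?A\<^esub> F) (t, s) = (\<Sum>q\<in>S. if q = m then if t = m then F (m, s) else 0 else 0)"
        unfolding incidence_algebra_sel prod.case by (intro sum.cong) (auto simp: D_def)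
      then show "(D \<otimes>\<^bsub>?A\<^esub> F) (t, s) = (if t = m then F (m, s) else 0)" using S(1) m(1) by simp
    qed
    have mult_D: "F \<otimes>\<^bsub>?A\<^esub> D = (\<lambda>(t, s). if s = m then F (t, m) else 0)" for F
    proof (rule ext, clarify)
      fix t s
      have "(F \<otimes>\<^bsub>?A\<^esub> D) (t, s) = (\<Sum>q\<in>S. if q = m then if s = m then F (t, m) else 0 else 0)"
        unfolding incidence_algebra_sel prod.case by (intro sum.cong) (auto simp: D_def)
      then show "(F \<otimes>\<^bsub>?A\<^esub> D) (t, s) = (if s = m then F (t, m) else 0)" using S(1) m(1) by simp
    qed
    have DFD: "(D \<otimes>\<^bsub>?A\<^esub> F) \<otimes>\<^bsub>?A\<^esub> D = F (m, m) \<odot>\<^bsub>?A\<^esub> D" for F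
      unfolding mult_D D_mult by (auto simp: fun_eq_iff D_def)
    have DF: "D \<otimes>\<^bsub>?A\<^esub> F \<in> carrier ?A" if "F \<in> carrier ?A" for F
      unfolding D_mult using that by auto
    define e where "e = h D"
    have e: "e \<in> carrier ?B" unfolding e_def using ring_hom_closed[OF h_hom D] .
    have pre: "\<exists>F\<in>carrier ?A. h F = b" if "b \<in> carrier ?B" for b
      using bij that unfolding bij_betw_def by (metis imageE)
    have local_e: "\<exists>c. (e \<otimes>\<^bsub>?B\<^esub> b) \<otimes>\<^bsub>?B\<^esub> e = c \<odot>\<^bsub>?B\<^esub> e" if b: "b \<in> carrier ?B" for b
    proof -
      obtain F where F: "F \<in> carrier ?A" "h F = b" using pre[OF b] by blast
      have "(e \<otimes>\<^bsub>?B\<^esub> b) \<otimes>\<^bsub>?B\<^esub> e = h ((D \<otimes>\<^bsub>?A\<^esub> F) \<otimes>\<^bsub>?A\<^esub> D)"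
        using h_mult[OF DF[OF F(1)] D] h_mult[OF D F(1)] F(2) by (simp only: e_def)
      also have "\<dots> = F (m, m) \<odot>\<^bsub>?B\<^esub> e" unfolding DFD e_def by (rule h_smult[OF D])
      finally show ?thesis by blast
    qed
    have sincere: "\<exists>b\<in>carrier ?B. (e \<otimes>\<^bsub>?B\<^esub> b) \<otimes>\<^bsub>?B\<^esub> E x \<noteq> (\<lambda>_. 0)" if x: "x \<in> P" for x
    proof -
      obtain F where F: "F \<in> carrier ?A" "h F = E x" using pre[OF E[OF x]] by blast
      have "E x (x, x) \<noteq> 0" by (simp add: E_def)
      then have "E x \<noteq> (\<lambda>_. 0)" by metis
      then have "F \<noteq> (\<lambda>_. 0)" using F h_zero by metis
      then obtain t s where ts: "F (t, s) \<noteq> 0" by (auto simp: fun_eq_iff)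
      then have tS: "t \<in> S" using F(1) S(2) by auto
      \<comment> \<open>The basis element (m, t) moves a nonzero entry of F from row t to row m.\<close>
      let ?G = "\<lambda>q. if q = (m, t) then 1 else 0 :: 'k"
      have G: "?G \<in> carrier ?A" using m(2)[OF tS] by auto
      have DG: "D \<otimes>\<^bsub>?A\<^esub> ?G = ?G" unfolding D_mult by (auto simp: fun_eq_iff)
      define GF where "GF = (\<lambda>(z, s). if z = m then F (t, s) else 0)"
      have GF: "?G \<otimes>\<^bsub>?A\<^esub> F = GF"
      proof (rule ext, clarify)
        fix z s
        have "(?G \<otimes>\<^bsub>?A\<^esub> F) (z, s) = (\<Sum>q\<in>S. if q = t then if z = m then F (t, s) else 0 else 0)"
          unfolding incidence_algebra_sel prod.case by (intro sum.cong) auto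
        then show "(?G \<otimes>\<^bsub>?A\<^esub> F) (z, s) = GF (z, s)" using tS S(1) by (simp add: GF_def)
      qed
      have GF_in: "GF \<in> carrier ?A" using F(1) m(2) S(2) by (fastforce simp: GF_def)
      have "GF (m, s) \<noteq> 0" using ts by (simp add: GF_def)
      then have "GF \<noteq> (\<lambda>_. 0)" by metis
      then have "h GF \<noteq> (\<lambda>_. 0)"
        using bij GF_in zero_A h_zero by (metis bij_betw_def inj_on_eq_iff)
      moreover have "h GF = (e \<otimes>\<^bsub>?B\<^esub> h ?G) \<otimes>\<^bsub>?B\<^esub> E x"
        using h_mult[OF D G] h_mult[OF G F(1)] F(2) by (simp only: DG GF e_def)
      ultimately show ?thesis using ring_hom_closed[OF h_hom G] by (intro bexI[of _ "h ?G"]) simp_all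
    qed
    have idem: "e \<otimes>\<^bsub>?B\<^esub> e = e"
    proof -
      have "D \<otimes>\<^bsub>?A\<^esub> D = D" unfolding D_mult by (auto simp: D_def fun_eq_iff)
      then show ?thesis using h_mult[OF D D] by (simp only: e_def)
    qed
    obtain b where b: "(e \<otimes>\<^bsub>?B\<^esub> b) \<otimes>\<^bsub>?B\<^esub> E x0 \<noteq> (\<lambda>_. 0)" using sincere[OF x0] by blast
    have "e \<noteq> (\<lambda>_. 0)"
    proof
      assume "e = (\<lambda>_. 0)"
      then have "(e \<otimes>\<^bsub>?B\<^esub> b) \<otimes>\<^bsub>?B\<^esub> E x0 = (\<lambda>_. 0)" by (simp add: fun_eq_iff)
      then show False using b by blast
    qed
    then obtain z x where zx: "e (z, x) \<noteq> 0" by (auto simp: fun_eq_iff)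
    have "e (z, x) = (\<Sum>y\<in>P. e (z, y) * e (y, x))"
      using fun_cong[OF idem, of "(z, x)"] by simp
    \<comment> \<open>Since e is idempotent, a nonzero entry of e is a sum of such products.\<close>
    then obtain p where p: "p \<in> P" "e (z, p) * e (p, x) \<noteq> 0"
      using zx by (metis (no_types, lifting) sum.neutral)
    have entry: "((e \<otimes>\<^bsub>?B\<^esub> E p) \<otimes>\<^bsub>?B\<^esub> e) (z, x) = e (z, p) * e (p, x)" for z x
    proof -
      have "(e \<otimes>\<^bsub>?B\<^esub> E p) (z, y) = (if y = p then e (z, p) else 0)" for y
      proof -
        have "(e \<otimes>\<^bsub>?B\<^esub> E p) (z, y) = (\<Sum>q\<in>P. if q = p then if y = p then e (z, p) else 0 else 0)"
          unfolding incidence_algebra_sel prod.case by (intro sum.cong) (auto simp: E_def)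
        then show ?thesis using P(1) p(1) by simp
      qed
      then have "((e \<otimes>\<^bsub>?B\<^esub> E p) \<otimes>\<^bsub>?B\<^esub> e) (z, x)
          = (\<Sum>y\<in>P. if y = p then e (z, p) * e (p, x) else 0)"
        by (subst (1) incidence_algebra_sel(2)) (auto intro!: sum.cong)
      then show ?thesis using P(1) p(1) by simp
    qed
    obtain c where c: "(e \<otimes>\<^bsub>?B\<^esub> E p) \<otimes>\<^bsub>?B\<^esub> e = c \<odot>\<^bsub>?B\<^esub> e"
      using local_e[OF E[OF p(1)]] by blast
    have split: "e (z, p) * e (p, x) = c * e (z, x)" for z x
      using entry[of z x] fun_cong[OF c, of "(z, x)"] by simp
    have c0: "c \<noteq> 0" using split[of z x] p(2) by auto
    have "(x, p) \<in> r" if x: "x \<in> P" for x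
    proof -
      obtain b where b: "b \<in> carrier ?B" "(e \<otimes>\<^bsub>?B\<^esub> b) \<otimes>\<^bsub>?B\<^esub> E x \<noteq> (\<lambda>_. 0)"
        using sincere[OF x] by blast
      obtain z y where zy: "((e \<otimes>\<^bsub>?B\<^esub> b) \<otimes>\<^bsub>?B\<^esub> E x) (z, y) \<noteq> 0"
        using b(2) by (auto simp: fun_eq_iff simp del: incidence_algebra_sel)
      then have "(\<Sum>q\<in>P. (e \<otimes>\<^bsub>?B\<^esub> b) (z, q) * E x (q, y)) \<noteq> 0" by simp
      then obtain q where "(e \<otimes>\<^bsub>?B\<^esub> b) (z, q) * E x (q, y) \<noteq> 0"
        by (metis (no_types, lifting) sum.neutral)
      then have "(e \<otimes>\<^bsub>?B\<^esub> b) (z, x) \<noteq> 0"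
        by (auto simp: E_def simp del: incidence_algebra_sel split: if_splits)
      then have "(\<Sum>q\<in>P. e (z, q) * b (q, x)) \<noteq> 0" by simp
      then obtain q where "e (z, q) * b (q, x) \<noteq> 0" by (metis (no_types, lifting) sum.neutral)
      then have q: "e (z, q) \<noteq> 0" "b (q, x) \<noteq> 0" by auto
      then have "e (p, q) \<noteq> 0" using split[of z q] c0 by auto
      then have "(q, p) \<in> r" "(x, q) \<in> r" using e b(1) q(2) by auto
      then show ?thesis using P(2) unfolding partial_order_on_def preorder_on_def trans_def by blast
    qed
    then show False using no_max p(1) unfolding has_maximum_def by blast
  qed
qed

section \<open>The module V\<close>

lemma row_lattice_reindex:
  assumes "row_lattice n d M J \<kappa> f" and g: "bij_betw g J' J"
  shows "row_lattice n d M J' (\<lambda>v (j, l). \<kappa> v (g j, l)) (\<lambda>(j, l). f (g j, l))"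
proof -
  interpret row_lattice n d M J \<kappa> f by fact
  have g_in: "g j \<in> J" if "j \<in> J'" for j using g that by (auto simp: bij_betw_def)
  have J: "J = g ` J'" using g by (simp add: bij_betw_def)
  show ?thesis
  proof (unfold_locales, goal_cases)
    case 1
    then show ?case using finite_rows g by (simp add: bij_betw_finite)
  next
    case (3 v w)
    show ?case
    proof (rule row_eqI[OF 3(1,2)])
      fix j l assume "j \<in> J" "l < n"
      then show "\<kappa> v (j, l) = \<kappa> w (j, l)" using 3(3) by (auto simp: J)
    qed
  next
    case (4 F)
    have "\<exists>v\<in>carrier M. \<forall>x\<in>J \<times> {..<n}. \<kappa> v x = F (inv_into J' g (fst x), snd x)"
      using 4 g by (intro coord_surj) (force simp: J bij_betw_def)
    then obtain v where "v \<in> carrier M"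
      "\<And>x. x \<in> J \<times> {..<n} \<Longrightarrow> \<kappa> v x = F (inv_into J' g (fst x), snd x)" by blast
    then show ?case using g by (intro bexI[of _ v]) (auto simp: J bij_betw_def)
  next
    case 11
    then show ?case using finite_rows g by (simp add: bij_betw_finite)
  qed (auto simp: g_in zero_closed coord_zero add_closed coord_add gr_eq tiled act_closed act J coord_in)
qed

lemma nonneg_graded_iff:
  "nonneg_graded (tiled_order n d :: ('k::field, 'k laurent mat) graded_algebra) \<longleftrightarrow>
     (\<forall>i<n. \<forall>j<n. 0 \<le> d i j)"
proof
  let ?A = "tiled_order n d :: ('k, 'k laurent mat) graded_algebra"
  assume A: "nonneg_graded ?A"
  show "\<forall>i<n. \<forall>j<n. 0 \<le> d i j"
  proof (intro allI impI, rule ccontr)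
    fix i j assume ij: "i < n" "j < n" "\<not> 0 \<le> d i j"
    let ?a = "entry_mat n (Poly_Mapping.single (d i j) (1::'k)) i j"
    have "?a \<in> deg_part ?A (d i j)" by (auto simp: tiled_order_deg intro: entry_mat_closed)
    then have "?a = 0\<^sub>m n n" using A ij(3) by (auto simp: nonneg_graded_def)
    then have "?a $$ (i, j) = 0" using ij by simp
    then have "Poly_Mapping.single (d i j) (1::'k) = 0" using ij by simp
    then show False by (metis lookup_single_eq lookup_zero zero_neq_one)
  qed
next
  let ?A = "tiled_order n d :: ('k, 'k laurent mat) graded_algebra"
  assume nonneg: "\<forall>i<n. \<forall>j<n. 0 \<le> d i j"
  have "a = 0\<^sub>m n n" if "a \<in> deg_part ?A m" "m < 0" for a m
  proof (rule eq_matI)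
    fix i j assume "i < dim_row (0\<^sub>m n n :: 'k laurent mat)" "j < dim_col (0\<^sub>m n n :: 'k laurent mat)"
    then have ij: "i < n" "j < n" by auto
    then have "m < d i j" using that(2) nonneg by fastforce
    then show "a $$ (i, j) = 0\<^sub>m n n $$ (i, j)"
      using that(1) ij homog_Int_poly_times_x[of "a $$ (i, j)" m "d i j"]
      by (auto simp: tiled_order_deg tiled_order_carrier)
  qed (use that in \<open>auto simp: tiled_order_deg tiled_order_carrier\<close>)
  moreover have "0\<^sub>m n n \<in> deg_part ?A m" for m by (auto simp: tiled_order_deg tiled_order_carrier)
  ultimately show "nonneg_graded ?A" by (auto simp: nonneg_graded_def)
qed

text \<open>
  A homomorphism from \<open>e_i A\<close> to \<open>e_j A\<close> is multiplication by an element of \<open>R x^d(j, i)\<close>. If it is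
  onto, then the idempotent at \<open>j\<close> is such a multiple of an element of \<open>R x^d(i, j)\<close>, which forces
  \<open>d(i, j) + d(j, i)\<close> to be at most 0.
\<close>
lemma row_proj_isomorphic_exponents:
  assumes tiled: "tiled_exponents n d" and i: "i < n" and j: "j < n"
    and iso: "module_isomorphic (tiled_order n d :: ('k::field, 'k laurent mat) graded_algebra)
                (row_proj n d i) (row_proj n d j)"
  shows "d i j + d j i = 0"
proof -
  let ?A = "tiled_order n d :: ('k, 'k laurent mat) graded_algebra"
  let ?P = "row_proj n d i :: ('k laurent mat, 'k laurent mat) gmod"
  let ?Q = "row_proj n d j :: ('k laurent mat, 'k laurent mat) gmod"
  obtain \<phi> where \<phi>: "\<phi> \<in> module_hom ?A ?P ?Q" and bij: "bij_betw \<phi> (carrier ?P) (carrier ?Q)"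
    using iso unfolding module_isomorphic_def by blast
  interpret P: row_lattice n d ?P "{()}" "\<lambda>v (_, l). v $$ (i, l)" "\<lambda>(_, l). d i l"
    by (rule row_lattice_row_proj[OF tiled i])
  interpret Q: row_lattice n d ?Q "{()}" "\<lambda>v (_, l). v $$ (j, l)" "\<lambda>(_, l). d j l"
    by (rule row_lattice_row_proj[OF tiled j])
  define u where "u = P.basis ((), i)"
  define e where "e = Q.basis ((), j)"
  have diag: "d i i = 0" "d j j = 0" using tiled i j by (auto simp: tiled_exponents_def)
  have u: "u \<in> carrier ?P" "\<And>l. l < n \<Longrightarrow> u $$ (i, l) = (if l = i then 1 else 0)"
    using P.basis_closed P.coord_basis[of "((), _)" "((), i)"] diag by (auto simp: u_def)
  have e: "e \<in> carrier ?Q" "e $$ (j, j) = 1"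
    using Q.basis_closed Q.coord_basis[of "((), j)" "((), j)"] diag j by (auto simp: e_def)
  obtain w where w: "w \<in> carrier ?P" "\<phi> w = e" using bij e(1) by (metis bij_betw_def imageE)
  \<comment> \<open>The preimage w of e, viewed as an element of the order, satisfies w = u a.\<close>
  define a where "a = mat n n (\<lambda>(r, c). if r = i then w $$ (i, c) else 0)"
  have wx: "w $$ (i, c) \<in> poly_times_x (d i c)" if "c < n" for c
    using P.coord_in[OF w(1), of "((), c)"] that by simp
  have a: "a \<in> carrier ?A" using wx by (auto simp: a_def tiled_order_carrier)
  have "ract ?P u a = w"
  proof (rule P.row_eqI[OF P.act_closed[OF u(1) a] w(1)])
    fix x l assume l: "l < n"
    have "ract ?P u a $$ (i, l) = (\<Sum>l'<n. u $$ (i, l') * a $$ (l', l))"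
      using P.act[OF u(1) a, of "()" l] l by simp
    also have "\<dots> = (\<Sum>l'<n. if l' = i then w $$ (i, l) else 0)"
      using l i by (intro sum.cong) (auto simp: u(2) a_def)
    finally show "(case (x, l) of (_, l) \<Rightarrow> ract ?P u a $$ (i, l)) = (case (x, l) of (_, l) \<Rightarrow> w $$ (i, l))"
      using i by simp
  qed
  then have "e = ract ?Q (\<phi> u) a" using w(2) module_homD(4)[OF \<phi> u(1) a] by simp
  then have "1 = (\<Sum>l<n. \<phi> u $$ (j, l) * a $$ (l, j))"
    using Q.act[OF module_homD(2)[OF \<phi> u(1)] a, of "()" j] j e(2) by simp
  also have "\<dots> = (\<Sum>l<n. if l = i then \<phi> u $$ (j, i) * w $$ (i, j) else 0)"
    using j by (intro sum.cong) (auto simp: a_def)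
  also have "\<dots> = \<phi> u $$ (j, i) * w $$ (i, j)" using i by simp
  also have "\<dots> \<in> poly_times_x (d j i + d i j)"
    using Q.coord_in[OF module_homD(2)[OF \<phi> u(1)], of "((), i)"] i wx[OF j]
    by (intro poly_times_x_mult) auto
  finally have "d j i + d i j \<le> 0" by (simp add: single_one[symmetric] del: single_one)
  moreover have "d i i \<le> d i j + d j i" using tiled i j unfolding tiled_exponents_def by blast
  ultimately show ?thesis using diag by simp
qed

definition summand_index :: "(nat \<Rightarrow> nat \<Rightarrow> int) \<Rightarrow> nat set \<Rightarrow> (nat \<Rightarrow> nat) \<Rightarrow> (nat \<times> int) option set" where
  "summand_index d I \<nu> = insert None (Some ` (SIGMA i:I. {1..- p_param d \<nu> i}))"

text \<open>
  The exponents of the row module and of the truncations of \<open>e_\<nu>i A(j)\<close>: the shift lowers all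
  exponents by \<open>j\<close>, and the truncation replaces the negative ones by 0.
\<close>
definition summand_exp :: "(nat \<Rightarrow> nat \<Rightarrow> int) \<Rightarrow> (nat \<Rightarrow> nat) \<Rightarrow> (nat \<times> int) option \<Rightarrow> nat \<Rightarrow> int" where
  "summand_exp d \<nu> s l = (case s of None \<Rightarrow> 0 | Some (i, j) \<Rightarrow> max (d (\<nu> i) l - j) 0)"

definition nonprojective_summands ::
  "nat \<Rightarrow> (nat \<Rightarrow> nat \<Rightarrow> int) \<Rightarrow> nat set \<Rightarrow> (nat \<Rightarrow> nat) \<Rightarrow> (nat \<times> int) option set" where
  "nonprojective_summands n d I \<nu> =
     {s \<in> summand_index d I \<nu>. \<not> (\<exists>b<n. \<exists>c. \<forall>l<n. summand_exp d \<nu> s l = d b l - c)}"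

text \<open>
  Inclusion of rows, so the exponents are compared in the opposite direction.
\<close>
definition summand_order ::
  "nat \<Rightarrow> (nat \<Rightarrow> nat \<Rightarrow> int) \<Rightarrow> nat set \<Rightarrow> (nat \<Rightarrow> nat) \<Rightarrow> (nat \<times> int) option rel" where
  "summand_order n d I \<nu> =
     {(s, t). s \<in> nonprojective_summands n d I \<nu> \<and> t \<in> nonprojective_summands n d I \<nu> \<and>
        (\<forall>l<n. summand_exp d \<nu> t l \<le> summand_exp d \<nu> s l)}"

lemma row_lattice_V_module:
  assumes tiled: "tiled_exponents n d" and nonneg: "\<And>i j. i < n \<Longrightarrow> j < n \<Longrightarrow> 0 \<le> d i j"
    and I: "I \<subseteq> {..<n}" and \<nu>: "\<nu> ` I \<subseteq> I"
  shows "\<exists>\<kappa>. row_lattice n d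
           (V_module n d I \<nu> :: ('k::field laurent mat, (nat \<times> int) option \<Rightarrow> 'k laurent mat) gmod)
           (summand_index d I \<nu>) \<kappa> (\<lambda>(s, l). summand_exp d \<nu> s l)"
proof -
  let ?K = "summand_index d I \<nu>"
  let ?M = "\<lambda>s. (case s of None \<Rightarrow> row_module n
            | Some (i, j) \<Rightarrow> trunc (shift (row_proj n d (\<nu> i)) j))
            :: ('k laurent mat, 'k laurent mat) gmod"
  define \<kappa> :: "(nat \<times> int) option \<Rightarrow> 'k laurent mat \<Rightarrow> unit \<times> nat \<Rightarrow> 'k laurent"
    where "\<kappa> s = (case s of None \<Rightarrow> (\<lambda>v (_, l). v $$ (0, l))
     | Some (i, j) \<Rightarrow> (\<lambda>v x. Poly_Mapping.single (- j) 1 * (case x of (_, l) \<Rightarrow> v $$ (\<nu> i, l))))"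
    for s
  define \<kappa>' where "\<kappa>' = (\<lambda>v (s, l :: nat). \<kappa> s (v s :: 'k laurent mat) ((), l) :: 'k laurent)"
  have fin: "finite ?K" using I by (auto simp: summand_index_def intro: finite_subset)
  have row: "row_lattice n d (?M s) {()} (\<kappa> s) (\<lambda>x. summand_exp d \<nu> s (snd x))" if s: "s \<in> ?K" for s
  proof (cases s)
    case None
    then show ?thesis using row_lattice_row_module[OF tiled nonneg]
      by (simp add: \<kappa>_def summand_exp_def case_prod_beta)
  next
    case (Some p)
    obtain i j where p: "p = (i, j)" by (cases p)
    have "\<nu> i < n" using s I \<nu> Some p by (auto simp: summand_index_def)
    then show ?thesis
      using row_lattice_trunc[OF row_lattice_shift[OF row_lattice_row_proj[OF tiled]] nonneg, of "\<nu> i" j]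
      by (simp add: \<kappa>_def summand_exp_def Some p case_prod_beta)
  qed
  have sum: "row_lattice n d (direct_sum ?K ?M) (Sigma ?K (\<lambda>_. {()}))
      (\<lambda>v ((s, j), l). \<kappa> s (v s) (j, l)) (\<lambda>((s, j), l). summand_exp d \<nu> s (snd (j, l)))"
    by (rule row_lattice_direct_sum[OF fin tiled row])
  have bij: "bij_betw (\<lambda>s. (s, ())) ?K (Sigma ?K (\<lambda>_. {()}))"
    by (auto simp: bij_betw_def inj_on_def)
  have "row_lattice n d (direct_sum ?K ?M) ?K \<kappa>' (\<lambda>(s, l). summand_exp d \<nu> s l)"
    using row_lattice_reindex[OF sum bij] by (simp add: \<kappa>'_def)
  then show ?thesis by (auto simp: V_module_def summand_index_def)
qed

text \<open>
  The numerical content of an \<open>\<nat>\<close>-graded Gorenstein tiled order with a complete set \<open>I\<close> of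
  representatives.
\<close>
locale nakayama_order =
  fixes n :: nat and d :: "nat \<Rightarrow> nat \<Rightarrow> int" and I :: "nat set" and \<nu> :: "nat \<Rightarrow> nat"
  assumes tiled: "tiled_exponents n d"
    and nonneg: "\<And>i j. i < n \<Longrightarrow> j < n \<Longrightarrow> 0 \<le> d i j"
    and I_subset: "I \<subseteq> {..<n}"
    and representative: "\<And>i. i < n \<Longrightarrow> \<exists>j\<in>I. d i j + d j i = 0"
    and nakayama: "nakayama n d I \<nu>"
begin

lemma triangle: "i < n \<Longrightarrow> j < n \<Longrightarrow> l < n \<Longrightarrow> d i j \<le> d i l + d l j"
  using tiled by (simp add: tiled_exponents_def)

lemma diag: "i < n \<Longrightarrow> d i i = 0"
  using tiled by (simp add: tiled_exponents_def)

lemma nak: "i \<in> I \<Longrightarrow> l < n \<Longrightarrow> d (\<nu> i) l + d l i = d (\<nu> i) i"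
  using nakayama by (simp add: nakayama_def)

lemma I_less: "i \<in> I \<Longrightarrow> i < n" using I_subset by auto

lemma \<nu>_in: "i \<in> I \<Longrightarrow> \<nu> i \<in> I"
  using nakayama by (auto simp: nakayama_def bij_betw_def)

lemma \<nu>_less: "i \<in> I \<Longrightarrow> \<nu> i < n" by (rule I_less[OF \<nu>_in])

text \<open>
  Since all exponents are nonnegative, equivalent indices have equal rows, and every element of
  \<open>I\<close> is a value of the Nakayama permutation.
\<close>
lemma representative_row:
  assumes b: "b < n"
  obtains a where "a \<in> I" "\<And>l. l < n \<Longrightarrow> d b l = d (\<nu> a) l"
proof -
  obtain b' where b': "b' \<in> I" "d b b' + d b' b = 0" using representative[OF b] by blast
  then have *: "d b b' = 0" "d b' b = 0" using nonneg[of b b'] nonneg[of b' b] b I_less by force+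
  obtain a where a: "a \<in> I" "\<nu> a = b'"
    using nakayama b' by (metis nakayama_def bij_betw_def imageE)
  have "d b l = d b' l" if "l < n" for l
    using triangle[of b l b'] triangle[of b' l b] * b I_less[OF b'(1)] that by simp
  then show ?thesis using a that by blast
qed

text \<open>
  The position \<open>b\<close> gives \<open>c \<le> 0\<close>, and the position \<open>\<nu> i\<close>, at which the truncation has exponent 0,
  gives \<open>c = 0\<close> and \<open>d b (\<nu> i) = 0\<close>. Writing row \<open>b\<close> as row \<open>\<nu> a\<close>, the Nakayama identity yields
  \<open>d (\<nu> i) a = d b a\<close>. At position \<open>a\<close> the truncation is therefore smaller than \<open>d b a\<close> unless
  \<open>d b a = 0\<close>; but \<open>d b a\<close> is the largest entry of row \<open>b\<close>, so the row vanishes.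
\<close>
lemma projective_below_row_module:
  assumes ij: "i \<in> I" "1 \<le> j" and b: "b < n"
    and between: "\<And>l. l < n \<Longrightarrow> 0 \<le> d b l - c \<and> d b l - c \<le> max (d (\<nu> i) l - j) 0"
  shows "l < n \<Longrightarrow> d b l - c = 0"
proof -
  obtain a where a: "a \<in> I" and ba: "\<And>l. l < n \<Longrightarrow> d b l = d (\<nu> a) l"
    using representative_row[OF b] by blast
  have "c \<le> 0" using between[OF b] diag[OF b] by simp
  moreover have "d b (\<nu> i) - c \<le> 0"
    using between[OF \<nu>_less[OF ij(1)]] diag[OF \<nu>_less[OF ij(1)]] ij(2) by simp
  moreover have "0 \<le> d b (\<nu> i)" by (rule nonneg[OF b \<nu>_less[OF ij(1)]])
  ultimately have c: "c = 0" and bi: "d b (\<nu> i) = 0" by auto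
  have "d (\<nu> i) a = d b a"
    using nak[OF a \<nu>_less[OF ij(1)]] ba[OF I_less[OF a]] ba[OF \<nu>_less[OF ij(1)]] bi by simp
  then have "d b a = 0"
    using between[OF I_less[OF a]] c ij(2) nonneg[OF b I_less[OF a]] by auto
  then have "d b l + d l a = 0" if "l < n" for l
    using nak[OF a that] ba[OF that] ba[OF I_less[OF a]] by simp
  then show "l < n \<Longrightarrow> d b l - c = 0"
    using nonneg[OF b] nonneg[OF _ I_less[OF a]] c by (smt (verit))
qed

abbreviation "S \<equiv> nonprojective_summands n d I \<nu>"

lemma summand_index_iff:
  "Some (i, j) \<in> summand_index d I \<nu> \<longleftrightarrow> i \<in> I \<and> 1 \<le> j \<and> j \<le> d (\<nu> i) i - 1"
  "None \<in> summand_index d I \<nu>"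
  by (auto simp: summand_index_def p_param_def)

lemma summand_exp_simps [simp]:
  "summand_exp d \<nu> None l = 0" "summand_exp d \<nu> (Some (i, j)) l = max (d (\<nu> i) l - j) 0"
  by (auto simp: summand_exp_def)

lemma summand_exp_nonneg: "0 \<le> summand_exp d \<nu> s l"
  by (auto simp: summand_exp_def split: option.splits)

text \<open>
  Otherwise the truncation would be all of the row module, but its exponent at position \<open>i\<close> is
  positive.
\<close>
lemma truncation_nonprojective:
  assumes "Some p \<in> summand_index d I \<nu>"
  shows "Some p \<in> S"
proof -
  obtain i j where p: "p = (i, j)" by (cases p)
  have ij: "i \<in> I" "1 \<le> j" "j \<le> d (\<nu> i) i - 1" using assms by (simp_all add: p summand_index_iff)
  have False if b: "b < n" and proj: "\<And>l. l < n \<Longrightarrow> summand_exp d \<nu> (Some p) l = d b l - c" for b c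
  proof -
    have "d b l - c = max (d (\<nu> i) l - j) 0" if "l < n" for l using proj[OF that] p by simp
    then have "d b i - c = 0"
      by (intro projective_below_row_module[OF ij(1,2) b _ I_less[OF ij(1)]]) auto
    then show False using proj[OF I_less[OF ij(1)]] ij(3) p by simp
  qed
  then show ?thesis using assms by (auto simp: nonprojective_summands_def)
qed

lemma nonprojective_summands_separated:
  assumes s: "s \<in> S" and t: "t \<in> S" and b: "b < n"
    and between: "\<And>l. l < n \<Longrightarrow> summand_exp d \<nu> t l \<le> d b l - c \<and> d b l - c \<le> summand_exp d \<nu> s l"
  shows False
proof (cases s)
  case None
  have "summand_exp d \<nu> s l = d b l - c" if "l < n" for l
    using between[OF that] summand_exp_nonneg[of t l] None by simp
  then show False using s b by (auto simp: nonprojective_summands_def)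
next
  case (Some p)
  obtain i j where p: "p = (i, j)" by (cases p)
  have ij: "i \<in> I" "1 \<le> j" using s Some p by (auto simp: nonprojective_summands_def summand_index_iff)
  have "0 \<le> d b l - c \<and> d b l - c \<le> max (d (\<nu> i) l - j) 0" if "l < n" for l
    using between[OF that] summand_exp_nonneg[of t l] Some p by simp
  then have zero: "d b l - c = 0" if "l < n" for l
    using projective_below_row_module[OF ij b] that by blast
  have "summand_exp d \<nu> t l = d b l - c" if "l < n" for l
    using between[OF that] zero[OF that] summand_exp_nonneg[of t l] by simp
  then show False using t b by (auto simp: nonprojective_summands_def)
qed

theorem Gamma_incidence:
  shows "algebra_isomorphic (Gamma_algebra n d I \<nu> :: ('k::field, _) module)
           (incidence_algebra S (summand_order n d I \<nu>))"
    and "algebra_isomorphic (incidence_algebra S (summand_order n d I \<nu>))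
           (Gamma_algebra n d I \<nu> :: ('k::field, _) module)"
proof -
  obtain \<kappa> where "row_lattice n d
      (V_module n d I \<nu> :: ('k laurent mat, (nat \<times> int) option \<Rightarrow> 'k laurent mat) gmod)
      (summand_index d I \<nu>) \<kappa> (\<lambda>(s, l). summand_exp d \<nu> s l)"
    using row_lattice_V_module[OF tiled nonneg I_subset] \<nu>_in by blast
  then interpret V: row_lattice n d
    "V_module n d I \<nu> :: ('k laurent mat, (nat \<times> int) option \<Rightarrow> 'k laurent mat) gmod"
    "summand_index d I \<nu>" \<kappa> "\<lambda>(s, l). summand_exp d \<nu> s l" .
  have le_le: "x \<le> y \<and> y \<le> x \<longleftrightarrow> x = y" for x y :: int by auto
  have rows: "V.nonprojective_rows = S"
    unfolding V.nonprojective_rows_def V.projective_between_def nonprojective_summands_def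
      prod.case le_le ..
  have order: "V.row_order = summand_order n d I \<nu>"
    unfolding V.row_order_def rows summand_order_def by simp
  have "\<not> V.projective_between s t" if "s \<in> S" "t \<in> S" for s t
    using nonprojective_summands_separated[OF that] unfolding V.projective_between_def by auto
  then show "algebra_isomorphic (Gamma_algebra n d I \<nu> :: ('k::field, _) module)
           (incidence_algebra S (summand_order n d I \<nu>))"
    "algebra_isomorphic (incidence_algebra S (summand_order n d I \<nu>))
           (Gamma_algebra n d I \<nu> :: ('k::field, _) module)"
    using V.stable_End_incidence unfolding rows order Gamma_algebra_def by simp_all
qed

lemma finite_summands: "finite S"
proof -
  have "finite (summand_index d I \<nu>)"
    using I_subset by (auto simp: summand_index_def intro: finite_subset)
  then show ?thesis by (simp add: nonprojective_summands_def)
qed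

text \<open>
  If the row module is projective, it is a row \<open>e_a A\<close> with exponents 0. Its maximal graded
  submodule has exponent 1 at the positions equivalent to \<open>a\<close> and 0 elsewhere. By the Nakayama
  identity this is the truncation of \<open>e_\<nu>a A\<close> at \<open>d (\<nu> a) a - 1\<close>, and all truncations lie below it.
\<close>
theorem nonprojective_summands_maximum:
  "S = {} \<or> has_maximum S (summand_order n d I \<nu>)"
proof (cases "None \<in> S")
  case True
  then have "(s, None) \<in> summand_order n d I \<nu>" if "s \<in> S" for s
    using that summand_exp_nonneg by (simp add: summand_order_def)
  then show ?thesis using True by (auto simp: has_maximum_def)
next
  case False
  show ?thesis
  proof (rule disjCI)
    assume "\<not> has_maximum S (summand_order n d I \<nu>)"
    show "S = {}"
    proof (rule ccontr)
      assume "S \<noteq> {}"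
      then obtain s where s: "s \<in> S" by blast
      obtain b c where b: "b < n" "\<And>l. l < n \<Longrightarrow> 0 = d b l - c"
        using False by (auto simp: nonprojective_summands_def summand_index_iff)
      have c: "c = 0" using b(2)[OF b(1)] diag[OF b(1)] by simp
      obtain a' where a': "a' \<in> I" and ba: "\<And>l. l < n \<Longrightarrow> d b l = d (\<nu> a') l"
        using representative_row[OF b(1)] by blast
      define a where "a = \<nu> a'"
      have a: "a \<in> I" "a < n" using a' \<nu>_in \<nu>_less by (auto simp: a_def)
      have da: "d a l = 0" if "l < n" for l using b(2)[OF that] c ba[OF that] by (simp add: a_def)
      have da': "d l a' = 0" if "l < n" for l
        using nak[OF a' that] da[OF that] da[OF I_less[OF a']] by (simp add: a_def)
      have height: "d (\<nu> i) i = d a' i" "d (\<nu> i) i = d (\<nu> i) a" if "i \<in> I" for i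
        using nak[OF that I_less[OF a']] nak[OF that a(2)] da'[OF \<nu>_less[OF that]] da[OF I_less[OF that]]
        by auto
      \<comment> \<open>If any truncation exists, this bound ensures that the truncations of e_\<nu>a A exist as well.\<close>
      have height_le: "d (\<nu> i) i \<le> d (\<nu> a) a" if "i \<in> I" for i
        using triangle[OF I_less[OF a'] I_less[OF that] a(2)] da[OF I_less[OF that]]
          height(1)[OF that] height(1)[OF a(1)] by simp
      let ?m = "Some (a, d (\<nu> a) a - 1)"
      have below: "(\<exists>i j. t = Some (i, j) \<and> i \<in> I \<and> 1 \<le> j \<and> j \<le> d (\<nu> i) i - 1)" if "t \<in> S" for t
        using that False by (cases t) (auto simp: nonprojective_summands_def summand_index_iff)
      then have two: "2 \<le> d (\<nu> a) a" using height_le s by fastforce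
      have m: "?m \<in> S"
        using two a(1) by (intro truncation_nonprojective) (simp add: summand_index_iff)
      have "(t, ?m) \<in> summand_order n d I \<nu>" if t: "t \<in> S" for t
      proof -
        obtain i j where ij: "t = Some (i, j)" "i \<in> I" "1 \<le> j" "j \<le> d (\<nu> i) i - 1"
          using below[OF t] by blast
        have "summand_exp d \<nu> ?m l \<le> summand_exp d \<nu> t l" if l: "l < n" for l
        proof (cases "d l a = 0")
          case True
          then have "d (\<nu> i) i \<le> d (\<nu> i) l"
            using triangle[OF \<nu>_less[OF ij(2)] a(2) l] height(2)[OF ij(2)] by simp
          then show ?thesis using nak[OF a(1) l] True ij by simp
        next
          case False
          then have "1 \<le> d l a" using nonneg[OF l a(2)] by simp
          then show ?thesis using nak[OF a(1) l] summand_exp_nonneg[of t l] by simp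
        qed
        then show ?thesis using t m by (simp add: summand_order_def)
      qed
      then have "has_maximum S (summand_order n d I \<nu>)" using m by (auto simp: has_maximum_def)
      then show False using \<open>\<not> has_maximum S (summand_order n d I \<nu>)\<close> by contradiction
    qed
  qed
qed

end

section \<open>The canonical module\<close>

text \<open>
  An \<open>R\<close>-linear map from the order to \<open>R\<close> has the form \<open>\<phi> a = trace (F a)\<close> for a matrix \<open>F\<close> over
  \<open>K\<close> with \<open>F(i, l)\<close> in \<open>R x^-d(l, i)\<close>, and the action of the order on \<open>\<phi>\<close> is right multiplication
  on \<open>F\<close>. The additional factor \<open>x\<close> in the coordinates accounts for the shift by -1.
\<close>
lemma row_lattice_canonical_module:
  fixes n :: nat and d :: "nat \<Rightarrow> nat \<Rightarrow> int"
  assumes tiled: "tiled_exponents n d"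
  defines "H \<equiv> Hom_module poly_algebra (scalar_emb n)
      (tiled_order n d :: ('k::field, 'k laurent mat) graded_algebra)
      (shift (regular poly_algebra) (-1))"
  shows "row_lattice n d H {..<n}
     (\<lambda>\<phi> (i, l). Poly_Mapping.single (1 - d l i) 1 * \<phi> (entry_mat n (Poly_Mapping.single (d l i) 1) l i))
     (\<lambda>(i, l). 1 - d l i)"
proof -
  let ?A = "tiled_order n d :: ('k, 'k laurent mat) graded_algebra"
  define u where "u l i = entry_mat n (Poly_Mapping.single (d l i) (1::'k)) l i" for l i
  define \<kappa> where "\<kappa> \<phi> i l = Poly_Mapping.single (1 - d l i) 1 * \<phi> (u l i)"
    for \<phi> :: "'k laurent mat \<Rightarrow> 'k laurent" and i l
  define C where "C = {\<phi> \<in> carrier ?A \<rightarrow>\<^sub>E (poly_carrier :: 'k laurent set).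
      (\<forall>a\<in>carrier ?A. \<forall>b\<in>carrier ?A. \<phi> (a + b) = \<phi> a + \<phi> b) \<and>
      (\<forall>a\<in>carrier ?A. \<forall>p\<in>poly_carrier. \<phi> (a * scalar_emb n p) = \<phi> a * p)}"
  have H: "carrier H = C" "zero H = (\<lambda>b\<in>carrier ?A. 0)"
    "add H = (\<lambda>f g. \<lambda>b\<in>carrier ?A. f b + g b)"
    "ract H = (\<lambda>f a. \<lambda>b\<in>carrier ?A. f (a * b))"
    "gr H = (\<lambda>j. {f \<in> C. \<forall>m. f ` deg_part ?A m \<subseteq> poly_carrier \<inter> homog (m + j - 1)})"
    by (simp_all add: H_def Hom_module_def C_def module_hom_def Let_def shift_def regular_def
        right_ideal_def)
  have u: "u l i \<in> carrier ?A" for l i unfolding u_def by (rule entry_mat_closed) simp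
  have u_index: "u l i $$ (r, c) = (if r = l \<and> c = i then Poly_Mapping.single (d l i) 1 else 0)"
    if "r < n" "c < n" for l i r c
    using that by (simp add: u_def)
  note A_mult = tiled_order_mult_closed[OF tiled] and A_add = tiled_order_add_closed[OF tiled]
  have emb: "scalar_emb n p \<in> carrier ?A" if "p \<in> poly_carrier" for p
    by (rule scalar_emb_closed[OF tiled that])
  have times_emb: "(a * scalar_emb n p) $$ (r, c) = a $$ (r, c) * p"
    if "a \<in> carrier ?A" "p \<in> poly_carrier" "r < n" "c < n" for a p r c
  proof -
    have "(a * scalar_emb n p) $$ (r, c) = (\<Sum>l<n. if l = c then a $$ (r, c) * p else 0)"
      unfolding tiled_order_mult_index[OF that(1) emb[OF that(2)] that(3,4)]
      using that by (intro sum.cong) auto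
    then show ?thesis using that by simp
  qed
  have C_in: "\<phi> a \<in> poly_carrier" if "\<phi> \<in> C" "a \<in> carrier ?A" for \<phi> a
    using that by (auto simp: C_def)
  have C_add: "\<phi> (a + b) = \<phi> a + \<phi> b" if "\<phi> \<in> C" "a \<in> carrier ?A" "b \<in> carrier ?A" for \<phi> a b
    using that by (simp add: C_def)
  have C_emb: "\<phi> (a * scalar_emb n p) = \<phi> a * p"
    if "\<phi> \<in> C" "a \<in> carrier ?A" "p \<in> poly_carrier" for \<phi> a p
    using that by (simp add: C_def)
  have C_I: "(\<lambda>b\<in>carrier ?A. g b) \<in> C"
    if g_in: "\<And>a. a \<in> carrier ?A \<Longrightarrow> g a \<in> poly_carrier"
      and g_add: "\<And>a b. a \<in> carrier ?A \<Longrightarrow> b \<in> carrier ?A \<Longrightarrow> g (a + b) = g a + g b"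
      and g_emb: "\<And>a p. a \<in> carrier ?A \<Longrightarrow> p \<in> poly_carrier \<Longrightarrow> g (a * scalar_emb n p) = g a * p"
    for g
    unfolding C_def
    by (intro CollectI conjI ballI)
       (simp_all add: g_in g_add g_emb A_add A_mult emb del: index_mult_mat)
  have expansion: "\<phi> a = (\<Sum>i<n. \<Sum>l<n. Poly_Mapping.single (- 1) 1 * \<kappa> \<phi> i l * a $$ (l, i))"
    if \<phi>: "\<phi> \<in> C" and a: "a \<in> carrier ?A" for \<phi> a
  proof -
    \<comment> \<open>The formula is proved for the part of a supported on a set B of positions, by induction on B.\<close>
    define part where "part B = mat n n (\<lambda>x. if x \<in> B then a $$ x else 0)" for B
    have part: "part B \<in> carrier ?A" for B using a by (auto simp: part_def tiled_order_carrier)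
    have "\<phi> (part B) = (\<Sum>(l, i)\<in>B. Poly_Mapping.single (- 1) 1 * \<kappa> \<phi> i l * a $$ (l, i))"
      if "B \<subseteq> {..<n} \<times> {..<n}" for B
    proof -
      have "finite B" using that by (rule finite_subset) simp
      then show ?thesis using that
      proof (induction B rule: finite_induct)
        case empty
        have "part {} = part {} + part {}" by (rule eq_matI) (auto simp: part_def)
        then have "\<phi> (part {}) = \<phi> (part {}) + \<phi> (part {})"
          using C_add[OF \<phi> part part] by metis
        then have "\<phi> (part {}) + 0 = \<phi> (part {}) + \<phi> (part {})" by simp
        then have "\<phi> (part {}) = 0" by (simp only: add_left_cancel)
        then show ?case by simp
      next
        case (insert x B)
        obtain l i where x: "x = (l, i)" "l < n" "i < n" using insert.prems by (cases x) auto
        let ?p = "Poly_Mapping.single (- d l i) 1 * a $$ (l, i)"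
        have p: "?p \<in> poly_carrier"
          using monomial_mult_poly_times_x[of "a $$ (l, i)" "d l i" 0 "- d l i" 1] a x(2,3)
          by (simp add: tiled_order_carrier poly_times_x_0)
        have "part (insert x B) = part B + u l i * scalar_emb n ?p"
        proof (rule eq_matI)
          fix r c assume "r < dim_row (part B + u l i * scalar_emb n ?p)"
            "c < dim_col (part B + u l i * scalar_emb n ?p)"
          then have rc: "r < n" "c < n" by (auto simp: u_def)
          have "(u l i * scalar_emb n ?p) $$ (r, c) = (if r = l \<and> c = i then a $$ (l, i) else 0)"
            unfolding times_emb[OF u p rc] u_index[OF rc] by (simp add: monomial_mult_cancel)
          then show "part (insert x B) $$ (r, c) = (part B + u l i * scalar_emb n ?p) $$ (r, c)"
            using rc insert.hyps(2) x by (auto simp: part_def u_def simp del: index_mult_mat(1))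
        qed (auto simp: part_def u_def)
        then have "\<phi> (part (insert x B)) = \<phi> (part B) + \<phi> (u l i) * ?p"
          by (simp only: C_add[OF \<phi> part A_mult[OF u emb[OF p]]] C_emb[OF \<phi> u p])
        also have "\<phi> (u l i) * ?p = Poly_Mapping.single (- 1) 1 * \<kappa> \<phi> i l * a $$ (l, i)"
          unfolding \<kappa>_def by (simp add: mult.assoc[symmetric] mult_single mult.commute[of "\<phi> (u l i)"])
        finally show ?case using insert x by simp
      qed
    qed
    from this[of "{..<n} \<times> {..<n}"] have "\<phi> (part ({..<n} \<times> {..<n})) =
        (\<Sum>l<n. \<Sum>i<n. Poly_Mapping.single (- 1) 1 * \<kappa> \<phi> i l * a $$ (l, i))"
      by (simp add: sum.cartesian_product)
    also have "\<dots> = (\<Sum>i<n. \<Sum>l<n. Poly_Mapping.single (- 1) 1 * \<kappa> \<phi> i l * a $$ (l, i))"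
      by (rule sum.swap)
    finally have "\<phi> (part ({..<n} \<times> {..<n})) =
        (\<Sum>i<n. \<Sum>l<n. Poly_Mapping.single (- 1) 1 * \<kappa> \<phi> i l * a $$ (l, i))" .
    moreover have "part ({..<n} \<times> {..<n}) = a"
      using a by (intro eq_matI) (auto simp: part_def tiled_order_carrier)
    ultimately show ?thesis by simp
  qed
  have \<kappa>_in: "\<kappa> \<phi> i l \<in> poly_times_x (1 - d l i)" if "\<phi> \<in> C" for \<phi> i l
    unfolding \<kappa>_def using that u[of l i]
    by (intro monomial_mult_poly_times_x[of _ 0]) (auto simp: C_def poly_times_x_0)
  have add_C: "(\<lambda>b\<in>carrier ?A. \<phi> b + \<psi> b) \<in> C" if "\<phi> \<in> C" "\<psi> \<in> C" for \<phi> \<psi>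
    by (rule C_I) (simp_all add: C_in C_add C_emb that poly_carrier_closed distrib_right)
  have act_C: "(\<lambda>b\<in>carrier ?A. \<phi> (a * b)) \<in> C" if \<phi>: "\<phi> \<in> C" and a: "a \<in> carrier ?A" for \<phi> a
  proof (rule C_I)
    fix b assume b: "b \<in> carrier ?A"
    show "\<phi> (a * b) \<in> poly_carrier" by (rule C_in[OF \<phi> A_mult[OF a b]])
    show "\<phi> (a * (b + c)) = \<phi> (a * b) + \<phi> (a * c)" if c: "c \<in> carrier ?A" for c
    proof -
      have "a * (b + c) = a * b + a * c"
        using a b c by (intro mult_add_distrib_mat) (auto simp: tiled_order_carrier)
      then show ?thesis using C_add[OF \<phi> A_mult[OF a b] A_mult[OF a c]] by simp
    qed
    show "\<phi> (a * (b * scalar_emb n p)) = \<phi> (a * b) * p" if p: "p \<in> poly_carrier" for p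
    proof -
      have "a * (b * scalar_emb n p) = (a * b) * scalar_emb n p"
        using a b emb[OF p] by (intro assoc_mult_mat[symmetric]) (auto simp: tiled_order_carrier)
      then show ?thesis using C_emb[OF \<phi> A_mult[OF a b] p] by simp
    qed
  qed
  have act_u: "\<kappa> (\<lambda>b\<in>carrier ?A. \<phi> (a * b)) i l = (\<Sum>l'<n. \<kappa> \<phi> i l' * a $$ (l', l))"
    if \<phi>: "\<phi> \<in> C" and a: "a \<in> carrier ?A" and i: "i < n" and l: "l < n" for \<phi> a i l
  proof -
    have au: "(a * u l i) $$ (r, c) = (if c = i then Poly_Mapping.single (d l i) 1 * a $$ (r, l) else 0)"
      if "r < n" "c < n" for r c
    proof -
      have "(a * u l i) $$ (r, c)
          = (\<Sum>q<n. if q = l then if c = i then Poly_Mapping.single (d l i) 1 * a $$ (r, l) else 0 else 0)"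
        unfolding tiled_order_mult_index[OF a u that]
        using that by (intro sum.cong) (auto simp: u_index mult.commute)
      then show ?thesis using l by simp
    qed
    have "\<phi> (a * u l i) = (\<Sum>i'<n. \<Sum>l'<n. Poly_Mapping.single (- 1) 1 * \<kappa> \<phi> i' l' * (a * u l i) $$ (l', i'))"
      by (rule expansion[OF \<phi> A_mult[OF a u]])
    also have "\<dots> = (\<Sum>i'<n. if i' = i then (\<Sum>l'<n. Poly_Mapping.single (- 1) 1 * \<kappa> \<phi> i l'
        * (Poly_Mapping.single (d l i) 1 * a $$ (l', l))) else 0)"
      by (intro sum.cong) (auto simp: au)
    also have "\<dots> = (\<Sum>l'<n. Poly_Mapping.single (- 1) 1 * \<kappa> \<phi> i l'
        * (Poly_Mapping.single (d l i) 1 * a $$ (l', l)))" using i by simp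
    also have "\<dots> = Poly_Mapping.single (d l i - 1) 1 * (\<Sum>l'<n. \<kappa> \<phi> i l' * a $$ (l', l))"
    proof -
      have "Poly_Mapping.single (- 1) 1 * x * (Poly_Mapping.single (d l i) 1 * y)
          = Poly_Mapping.single (d l i - 1) (1::'k) * (x * y)" for x y
      proof -
        have "Poly_Mapping.single (- 1) 1 * x * (Poly_Mapping.single (d l i) 1 * y)
            = (Poly_Mapping.single (- 1) (1::'k) * Poly_Mapping.single (d l i) 1) * (x * y)"
          by (simp only: ac_simps)
        then show ?thesis by (simp add: mult_single)
      qed
      then show ?thesis by (simp only: sum_distrib_left)
    qed
    finally show ?thesis
      using u[of l i] by (simp add: \<kappa>_def[of "\<lambda>b\<in>carrier ?A. \<phi> (a * b)"] mult.assoc[symmetric] mult_single)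
  qed
  have "row_lattice n d H {..<n} (\<lambda>\<phi> (i, l). \<kappa> \<phi> i l) (\<lambda>(i, l). 1 - d l i)"
  proof (unfold_locales, goal_cases)
    case (2 \<phi> x)
    then show ?case using \<kappa>_in by (auto simp: H)
  next
    case (3 \<phi> \<psi>)
    then have C: "\<phi> \<in> C" "\<psi> \<in> C" by (simp_all add: H)
    have "\<kappa> \<phi> i l = \<kappa> \<psi> i l" if "i < n" "l < n" for i l using 3(3)[of "(i, l)"] that by simp
    then have "\<phi> a = \<psi> a" if "a \<in> carrier ?A" for a
      unfolding expansion[OF C(1) that] expansion[OF C(2) that] by simp
    then show ?case using C by (auto simp: C_def intro: PiE_ext)
  next
    case (4 F)
    define \<phi> where "\<phi> = (\<lambda>a\<in>carrier ?A.
        \<Sum>i<n. \<Sum>l<n. Poly_Mapping.single (- 1) 1 * F (i, l) * a $$ (l, i))"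
    have "(\<Sum>i<n. \<Sum>l<n. Poly_Mapping.single (- 1) 1 * F (i, l) * a $$ (l, i)) \<in> poly_carrier"
      if a: "a \<in> carrier ?A" for a
    proof -
      have "Poly_Mapping.single (- 1) 1 * F (i, l) * a $$ (l, i) \<in> poly_times_x 0"
        if il: "i < n" "l < n" for i l
      proof -
        have "Poly_Mapping.single (- 1) 1 * F (i, l) \<in> poly_times_x (- d l i)"
          using 4[of "(i, l)"] il by (intro monomial_mult_poly_times_x[of _ "1 - d l i"]) auto
        from poly_times_x_mult[OF this tiled_orderD(3)[OF a il(2,1)]] show ?thesis by simp
      qed
      then show ?thesis unfolding poly_times_x_0[symmetric] by (intro poly_times_x_sum) auto
    qed
    then have \<phi>: "\<phi> \<in> C"
      unfolding \<phi>_def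
    proof (rule C_I)
      fix a p assume a: "a \<in> carrier ?A" and p: "p \<in> (poly_carrier :: 'k laurent set)"
      show "(\<Sum>i<n. \<Sum>l<n. Poly_Mapping.single (- 1) 1 * F (i, l) * (a * scalar_emb n p) $$ (l, i))
          = (\<Sum>i<n. \<Sum>l<n. Poly_Mapping.single (- 1) 1 * F (i, l) * a $$ (l, i)) * p"
        by (simp add: times_emb[OF a p] sum_distrib_right mult.assoc del: index_mult_mat)
    next
      fix a b assume "a \<in> carrier ?A" "b \<in> carrier ?A"
      then show "(\<Sum>i<n. \<Sum>l<n. Poly_Mapping.single (- 1) 1 * F (i, l) * (a + b) $$ (l, i))
          = (\<Sum>i<n. \<Sum>l<n. Poly_Mapping.single (- 1) 1 * F (i, l) * a $$ (l, i))
          + (\<Sum>i<n. \<Sum>l<n. Poly_Mapping.single (- 1) 1 * F (i, l) * b $$ (l, i))"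
        by (simp add: tiled_orderD distrib_left sum.distrib)
    qed
    have "\<kappa> \<phi> i l = F (i, l)" if "i < n" "l < n" for i l
    proof -
      have "\<phi> (u l i) = (\<Sum>i'<n. \<Sum>l'<n. Poly_Mapping.single (- 1) 1 * F (i', l') * u l i $$ (l', i'))"
        using u[of l i] by (simp add: \<phi>_def)
      also have "\<dots> = (\<Sum>i'<n. \<Sum>l'<n. if l' = l then if i' = i then
          Poly_Mapping.single (- 1) 1 * F (i, l) * Poly_Mapping.single (d l i) 1 else 0 else 0)"
        by (intro sum.cong refl) (auto simp: u_index)
      also have "\<dots> = Poly_Mapping.single (- 1) 1 * F (i, l) * Poly_Mapping.single (d l i) 1"
        using that by simp
      also have "\<dots> = (Poly_Mapping.single (- 1) 1 * Poly_Mapping.single (d l i) 1) * F (i, l)"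
        by (simp only: ac_simps)
      finally show ?thesis by (simp add: \<kappa>_def mult.assoc[symmetric] mult_single)
    qed
    then show ?case using \<phi> by (intro bexI[of _ \<phi>]) (auto simp: H)
  next
    case 5
    show ?case unfolding H by (rule C_I) (simp_all add: poly_carrier_closed)
  next
    case (6 x)
    show ?case using u by (auto simp: H \<kappa>_def split: prod.splits)
  next
    case (7 \<phi> \<psi>)
    then show ?case using add_C by (simp add: H)
  next
    case (8 \<phi> \<psi> x)
    then show ?case using u by (auto simp: H \<kappa>_def distrib_left split: prod.splits)
  next
    case (9 m)
    have "\<kappa> \<phi> i l \<in> homog m"
      if "\<phi> \<in> C" "\<forall>q. \<phi> ` deg_part ?A q \<subseteq> poly_carrier \<inter> homog (q + m - 1)" "i < n" "l < n" for \<phi> i l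
    proof -
      have "u l i \<in> deg_part ?A (d l i)" using u[of l i] by (auto simp: tiled_order_deg u_index)
      then have "\<phi> (u l i) \<in> homog (d l i + m - 1)" using that(2) by blast
      then show ?thesis unfolding \<kappa>_def by (rule monomial_mult_homog) simp
    qed
    moreover have "\<phi> a \<in> poly_carrier \<inter> homog (q + m - 1)"
      if \<phi>: "\<phi> \<in> C" and k: "\<forall>i<n. \<forall>l<n. \<kappa> \<phi> i l \<in> homog m" and a: "a \<in> deg_part ?A q" for \<phi> a q
    proof -
      have aA: "a \<in> carrier ?A" using a by (simp add: tiled_order_deg)
      have "Poly_Mapping.single (- 1) 1 * \<kappa> \<phi> i l * a $$ (l, i) \<in> homog (q + m - 1)"
        if "i < n" "l < n" for i l
      proof -
        have "Poly_Mapping.single (- 1) 1 * \<kappa> \<phi> i l \<in> homog (m - 1)"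
          using k that by (intro monomial_mult_homog[of _ m]) auto
        moreover have "a $$ (l, i) \<in> homog q" using a that by (simp add: tiled_order_deg)
        ultimately have "Poly_Mapping.single (- 1) 1 * \<kappa> \<phi> i l * a $$ (l, i) \<in> homog (m - 1 + q)"
          by (rule homog_mult)
        then show ?thesis by (simp add: algebra_simps)
      qed
      then have "\<phi> a \<in> homog (q + m - 1)"
        unfolding expansion[OF \<phi> aA] by (intro homog_sum) auto
      then show ?thesis using C_in[OF \<phi> aA] by blast
    qed
    ultimately show ?case unfolding H by auto
  next
    case (12 \<phi> a)
    then show ?case using act_C by (simp add: H)
  next
    case (13 \<phi> a i l)
    then show ?case using act_u[of \<phi> a i l] by (simp add: H)
  qed (use tiled in auto)
  then show ?thesis unfolding \<kappa>_def u_def .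
qed

text \<open>
  Row \<open>i\<close> of the canonical module has exponents \<open>1 - d l i\<close>, which by the assumption are those of
  \<open>e_b A\<close> up to a constant.
\<close>
lemma gorensteinI:
  assumes tiled: "tiled_exponents n d"
    and nak: "\<And>i. i < n \<Longrightarrow> \<exists>b<n. \<forall>j<n. d b j + d j i = d b i"
  shows "gorenstein TYPE('k::field) n d"
proof -
  have "\<exists>b<n. \<exists>c. \<forall>l<n. (case (i, l) of (i, l) \<Rightarrow> 1 - d l i) = d b l - c" if i: "i \<in> {..<n}" for i
  proof -
    obtain b where b: "b < n" "\<And>j. j < n \<Longrightarrow> d b j + d j i = d b i" using nak[of i] i by blast
    then have "\<forall>l<n. (case (i, l) of (i, l) \<Rightarrow> 1 - d l i) = d b l - (d b i - 1)" by force
    with b(1) show ?thesis by blast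
  qed
  from row_lattice.graded_projectiveI[OF row_lattice_canonical_module[OF tiled], OF this]
  show ?thesis unfolding gorenstein_def Let_def .
qed

section \<open>Basic tiled orders\<close>

lemma complete_reps_representative:
  assumes tiled: "tiled_exponents n d" and reps: "complete_reps TYPE('k::field) n d I" and i: "i < n"
  shows "\<exists>j\<in>I. d i j + d j i = 0"
  using assms row_proj_isomorphic_exponents[OF tiled i, where 'k = 'k]
  unfolding complete_reps_def by blast

lemma complete_reps_basic:
  assumes tiled: "tiled_exponents n d" and reps: "complete_reps TYPE('k::field) n d I"
    and basic: "\<And>i j. i < n \<Longrightarrow> j < n \<Longrightarrow> d i j + d j i = 0 \<Longrightarrow> i = j"
  shows "I = {..<n}"
proof
  show I: "I \<subseteq> {..<n}" using reps by (simp add: complete_reps_def)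
  show "{..<n} \<subseteq> I"
  proof
    fix i assume i: "i \<in> {..<n}"
    then obtain j where "j \<in> I" "d i j + d j i = 0"
      using complete_reps_representative[OF tiled reps, of i] by auto
    then show "i \<in> I" using basic[of i j] i I by auto
  qed
qed

section \<open>Doubling a poset\<close>

text \<open>
  \<open>le\<close> is a partial order on the numbers below \<open>N\<close>. The order \<open>D\<close> of size \<open>2 N\<close> has the indices \<open>p\<close>
  and \<open>p + N\<close> for the two copies of the point \<open>p\<close>, and \<open>h\<close> and \<open>k\<close> are the values of \<open>d(\<nu>i, i)\<close> on
  the first and on the second copy. The last two assumptions say that the numbers \<open>\<delta>(p, q)\<close> are at most
  \<open>k\<close> and less than \<open>h\<close>; this keeps the exponents between the copies nonnegative and the two
  copies inequivalent.
\<close>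
locale doubling =
  fixes N :: nat and le :: "nat \<Rightarrow> nat \<Rightarrow> bool" and h k :: int
  assumes N: "0 < N"
    and le_refl: "\<And>p. p < N \<Longrightarrow> le p p"
    and le_trans: "\<And>p q s. p < N \<Longrightarrow> q < N \<Longrightarrow> s < N \<Longrightarrow> le p q \<Longrightarrow> le q s \<Longrightarrow> le p s"
    and le_antisym: "\<And>p q. p < N \<Longrightarrow> q < N \<Longrightarrow> le p q \<Longrightarrow> le q p \<Longrightarrow> p = q"
    and hk: "1 \<le> h" "0 \<le> k"
    and hk': "\<And>p q. p < N \<Longrightarrow> q < N \<Longrightarrow> \<not> le p q \<Longrightarrow> 2 \<le> h \<and> 1 \<le> k"
begin

definition \<delta> :: "nat \<Rightarrow> nat \<Rightarrow> int" where
  "\<delta> p q = (if le p q then 0 else 1)"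

definition D :: "nat \<Rightarrow> nat \<Rightarrow> int" where
  "D i j = (if i < N then if j < N then \<delta> i j else k - \<delta> (j - N) i
            else if j < N then h - \<delta> j (i - N) else \<delta> (i - N) (j - N))"

definition swap :: "nat \<Rightarrow> nat" where
  "swap i = (if i < N then i + N else i - N)"

lemma \<delta>_bounds:
  assumes "p < N" "q < N"
  shows "0 \<le> \<delta> p q" "\<delta> p q \<le> 1" "\<delta> p q \<le> k" "\<delta> p q + 1 \<le> h"
  using hk hk'[OF assms] by (auto simp: \<delta>_def)

lemma \<delta>_triangle: "p < N \<Longrightarrow> q < N \<Longrightarrow> s < N \<Longrightarrow> \<delta> p s \<le> \<delta> p q + \<delta> q s"
  using le_trans[of p q s] by (auto simp: \<delta>_def)

lemma \<delta>_refl: "p < N \<Longrightarrow> \<delta> p p = 0"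
  using le_refl by (simp add: \<delta>_def)

lemma D_simps:
  "p < N \<Longrightarrow> q < N \<Longrightarrow> D p q = \<delta> p q"
  "p < N \<Longrightarrow> D p (q + N) = k - \<delta> q p"
  "q < N \<Longrightarrow> D (p + N) q = h - \<delta> q p"
  "D (p + N) (q + N) = \<delta> p q"
  by (auto simp: D_def)

lemma index_cases:
  assumes "i < 2 * N"
  obtains p where "p < N" "i = p \<or> i = p + N"
proof (cases "i < N")
  case False
  then have "i - N < N" "i = (i - N) + N" using assms by auto
  then show ?thesis using that by blast
qed (use that in blast)

lemma tiled: "tiled_exponents (2 * N) D"
  unfolding tiled_exponents_def
proof (intro conjI allI impI)
  fix i j l assume "i < 2 * N" "j < 2 * N" "l < 2 * N"
  then obtain p q s where pqs: "p < N" "q < N" "s < N"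
    and cases: "i = p \<or> i = p + N" "j = q \<or> j = q + N" "l = s \<or> l = s + N"
    by (metis index_cases)
  note bounds = \<delta>_bounds[OF pqs(1,2)] \<delta>_bounds[OF pqs(1,3)] \<delta>_bounds[OF pqs(2,1)]
    \<delta>_bounds[OF pqs(2,3)] \<delta>_bounds[OF pqs(3,1)] \<delta>_bounds[OF pqs(3,2)]
  note tri = \<delta>_triangle[OF pqs(1,3,2)] \<delta>_triangle[OF pqs(2,3,1)] \<delta>_triangle[OF pqs(3,1,2)]
    \<delta>_triangle[OF pqs(2,1,3)] \<delta>_triangle[OF pqs(1,2,3)] \<delta>_triangle[OF pqs(3,2,1)]
  show "D i j \<le> D i l + D l j"
    using cases by (elim disjE; simp only: D_simps pqs; use bounds tri in linarith)
next
  fix i assume "i < 2 * N"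
  then obtain p where "p < N" "i = p \<or> i = p + N" by (rule index_cases)
  then show "D i i = 0" by (auto simp: D_simps \<delta>_refl)
qed (use N in simp)

lemma nonneg:
  assumes "i < 2 * N" "j < 2 * N"
  shows "0 \<le> D i j"
proof -
  obtain p q where pq: "p < N" "q < N" and cases: "i = p \<or> i = p + N" "j = q \<or> j = q + N"
    using assms by (metis index_cases)
  show ?thesis
    using cases by (elim disjE; simp only: D_simps pq;
        use \<delta>_bounds[OF pq] \<delta>_bounds[OF pq(2,1)] in linarith)
qed

lemma basic:
  assumes "i < 2 * N" "j < 2 * N" "D i j + D j i = 0"
  shows "i = j"
proof -
  obtain p q where pq: "p < N" "q < N" and cases: "i = p \<or> i = p + N" "j = q \<or> j = q + N"
    using assms(1,2) by (metis index_cases)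
  have eq: "p = q" if "\<delta> p q + \<delta> q p = 0"
    using that le_antisym[OF pq] by (auto simp: \<delta>_def split: if_splits)
  show ?thesis
    using cases
  proof (elim disjE)
    assume "i = p" "j = q + N"
    then have False using assms(3) \<delta>_bounds[OF pq] \<delta>_bounds[OF pq(2,1)] by (simp add: D_simps pq)
    then show ?thesis ..
  next
    assume "i = p + N" "j = q"
    then have False using assms(3) \<delta>_bounds[OF pq] \<delta>_bounds[OF pq(2,1)] by (simp add: D_simps pq)
    then show ?thesis ..
  qed (use eq assms(3) pq in \<open>auto simp: D_simps\<close>)
qed

lemma swap: "bij_betw swap {..<2 * N} {..<2 * N}"
  by (rule bij_betwI[where g = swap]) (auto simp: swap_def)

lemma nakayama_swap: "nakayama (2 * N) D {..<2 * N} swap"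
  unfolding nakayama_def
proof (intro conjI swap ballI allI impI)
  fix i j assume "i \<in> {..<2 * N}" and j: "j < 2 * N"
  then have "i < 2 * N" by simp
  with j obtain p q where pq: "p < N" "q < N" and cases: "i = p \<or> i = p + N" "j = q \<or> j = q + N"
    by (metis index_cases)
  show "D (swap i) j + D j i = D (swap i) i"
    using cases pq by (elim disjE) (simp_all add: swap_def D_simps \<delta>_refl)
qed

lemma doubled_nakayama_order: "nakayama_order (2 * N) D {..<2 * N} swap"
proof
  fix i assume "i < 2 * N"
  then have "D i i + D i i = 0" using tiled by (simp add: tiled_exponents_def)
  then show "\<exists>j\<in>{..<2 * N}. D i j + D j i = 0" using \<open>i < 2 * N\<close> by blast
qed (auto simp: tiled nonneg nakayama_swap)

sublocale nakayama_order "2 * N" D "{..<2 * N}" swap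
  by (rule doubled_nakayama_order)

lemma height: "p < N \<Longrightarrow> D (swap p) p = h" "p < N \<Longrightarrow> D (swap (p + N)) (p + N) = k"
  by (simp_all add: swap_def D_simps \<delta>_refl)

text \<open>
  A row with constant exponents would have \<open>D b (swap b) = 0\<close>, but this entry is \<open>h\<close> or \<open>k\<close>.
\<close>
lemma row_module_nonprojective:
  assumes "1 \<le> k"
  shows "None \<in> S"
proof -
  have False if b: "b < 2 * N" and proj: "\<And>l. l < 2 * N \<Longrightarrow> 0 = D b l - c" for b c
  proof -
    obtain p where p: "p < N" "b = p \<or> b = p + N" using index_cases[OF b] by blast
    have "D b b = 0" by (rule diag[OF b])
    moreover have "D b p = 0" "D b (p + N) = 0"
      using proj[of b] proj[of p] proj[of "p + N"] b p(1) \<open>D b b = 0\<close> by simp_all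
    ultimately show False using p hk(1) assms by (auto simp: D_simps \<delta>_refl)
  qed
  then show ?thesis by (auto simp: nonprojective_summands_def summand_index_iff)
qed

lemma summand_index_eq:
  "summand_index D {..<2 * N} swap
     = insert None (Some ` ({..<N} \<times> {1..h - 1} \<union> (\<lambda>p. p + N) ` {..<N} \<times> {1..k - 1}))"
proof (rule Set.set_eqI)
  fix s
  show "s \<in> summand_index D {..<2 * N} swap \<longleftrightarrow>
      s \<in> insert None (Some ` ({..<N} \<times> {1..h - 1} \<union> (\<lambda>p. p + N) ` {..<N} \<times> {1..k - 1}))"
  proof (cases s)
    case (Some x)
    obtain i j where x: "x = (i, j)" by (cases x)
    show ?thesis
    proof (cases "i < 2 * N")
      case True
      then obtain p where "p < N" "i = p \<or> i = p + N" by (rule index_cases)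
      then show ?thesis by (auto simp: Some x summand_index_iff height image_iff)
    qed (auto simp: Some x summand_index_iff)
  qed (simp add: summand_index_iff)
qed

lemma nonprojective_summands_empty:
  assumes "N = 1" "h = 1" "k = 0"
  shows "S = {}"
proof -
  have "k \<le> 0" "h \<le> 1" using assms by auto
  have "D 0 l = 0" if "l < 2 * N" for l
  proof -
    have "l = 0 \<or> l = 0 + N" using that assms(1) by auto
    then show ?thesis
      using D_simps(1)[OF N N] D_simps(2)[OF N, of 0] \<delta>_refl[OF N] hk(2) \<open>k \<le> 0\<close> by auto
  qed
  then have "\<exists>b<2 * N. \<exists>c. \<forall>l<2 * N. summand_exp D swap None l = D b l - c"
    unfolding summand_exp_simps using N by (intro exI[of _ 0] conjI allI impI) simp_all
  then have "None \<notin> S" unfolding nonprojective_summands_def by blast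
  have "{1..h - 1} = {}" "{1..k - 1} = {}" using \<open>k \<le> 0\<close> \<open>h \<le> 1\<close> by auto
  then have "summand_index D {..<2 * N} swap = {None}"
    unfolding summand_index_eq by simp
  then have "S \<subseteq> {None}" unfolding nonprojective_summands_def by blast
  with \<open>None \<notin> S\<close> show ?thesis by blast
qed

lemma nonprojective_summands_singleton:
  assumes "h = 1" "k = 1"
  shows "S = {None}"
proof -
  have "1 \<le> k" "k \<le> 1" "h \<le> 1" using assms by auto
  then have "summand_index D {..<2 * N} swap = {None}" unfolding summand_index_eq by auto
  then show ?thesis
    using row_module_nonprojective[OF \<open>1 \<le> k\<close>] by (auto simp: nonprojective_summands_def)
qed

lemma nonprojective_summands_eq:
  assumes "h = 2" "k = 1"
  shows "S = insert None ((\<lambda>p. Some (p, 1)) ` {..<N})"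
proof -
  have hk_le: "1 \<le> k" "k \<le> 1" and "{1..h - 1} = {1}" "{1..k - 1} = {}" using assms by auto
  then have "summand_index D {..<2 * N} swap = insert None ((\<lambda>p. Some (p, 1)) ` {..<N})"
    unfolding summand_index_eq by auto
  then show ?thesis
    using row_module_nonprojective[OF hk_le(1)] truncation_nonprojective
    by (auto simp: nonprojective_summands_def)
qed

text \<open>
  The truncation of the point \<open>p\<close> has exponent 1 at the positions \<open>s\<close> in the first copy with
  \<open>le s p\<close> and exponent 0 elsewhere. Inclusion of these rows is reverse inclusion of the sets of
  points below, which explains the change of direction.
\<close>
lemma summand_order_iff:
  assumes hk_eq: "h = 2" "k = 1" and p: "p < N"
  shows "(s, None) \<in> summand_order (2 * N) D {..<2 * N} swap \<longleftrightarrow> s \<in> S"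
    and "(None, Some (p, 1)) \<notin> summand_order (2 * N) D {..<2 * N} swap"
    and "q < N \<Longrightarrow>
      (Some (p, 1), Some (q, 1)) \<in> summand_order (2 * N) D {..<2 * N} swap \<longleftrightarrow> le q p"
proof -
  have in_S: "None \<in> S" "Some (q, 1) \<in> S" if "q < N" for q
    unfolding nonprojective_summands_eq[OF hk_eq] using that by auto
  have exp_low: "summand_exp D swap (Some (q, 1)) s = (if le s q then 1 else 0)"
    and exp_high: "summand_exp D swap (Some (q, 1)) (s + N) = 0" if "q < N" "s < N" for q s
  proof -
    have "D (swap q) s = h - \<delta> s q" "D (swap q) (s + N) = \<delta> q s"
      using that by (simp_all add: swap_def D_simps)
    then have "D (swap q) s - 1 = 1 - \<delta> s q" "D (swap q) (s + N) - 1 = \<delta> q s - 1"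
      using hk_eq(1) by linarith+
    then show "summand_exp D swap (Some (q, 1)) s = (if le s q then 1 else 0)"
      "summand_exp D swap (Some (q, 1)) (s + N) = 0"
      by (simp_all only: summand_exp_simps) (simp_all add: \<delta>_def)
  qed
  show "(s, None) \<in> summand_order (2 * N) D {..<2 * N} swap \<longleftrightarrow> s \<in> S"
    using in_S(1)[OF p] summand_exp_nonneg by (auto simp: summand_order_def)
  have "\<not> summand_exp D swap (Some (p, 1)) p \<le> summand_exp D swap None p"
    unfolding exp_low[OF p p] using le_refl[OF p] by simp
  then show "(None, Some (p, 1)) \<notin> summand_order (2 * N) D {..<2 * N} swap"
    using trans_less_add1[OF p, of N] unfolding summand_order_def mult_2 by blast
  assume q: "q < N"
  show "(Some (p, 1), Some (q, 1)) \<in> summand_order (2 * N) D {..<2 * N} swap \<longleftrightarrow> le q p"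
  proof
    assume "(Some (p, 1), Some (q, 1)) \<in> summand_order (2 * N) D {..<2 * N} swap"
    then have "\<forall>l<2 * N. summand_exp D swap (Some (q, 1)) l \<le> summand_exp D swap (Some (p, 1)) l"
      unfolding summand_order_def by blast
    then have "summand_exp D swap (Some (q, 1)) q \<le> summand_exp D swap (Some (p, 1)) q"
      using q by (simp del: summand_exp_simps)
    then show "le q p"
      unfolding exp_low[OF q q] exp_low[OF p q] using le_refl[OF q] by (auto split: if_splits)
  next
    assume qp: "le q p"
    have "summand_exp D swap (Some (q, 1)) l \<le> summand_exp D swap (Some (p, 1)) l" if "l < 2 * N" for l
    proof -
      obtain s where s: "s < N" "l = s \<or> l = s + N" using index_cases[OF \<open>l < 2 * N\<close>] by blast
      from s(2) show ?thesis
      proof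
        assume "l = s"
        then show ?thesis
          unfolding \<open>l = s\<close> exp_low[OF p s(1)] exp_low[OF q s(1)]
          using le_trans[OF s(1) q p _ qp] by auto
      next
        assume "l = s + N"
        then show ?thesis by (simp only: exp_high p q s(1))
      qed
    qed
    then show "(Some (p, 1), Some (q, 1)) \<in> summand_order (2 * N) D {..<2 * N} swap"
      using in_S(2)[OF p] in_S(2)[OF q] unfolding summand_order_def by blast
  qed
qed

lemma doubled_order_realises:
  fixes I :: "nat \<Rightarrow> (nat \<Rightarrow> nat \<Rightarrow> int) \<Rightarrow> nat set"
  assumes reps: "complete_reps TYPE('k::field) (2 * N) D (I (2 * N) D)"
    and iso: "algebra_isomorphic
        (incidence_algebra S (summand_order (2 * N) D {..<2 * N} swap)) C"
  shows "\<exists>n d \<nu>. tiled_exponents n d \<and>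
            nonneg_graded (tiled_order n d :: ('k, 'k laurent mat) graded_algebra) \<and>
            gorenstein TYPE('k) n d \<and>
            nakayama n d (I n d) \<nu> \<and>
            algebra_isomorphic (Gamma_algebra n d (I n d) \<nu> :: ('k, _) module) C"
proof (intro exI conjI)
  have I: "I (2 * N) D = {..<2 * N}"
    by (rule complete_reps_basic[OF tiled reps]) (rule basic)
  show "nakayama (2 * N) D (I (2 * N) D) swap" unfolding I by (rule nakayama_swap)
  show "algebra_isomorphic (Gamma_algebra (2 * N) D (I (2 * N) D) swap :: ('k, _) module) C"
    unfolding I by (rule algebra_isomorphic_trans[OF Gamma_incidence(1) iso])
  have "\<exists>b<2 * N. \<forall>j<2 * N. D b j + D j i = D b i" if "i < 2 * N" for i
    using nak[of i] \<nu>_less[of i] that by (intro exI[of _ "swap i"]) auto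
  then show "gorenstein TYPE('k) (2 * N) D" by (rule gorensteinI[OF tiled])
qed (auto simp: tiled nonneg nonneg_graded_iff)

end

lemma complete_reps_nakayama_order:
  assumes "tiled_exponents n d" "nonneg_graded (tiled_order n d :: ('k::field, 'k laurent mat) graded_algebra)"
    and "complete_reps TYPE('k) n d I" "nakayama n d I \<nu>"
  shows "nakayama_order n d I \<nu>"
  using assms complete_reps_representative[OF assms(1,3)]
  by unfold_locales (auto simp: nonneg_graded_iff complete_reps_def)

theorem theoremB:
  fixes P :: "'p set" and r :: "'p rel"
    and I :: "nat \<Rightarrow> (nat \<Rightarrow> nat \<Rightarrow> int) \<Rightarrow> nat set"
  assumes "finite P" and "partial_order_on P r"
    and "\<And>n d. tiled_exponents n d \<Longrightarrow> complete_reps TYPE('k::field) n d (I n d)"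
  shows "(\<exists>n d \<nu>. tiled_exponents n d \<and>
            nonneg_graded (tiled_order n d :: ('k, 'k laurent mat) graded_algebra) \<and>
            gorenstein TYPE('k) n d \<and>
            nakayama n d (I n d) \<nu> \<and>
            algebra_isomorphic
              (Gamma_algebra n d (I n d) \<nu> :: ('k, _) module)
              (incidence_algebra P r :: ('k, _) module))
         \<longleftrightarrow> P = {} \<or> has_maximum P r"
proof
  assume "\<exists>n d \<nu>. tiled_exponents n d \<and>
            nonneg_graded (tiled_order n d :: ('k, 'k laurent mat) graded_algebra) \<and>
            gorenstein TYPE('k) n d \<and>
            nakayama n d (I n d) \<nu> \<and>
            algebra_isomorphic
              (Gamma_algebra n d (I n d) \<nu> :: ('k, _) module)
              (incidence_algebra P r :: ('k, _) module)"
  then obtain n d \<nu> where tiled: "tiled_exponents n d"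
    and nonneg: "nonneg_graded (tiled_order n d :: ('k, 'k laurent mat) graded_algebra)"
    and nak: "nakayama n d (I n d) \<nu>"
    and iso: "algebra_isomorphic (Gamma_algebra n d (I n d) \<nu> :: ('k, _) module) (incidence_algebra P r)"
    by blast
  interpret nakayama_order n d "I n d" \<nu>
    by (rule complete_reps_nakayama_order[OF tiled nonneg assms(3)[OF tiled] nak])
  show "P = {} \<or> has_maximum P r"
    by (rule maximum_of_incidence_isomorphic[OF assms(1,2) finite_summands _
          nonprojective_summands_maximum algebra_isomorphic_trans[OF Gamma_incidence(2) iso]])
       (auto simp: summand_order_def)
next
  have r: "r \<subseteq> P \<times> P" "\<And>x. x \<in> P \<Longrightarrow> (x, x) \<in> r" "antisym r" "trans r"
    using assms(2) by (auto simp: partial_order_on_def preorder_on_def refl_on_def)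
  assume "P = {} \<or> has_maximum P r"
  then consider "P = {}" | m where "P = {m}"
    | m where "m \<in> P" "\<And>x. x \<in> P \<Longrightarrow> (x, m) \<in> r" "P - {m} \<noteq> {}"
    unfolding has_maximum_def by blast
  then show "\<exists>n d \<nu>. tiled_exponents n d \<and>
            nonneg_graded (tiled_order n d :: ('k, 'k laurent mat) graded_algebra) \<and>
            gorenstein TYPE('k) n d \<and>
            nakayama n d (I n d) \<nu> \<and>
            algebra_isomorphic
              (Gamma_algebra n d (I n d) \<nu> :: ('k, _) module)
              (incidence_algebra P r :: ('k, _) module)"
  proof cases
    case 1
    \<comment> \<open>With k = 0 the row module is projective, and no truncation exists.\<close>
    obtain N :: nat where N1: "N = 1" by blast
    interpret doubling N "\<lambda>_ _. True" 1 0 by unfold_locales (auto simp: N1)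
    have "S = {}" by (rule nonprojective_summands_empty) (simp_all add: N1)
    then have "algebra_isomorphic (incidence_algebra S (summand_order (2 * N) D {..<2 * N} swap)
        :: ('k, _) module) (incidence_algebra P r)"
      using 1 r(1)
      by (intro incidence_algebra_relabel[where \<gamma> = undefined]) (auto simp: summand_order_def bij_betw_def)
    then show ?thesis by (rule doubled_order_realises[where I = I, OF assms(3)[OF tiled]])
  next
    case (2 m)
    \<comment> \<open>With k = 1 the row module is not projective, and no truncation exists.\<close>
    obtain N :: nat where N1: "N = 1" by blast
    interpret doubling N "\<lambda>_ _. True" 1 1 by unfold_locales (auto simp: N1)
    have "S = {None}" by (rule nonprojective_summands_singleton) simp_all
    then have "algebra_isomorphic (incidence_algebra S (summand_order (2 * N) D {..<2 * N} swap)
        :: ('k, _) module) (incidence_algebra P r)"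
      using 2 r(1,2)
      by (intro incidence_algebra_relabel[where \<gamma> = "\<lambda>_. None"]) (auto simp: summand_order_def bij_betw_def)
    then show ?thesis by (rule doubled_order_realises[where I = I, OF assms(3)[OF tiled]])
  next
    case (3 m)
    have "\<exists>\<beta>. bij_betw \<beta> {..<card (P - {m})} (P - {m})"
      using ex_bij_betw_nat_finite[of "P - {m}"] assms(1) by (simp add: atLeast0LessThan)
    then obtain N :: nat and \<beta> where \<beta>: "bij_betw \<beta> {..<N} (P - {m})" by blast
    have \<beta>_in: "\<beta> p \<in> P" "\<beta> p \<noteq> m" if "p < N" for p using \<beta> that by (auto simp: bij_betw_def)
    \<comment> \<open>The opposite of the given order is doubled, since the order of the truncations is opposite to le.\<close>
    interpret doubling N "\<lambda>p q. (\<beta> q, \<beta> p) \<in> r" 2 1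
    proof
      show "0 < N" using 3(3) \<beta> by (auto simp: bij_betw_def)
      show "p = q" if "p < N" "q < N" "(\<beta> q, \<beta> p) \<in> r" "(\<beta> p, \<beta> q) \<in> r" for p q
        using that r(3) \<beta> by (auto simp: antisym_def bij_betw_def inj_on_def)
    qed (use r \<beta>_in in \<open>auto intro: transD[OF r(4)]\<close>)
    have S: "S = insert None ((\<lambda>p. Some (p, 1)) ` {..<N})"
      by (rule nonprojective_summands_eq) simp_all
    define \<gamma> where "\<gamma> x = (if x = m then None else Some (inv_into {..<N} \<beta> x, 1 :: int))" for x
    have inv: "inv_into {..<N} \<beta> x < N" "\<beta> (inv_into {..<N} \<beta> x) = x" if "x \<in> P" "x \<noteq> m" for x
      using \<beta> that bij_betw_inv_into_right[OF \<beta>, of x] inv_into_into[of x \<beta> "{..<N}"]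
      by (auto simp: bij_betw_def)
    have inv_\<beta>: "inv_into {..<N} \<beta> (\<beta> p) = p" if "p < N" for p
      using \<beta> that by (simp add: bij_betw_def)
    have bij: "bij_betw \<gamma> P S"
    proof (rule bij_betwI[where g = "\<lambda>s. case s of None \<Rightarrow> m | Some (p, j) \<Rightarrow> \<beta> p"])
      show "\<gamma> \<in> P \<rightarrow> S" using inv by (auto simp: \<gamma>_def S)
      show "(\<lambda>s. case s of None \<Rightarrow> m | Some (p, j) \<Rightarrow> \<beta> p) \<in> S \<rightarrow> P"
        using \<beta>_in 3(1) by (auto simp: S)
      show "(case \<gamma> x of None \<Rightarrow> m | Some (p, j) \<Rightarrow> \<beta> p) = x" if "x \<in> P" for x
        using that inv by (simp add: \<gamma>_def)
      show "\<gamma> (case s of None \<Rightarrow> m | Some (p, j) \<Rightarrow> \<beta> p) = s" if "s \<in> S" for s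
        using that \<beta>_in inv_\<beta> by (auto simp: \<gamma>_def S)
    qed
    have mono: "(x, y) \<in> r \<longleftrightarrow> (\<gamma> x, \<gamma> y) \<in> summand_order (2 * N) D {..<2 * N} swap"
      if xy: "x \<in> P" "y \<in> P" for x y
    proof (cases "y = m")
      case True
      then have "\<gamma> y = None" by (simp add: \<gamma>_def)
      moreover have "\<gamma> x \<in> S" using bij xy by (auto simp: bij_betw_def)
      ultimately show ?thesis
        using 3(2)[OF xy(1)] True summand_order_iff(1)[OF refl refl N] by simp
    next
      case y: False
      note \<gamma>y = inv[OF xy(2) y]
      show ?thesis
      proof (cases "x = m")
        case True
        then have "(x, y) \<notin> r" using y 3(2)[OF xy(2)] r(3) by (auto simp: antisym_def)
        then show ?thesis
          using summand_order_iff(2)[OF refl refl \<gamma>y(1)] True y by (simp add: \<gamma>_def)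
      next
        case False
        note \<gamma>x = inv[OF xy(1) False]
        show ?thesis
          using summand_order_iff(3)[OF refl refl \<gamma>x(1) \<gamma>y(1)] \<gamma>x(2) \<gamma>y(2) False y
          by (simp add: \<gamma>_def)
      qed
    qed
    have "algebra_isomorphic (incidence_algebra S (summand_order (2 * N) D {..<2 * N} swap)
        :: ('k, _) module) (incidence_algebra P r)"
      by (rule incidence_algebra_relabel[OF bij r(1) _ mono]) (auto simp: summand_order_def)
    then show ?thesis by (rule doubled_order_realises[where I = I, OF assms(3)[OF tiled]])
  qed
qed

end
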